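(* Let $\ell$ be an odd prime, $N$ a finite group of order not divisible by $\ell$, and $K$ a complete discrete valuation field of characteristic zero and residue characteristic $\ell$ which is an unramified extension of $\mathbf{Q}_\ell$. Let $W$ be a nonzero $K$-vector space which is an absolutely simple faithful symplectic $K[N]$-module. Let $G=N\times\mu_\ell$ and $V=W\otimes_K K(\zeta_\ell)$, where $N$ acts on $W$ and $\mu_\ell$ acts on $K(\zeta_\ell)$ by multiplication. Then $V$ carries a natural structure of a faithful symplectic $K[G]$-module (with form $f_1\otimes f_2$, where $f_1$ is the given alternating form on $W$ and $f_2(\alpha,\beta)=\mathrm{tr}_{K(\zeta_\ell)/K}(\alpha\bar\beta)$, $\bar{\ }$ being the automorphism sending $\zeta_\ell$ to $\zeta_\ell^{-1}$), but there is no $G$-stable $\mathcal{O}_K$-lattice $T$ in $V$ with a perfect alternating $G$-invariant pairing $f':T\times T\to\mathcal{O}_K$.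
   Context: $\zeta_\ell$ is a primitive $\ell$-th root of unity and $\mu_\ell$ the group it generates. A $K[N]$-module is symplectic if it carries a nondegenerate $N$-invariant alternating $K$-bilinear form. $\mathcal{O}_K$ is the valuation ring of $K$. A bilinear form on a free $\mathcal{O}_K$-module $T$ is perfect if the induced maps $T\to\mathrm{Hom}(T,\mathcal{O}_K)$ are bijective. *)

theory Defs
  imports
    "HOL-Algebra.Algebraic_Closure_Type"
    "HOL-Algebra.Generated_Fields"
    "HOL-Algebra.Group_Action"
    "HOL-Library.Poly_Mapping"
begin

text \<open>
  Fields and vector spaces are types, with the scalar multiplication of a vector space passed
  explicitly, as in \<open>HOL.Vector_Spaces\<close>. Groups are \<open>HOL-Algebra\<close> groups.
\<close>

section \<open>Complete discrete valuation fields\<close>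

text \<open>
  A normalised valuation is an integer-valued function; its value at \<open>0\<close> is irrelevant and
  stands for infinity.
\<close>

locale complete_dvf =
  fixes v :: "'k::field \<Rightarrow> int"
  assumes v_mult: "\<And>x y. x \<noteq> 0 \<Longrightarrow> y \<noteq> 0 \<Longrightarrow> v (x * y) = v x + v y"
    and v_add: "\<And>x y. x \<noteq> 0 \<Longrightarrow> y \<noteq> 0 \<Longrightarrow> x + y \<noteq> 0 \<Longrightarrow> min (v x) (v y) \<le> v (x + y)"
    and v_uniformizer: "\<exists>x. x \<noteq> 0 \<and> v x = 1"
    and complete: "\<And>u :: nat \<Rightarrow> 'k.
      (\<forall>n. \<exists>M. \<forall>i\<ge>M. \<forall>j\<ge>M. u i = u j \<or> n \<le> v (u i - u j)) \<Longrightarrow>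
      \<exists>x. \<forall>n. \<exists>M. \<forall>i\<ge>M. u i = x \<or> n \<le> v (u i - x)"

definition val_ring :: "('k::field \<Rightarrow> int) \<Rightarrow> 'k set"
  where "val_ring v = {x. x = 0 \<or> 0 \<le> v x}"

definition val_ideal :: "('k::field \<Rightarrow> int) \<Rightarrow> 'k set"
  where "val_ideal v = {x. x = 0 \<or> 0 < v x}"

definition residue_char :: "('k::field \<Rightarrow> int) \<Rightarrow> nat \<Rightarrow> bool"
  where "residue_char v p \<longleftrightarrow> (\<forall>n. of_nat n \<in> val_ideal v \<longleftrightarrow> p dvd n)"

text \<open>
  A complete field of characteristic \<open>0\<close> and residue characteristic \<open>p\<close> contains \<open>\<rat>\<^sub>p\<close> as the
  closure of its prime field. It is unramified over \<open>\<rat>\<^sub>p\<close> when the prime element \<open>p\<close> of \<open>\<rat>\<^sub>p\<close>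
  generates its maximal ideal; the residue field extension is automatically separable, since
  the residue field of \<open>\<rat>\<^sub>p\<close> is perfect.
\<close>

definition unramified_over_Qp :: "('k::field \<Rightarrow> int) \<Rightarrow> nat \<Rightarrow> bool"
  where "unramified_over_Qp v p \<longleftrightarrow> val_ideal v = (\<lambda>x. of_nat p * x) ` val_ring v"


section \<open>Field extensions\<close>

definition field_extension :: "('k::field \<Rightarrow> 'l::field) \<Rightarrow> bool"
  where "field_extension \<iota> \<longleftrightarrow> \<iota> \<in> ring_hom ring_of_type_algebra ring_of_type_algebra"

definition ext_scale :: "('k::field \<Rightarrow> 'l::field) \<Rightarrow> 'k \<Rightarrow> 'l \<Rightarrow> 'l"
  where "ext_scale \<iota> a x = \<iota> a * x"

definition generated_over :: "('k::field \<Rightarrow> 'l::field) \<Rightarrow> 'l \<Rightarrow> bool"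
  where "generated_over \<iota> x \<longleftrightarrow> generate_field ring_of_type_algebra (insert x (range \<iota>)) = UNIV"

definition ext_automorphism :: "('k::field \<Rightarrow> 'l::field) \<Rightarrow> ('l \<Rightarrow> 'l) \<Rightarrow> bool"
  where "ext_automorphism \<iota> \<sigma> \<longleftrightarrow>
    \<sigma> \<in> ring_iso ring_of_type_algebra ring_of_type_algebra \<and> (\<forall>a. \<sigma> (\<iota> a) = \<iota> a)"

definition primitive_root_of_unity :: "nat \<Rightarrow> 'l::field \<Rightarrow> bool"
  where "primitive_root_of_unity n z \<longleftrightarrow> z ^ n = 1 \<and> (\<forall>k. 0 < k \<and> k < n \<longrightarrow> z ^ k \<noteq> 1)"

definition root_group :: "'l::field \<Rightarrow> 'l monoid"
  where "root_group z = \<lparr>carrier = range (\<lambda>i::nat. z ^ i), monoid.mult = (*), one = 1\<rparr>"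

text \<open>The trace of an endomorphism of a finite-dimensional space, via the diagonal of its matrix.\<close>

definition lin_trace :: "('a::field \<Rightarrow> 'b::ab_group_add \<Rightarrow> 'b) \<Rightarrow> ('b \<Rightarrow> 'b) \<Rightarrow> 'a"
  where "lin_trace s F =
    (let B = (SOME B. \<not> module.dependent s B \<and> module.span s B = UNIV)
     in \<Sum>b\<in>B. module.representation s B (F b) b)"

definition field_trace :: "('k::field \<Rightarrow> 'l::field) \<Rightarrow> 'l \<Rightarrow> 'k"
  where "field_trace \<iota> x = lin_trace (ext_scale \<iota>) (\<lambda>y. x * y)"


section \<open>Tensor products\<close>

definition bilinear_map ::
  "('a::field \<Rightarrow> 'b::ab_group_add \<Rightarrow> 'b) \<Rightarrow> ('a \<Rightarrow> 'c::ab_group_add \<Rightarrow> 'c) \<Rightarrow>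
   ('a \<Rightarrow> 'd::ab_group_add \<Rightarrow> 'd) \<Rightarrow> ('b \<Rightarrow> 'c \<Rightarrow> 'd) \<Rightarrow> bool"
  where "bilinear_map s1 s2 s3 f \<longleftrightarrow>
    (\<forall>x. Vector_Spaces.linear s2 s3 (f x)) \<and> (\<forall>y. Vector_Spaces.linear s1 s3 (\<lambda>x. f x y))"

definition free_scale :: "'a::field \<Rightarrow> ('i \<Rightarrow>\<^sub>0 'a) \<Rightarrow> ('i \<Rightarrow>\<^sub>0 'a)"
  where "free_scale a p = Poly_Mapping.map ((*) a) p"

definition free_lift ::
  "('a::field \<Rightarrow> 'd::ab_group_add \<Rightarrow> 'd) \<Rightarrow> ('i \<Rightarrow> 'd) \<Rightarrow> ('i \<Rightarrow>\<^sub>0 'a) \<Rightarrow> 'd"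
  where "free_lift s f p = (\<Sum>i\<in>Poly_Mapping.keys p. s (Poly_Mapping.lookup p i) (f i))"

definition tensor_relations ::
  "('a::field \<Rightarrow> 'b::ab_group_add \<Rightarrow> 'b) \<Rightarrow> ('a \<Rightarrow> 'c::ab_group_add \<Rightarrow> 'c) \<Rightarrow>
   ('b \<times> 'c \<Rightarrow>\<^sub>0 'a) set"
  where "tensor_relations s1 s2 =
    {Poly_Mapping.single (x + x', y) 1 - Poly_Mapping.single (x, y) 1
       - Poly_Mapping.single (x', y) 1 | x x' y. True} \<union>
    {Poly_Mapping.single (x, y + y') 1 - Poly_Mapping.single (x, y) 1
       - Poly_Mapping.single (x, y') 1 | x y y'. True} \<union>
    {Poly_Mapping.single (s1 a x, y) 1 - Poly_Mapping.single (x, y) a | a x y. True} \<union>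
    {Poly_Mapping.single (x, s2 a y) 1 - Poly_Mapping.single (x, y) a | a x y. True}"

text \<open>
  \<open>V\<close> (with scalar multiplication \<open>s3\<close>) and \<open>t\<close> are the tensor product of the two spaces with
  its canonical map \<open>(x, y) \<mapsto> x \<otimes> y\<close>: the linear extension of \<open>t\<close> to the free vector space on
  the pairs identifies \<open>V\<close> with the quotient by the span of the bilinearity relations. The
  tensor product is given by this predicate, and not as a type constructor, because a HOL type
  cannot depend on the scalar multiplications \<open>s1\<close> and \<open>s2\<close>.
\<close>

definition is_tensor_product ::
  "('a::field \<Rightarrow> 'b::ab_group_add \<Rightarrow> 'b) \<Rightarrow> ('a \<Rightarrow> 'c::ab_group_add \<Rightarrow> 'c) \<Rightarrow>
   ('a \<Rightarrow> 'd::ab_group_add \<Rightarrow> 'd) \<Rightarrow> ('b \<Rightarrow> 'c \<Rightarrow> 'd) \<Rightarrow> bool"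
  where "is_tensor_product s1 s2 s3 t \<longleftrightarrow>
    vector_space s1 \<and> vector_space s2 \<and> vector_space s3 \<and>
    range (free_lift s3 (case_prod t)) = UNIV \<and>
    {p. free_lift s3 (case_prod t) p = 0} = module.span free_scale (tensor_relations s1 s2)"

lemma lookup_free_scale: "Poly_Mapping.lookup (free_scale a p) i = a * Poly_Mapping.lookup p i"
  by (simp add: free_scale_def map.rep_eq when_def)

lemma vector_space_free_scale: "vector_space (free_scale :: 'a::field \<Rightarrow> _)"
  by unfold_locales
    (auto intro!: poly_mapping_eqI simp: lookup_free_scale lookup_add algebra_simps)

lemma linear_free_lift:
  fixes s :: "'a::field \<Rightarrow> 'b::ab_group_add \<Rightarrow> 'b" and f :: "'c \<Rightarrow> 'b"
  assumes "vector_space s"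
  shows "Vector_Spaces.linear free_scale s (free_lift s f)"
proof -
  interpret vector_space s by fact
  have ext: "free_lift s f p = (\<Sum>i\<in>A. s (Poly_Mapping.lookup p i) (f i))"
    if "finite A" "Poly_Mapping.keys p \<subseteq> A" for p :: "'c \<Rightarrow>\<^sub>0 'a" and A
    unfolding free_lift_def
    by (rule sum.mono_neutral_left) (use that in \<open>auto simp: in_keys_iff\<close>)
  show ?thesis
  proof (intro Vector_Spaces.linear.intro module_hom.intro module_hom_axioms.intro vector_space_free_scale assms)
    show "Modules.module free_scale"
      using vector_space_free_scale by (simp add: module_iff_vector_space)
    show "Modules.module s" by unfold_locales
    fix p q :: "'c \<Rightarrow>\<^sub>0 'a"
    have "Poly_Mapping.keys (p + q) \<subseteq> Poly_Mapping.keys p \<union> Poly_Mapping.keys q"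
      by (rule Poly_Mapping.keys_add)
    then show "free_lift s f (p + q) = free_lift s f p + free_lift s f q"
      by (subst (1 2 3) ext[of "Poly_Mapping.keys p \<union> Poly_Mapping.keys q"])
        (auto simp: lookup_add scale_left_distrib sum.distrib)
  next
    fix c and p :: "'c \<Rightarrow>\<^sub>0 'a"
    have "Poly_Mapping.keys (free_scale c p) \<subseteq> Poly_Mapping.keys p"
      by (auto simp: in_keys_iff lookup_free_scale)
    then show "free_lift s f (free_scale c p) = s c (free_lift s f p)"
      by (subst (1 2) ext[of "Poly_Mapping.keys p"])
        (auto simp: lookup_free_scale scale_sum_right)
  qed
qed

lemma free_lift_single:
  assumes "vector_space s"
  shows "free_lift s f (Poly_Mapping.single i a) = s a (f i)"
proof -
  interpret vector_space s by fact
  show ?thesis by (simp add: free_lift_def)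
qed

lemma tensor_relations_kernel:
  assumes b: "bilinear_map s1 s2 s3 b" and "p \<in> module.span free_scale (tensor_relations s1 s2)"
  shows "free_lift s3 (case_prod b) p = 0"
proof -
  have lin: "Vector_Spaces.linear s2 s3 (b x)" "Vector_Spaces.linear s1 s3 (\<lambda>x. b x y)" for x y
    using b by (auto simp: bilinear_map_def)
  have V: "vector_space s1" "vector_space s2" "vector_space s3"
    using lin by (auto simp: Vector_Spaces.linear_def)
  interpret F: Vector_Spaces.linear free_scale s3 "free_lift s3 (case_prod b)"
    by (rule linear_free_lift) fact
  interpret B1: Vector_Spaces.linear s2 s3 "b x" for x by (rule lin)
  interpret B2: Vector_Spaces.linear s1 s3 "\<lambda>x. b x y" for y by (rule lin)
  note [simp] = free_lift_single[OF V(3)] F.diff B1.add B2.add B1.scale B2.scale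
  show ?thesis
    using assms(2)
  proof (induction rule: F.vs1.span_induct)
    case base
    have "F.vs1.subspace {p. free_lift s3 (case_prod b) p = 0}" by (rule F.subspace_kernel)
    then show ?case by (simp add: Collect_mono_iff)
  next
    case (step x)
    then show ?case unfolding tensor_relations_def by auto
  qed
qed

lemma is_tensor_product_bilinear:
  assumes "is_tensor_product s1 s2 s3 t"
  shows "bilinear_map s1 s2 s3 t"
proof -
  have V: "vector_space s1" "vector_space s2" "vector_space s3"
    and ker: "{p. free_lift s3 (case_prod t) p = 0} = module.span free_scale (tensor_relations s1 s2)"
    using assms by (auto simp: is_tensor_product_def)
  interpret F: Vector_Spaces.linear free_scale s3 "free_lift s3 (case_prod t)"
    by (rule linear_free_lift) fact
  interpret V1: vector_space s1 by fact
  interpret V2: vector_space s2 by fact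
  have k: "free_lift s3 (case_prod t) p = 0" if "p \<in> tensor_relations s1 s2" for p
    using that ker F.vs1.span_base by blast
  interpret V3: vector_space s3 by fact
  note [simp] = free_lift_single[OF V(3)] F.diff
  have "t (x + x') y = t x y + t x' y" for x x' y
  proof -
    have "Poly_Mapping.single (x + x', y) 1 - Poly_Mapping.single (x, y) 1
       - Poly_Mapping.single (x', y) 1 \<in> tensor_relations s1 s2"
      unfolding tensor_relations_def by blast
    from k[OF this] show ?thesis by (simp add: diff_eq_eq add.commute)
  qed
  moreover have "t x (y + y') = t x y + t x y'" for x y y'
  proof -
    have "Poly_Mapping.single (x, y + y') 1 - Poly_Mapping.single (x, y) 1
       - Poly_Mapping.single (x, y') 1 \<in> tensor_relations s1 s2"
      unfolding tensor_relations_def by blast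
    from k[OF this] show ?thesis by (simp add: diff_eq_eq add.commute)
  qed
  moreover have "t (s1 a x) y = s3 a (t x y)" for a x y
  proof -
    have "Poly_Mapping.single (s1 a x, y) 1 - Poly_Mapping.single (x, y) a \<in> tensor_relations s1 s2"
      unfolding tensor_relations_def by blast
    from k[OF this] show ?thesis by simp
  qed
  moreover have "t x (s2 a y) = s3 a (t x y)" for a x y
  proof -
    have "Poly_Mapping.single (x, s2 a y) 1 - Poly_Mapping.single (x, y) a \<in> tensor_relations s1 s2"
      unfolding tensor_relations_def by blast
    from k[OF this] show ?thesis by simp
  qed
  ultimately show ?thesis
    unfolding bilinear_map_def
    by (auto intro!: Vector_Spaces.linear.intro module_hom.intro module_hom_axioms.intro V
      simp: module_iff_vector_space V)
qed

lemma tensor_product_universal: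
  assumes t: "is_tensor_product s1 s2 s3 t" and b: "bilinear_map s1 s2 s4 b"
  shows "\<exists>!h. Vector_Spaces.linear s3 s4 h \<and> (\<forall>x y. h (t x y) = b x y)"
proof -
  let ?T = "free_lift s3 (case_prod t)" and ?B = "free_lift s4 (case_prod b)"
  have V: "vector_space s3" "vector_space s4" and surj: "range ?T = UNIV"
    and ker: "{p. ?T p = 0} = module.span free_scale (tensor_relations s1 s2)"
    using t b by (auto simp: is_tensor_product_def bilinear_map_def Vector_Spaces.linear_def)
  interpret T: Vector_Spaces.linear free_scale s3 ?T by (rule linear_free_lift) fact
  interpret B: Vector_Spaces.linear free_scale s4 ?B by (rule linear_free_lift) fact
  have wd: "?B p = ?B q" if "?T p = ?T q" for p q
  proof -
    have "?T (p - q) = 0" using that by (simp add: T.diff)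
    then have "?B (p - q) = 0" using tensor_relations_kernel[OF b] ker by blast
    then show ?thesis by (simp add: B.diff)
  qed
  define h where "h x = ?B (SOME p. ?T p = x)" for x
  have hT: "h (?T p) = ?B p" for p
    unfolding h_def by (rule wd, rule someI[of "\<lambda>q. ?T q = ?T p"]) simp
  have ex: "\<exists>p. x = ?T p" for x using surj by (metis rangeE UNIV_I)
  show ?thesis
  proof (intro ex1I conjI allI)
    show "Vector_Spaces.linear s3 s4 h"
    proof (intro Vector_Spaces.linear.intro module_hom.intro module_hom_axioms.intro V)
      show "Modules.module s3" "Modules.module s4" using V by (simp_all add: module_iff_vector_space)
      show "h (x + y) = h x + h y" for x y
        using ex[of x] ex[of y] by (auto simp flip: T.add simp: hT B.add)
      show "h (s3 c x) = s4 c (h x)" for c x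
        using ex[of x] by (auto simp flip: T.scale simp: hT B.scale)
    qed
    show "h (t x y) = b x y" for x y
      using hT[of "Poly_Mapping.single (x, y) 1"]
      by (simp add: free_lift_single V B.vs2.scale_one T.vs2.scale_one)
    fix h' assume h': "Vector_Spaces.linear s3 s4 h' \<and> (\<forall>x y. h' (t x y) = b x y)"
    interpret H: Vector_Spaces.linear s3 s4 h' using h' by blast
    have "h' (?T p) = ?B p" for p
      using h' by (simp add: free_lift_def H.sum H.scale split_beta)
    then show "h' = h" using ex hT by (metis ext)
  qed
qed


section \<open>Modules over group algebras\<close>

text \<open>
  A \<open>K[G]\<close>-module is a \<open>K\<close>-vector space with a \<open>K\<close>-linear action of \<open>G\<close>. It is faithful if \<open>G\<close>
  acts faithfully (\<open>faithful_action\<close>).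
\<close>

definition group_module ::
  "('g, 'm) monoid_scheme \<Rightarrow> ('a::field \<Rightarrow> 'b::ab_group_add \<Rightarrow> 'b) \<Rightarrow> ('g \<Rightarrow> 'b \<Rightarrow> 'b) \<Rightarrow> bool"
  where "group_module G s \<rho> \<longleftrightarrow> vector_space s \<and> group_action G UNIV \<rho> \<and>
    (\<forall>g\<in>carrier G. Vector_Spaces.linear s s (\<rho> g))"

definition symplectic_form ::
  "('g, 'm) monoid_scheme \<Rightarrow> ('a::field \<Rightarrow> 'b::ab_group_add \<Rightarrow> 'b) \<Rightarrow> ('g \<Rightarrow> 'b \<Rightarrow> 'b) \<Rightarrow>
   ('b \<Rightarrow> 'b \<Rightarrow> 'a) \<Rightarrow> bool"
  where "symplectic_form G s \<rho> f \<longleftrightarrow> bilinear_map s s (*) f \<and> (\<forall>x. f x x = 0) \<and>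
    (\<forall>x. (\<forall>y. f x y = 0) \<longrightarrow> x = 0) \<and>
    (\<forall>g\<in>carrier G. \<forall>x y. f (\<rho> g x) (\<rho> g y) = f x y)"

definition simple_module ::
  "('g, 'm) monoid_scheme \<Rightarrow> ('a::field \<Rightarrow> 'b::ab_group_add \<Rightarrow> 'b) \<Rightarrow> ('g \<Rightarrow> 'b \<Rightarrow> 'b) \<Rightarrow> bool"
  where "simple_module G s \<rho> \<longleftrightarrow> group_module G s \<rho> \<and> (\<exists>x::'b. x \<noteq> 0) \<and>
    (\<forall>S. module.subspace s S \<and> (\<forall>g\<in>carrier G. \<rho> g ` S \<subseteq> S) \<longrightarrow> S = {0} \<or> S = UNIV)"

text \<open>
  \<open>(sU, \<rho>U)\<close> is the extension of scalars of the module \<open>(s, \<rho>)\<close> along \<open>j\<close>, with canonical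
  map \<open>t\<close>.
\<close>

definition scalar_extension ::
  "('a::field \<Rightarrow> 'e::field) \<Rightarrow> ('g, 'm) monoid_scheme \<Rightarrow>
   ('a \<Rightarrow> 'b::ab_group_add \<Rightarrow> 'b) \<Rightarrow> ('g \<Rightarrow> 'b \<Rightarrow> 'b) \<Rightarrow>
   ('e \<Rightarrow> 'u::ab_group_add \<Rightarrow> 'u) \<Rightarrow> ('g \<Rightarrow> 'u \<Rightarrow> 'u) \<Rightarrow> ('b \<Rightarrow> 'e \<Rightarrow> 'u) \<Rightarrow> bool"
  where "scalar_extension j G s \<rho> sU \<rho>U t \<longleftrightarrow>
    is_tensor_product s (ext_scale j) (\<lambda>a. sU (j a)) t \<and>
    vector_space sU \<and> (\<forall>c x e. sU c (t x e) = t x (c * e)) \<and>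
    group_module G sU \<rho>U \<and> (\<forall>g\<in>carrier G. \<forall>x e. \<rho>U g (t x e) = t (\<rho> g x) e)"

text \<open>
  Simplicity over the algebraic closure. The type argument only supplies the type that carries
  a copy of \<open>W \<otimes> K_closure\<close>.
\<close>

definition absolutely_simple ::
  "'u::ab_group_add itself \<Rightarrow> ('g, 'm) monoid_scheme \<Rightarrow>
   ('a::field \<Rightarrow> 'b::ab_group_add \<Rightarrow> 'b) \<Rightarrow> ('g \<Rightarrow> 'b \<Rightarrow> 'b) \<Rightarrow> bool"
  where "absolutely_simple (_ :: 'u itself) G s \<rho> \<longleftrightarrow> group_module G s \<rho> \<and>
    (\<exists>(sU :: 'a alg_closure \<Rightarrow> 'u \<Rightarrow> 'u) \<rho>U t.
       scalar_extension to_ac G s \<rho> sU \<rho>U t \<and> simple_module G sU \<rho>U)"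


section \<open>Lattices\<close>

definition is_lattice ::
  "('k::field \<Rightarrow> int) \<Rightarrow> ('k \<Rightarrow> 'b::ab_group_add \<Rightarrow> 'b) \<Rightarrow> 'b set \<Rightarrow> bool"
  where "is_lattice v s T \<longleftrightarrow>
    (\<exists>B. finite B \<and> \<not> module.dependent s B \<and> module.span s B = UNIV \<and>
       T = {\<Sum>b\<in>B. s (c b) b | c. \<forall>b\<in>B. c b \<in> val_ring v})"

definition lattice_dual ::
  "('k::field \<Rightarrow> int) \<Rightarrow> ('k \<Rightarrow> 'b::ab_group_add \<Rightarrow> 'b) \<Rightarrow> 'b set \<Rightarrow> ('b \<Rightarrow> 'k) set"
  where "lattice_dual v s T =
    {\<phi> \<in> T \<rightarrow>\<^sub>E val_ring v.
       (\<forall>x\<in>T. \<forall>y\<in>T. \<phi> (x + y) = \<phi> x + \<phi> y) \<and>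
       (\<forall>a\<in>val_ring v. \<forall>x\<in>T. \<phi> (s a x) = a * \<phi> x)}"

text \<open>
  A pairing on \<open>T\<close> is bilinear over the valuation ring and integral precisely when both induced
  maps take values in \<open>lattice_dual v s T\<close>.
\<close>

definition lattice_pairing ::
  "('k::field \<Rightarrow> int) \<Rightarrow> ('k \<Rightarrow> 'b::ab_group_add \<Rightarrow> 'b) \<Rightarrow> 'b set \<Rightarrow> ('b \<Rightarrow> 'b \<Rightarrow> 'k) \<Rightarrow> bool"
  where "lattice_pairing v s T f \<longleftrightarrow>
    (\<forall>x\<in>T. restrict (\<lambda>y. f x y) T \<in> lattice_dual v s T) \<and>
    (\<forall>y\<in>T. restrict (\<lambda>x. f x y) T \<in> lattice_dual v s T)"

definition perfect_pairing ::
  "('k::field \<Rightarrow> int) \<Rightarrow> ('k \<Rightarrow> 'b::ab_group_add \<Rightarrow> 'b) \<Rightarrow> 'b set \<Rightarrow> ('b \<Rightarrow> 'b \<Rightarrow> 'k) \<Rightarrow> bool"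
  where "perfect_pairing v s T f \<longleftrightarrow> lattice_pairing v s T f \<and>
    bij_betw (\<lambda>x. restrict (\<lambda>y. f x y) T) T (lattice_dual v s T) \<and>
    bij_betw (\<lambda>y. restrict (\<lambda>x. f x y) T) T (lattice_dual v s T)"

end

theory Submission
  imports Defs
begin

text \<open>
  Write \<open>\<O>\<close> for the valuation ring of \<open>K\<close> and \<open>L = K(\<zeta>)\<close>. By Schur's lemma over the algebraic closure, an
  \<open>N\<close>-invariant bilinear form on \<open>W\<close> is a multiple of \<open>f\<^sub>1\<close>, so an invariant alternating pairing on a
  lattice \<open>T\<close> extends to \<open>V\<close> as \<open>(x \<otimes> \<alpha>, y \<otimes> \<beta>) \<mapsto> c(\<alpha>, \<beta>) f(x, y)\<close>, where \<open>f\<close> is \<open>f\<^sub>1\<close> up to a scalar and \<open>c\<close> is a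
  symmetric \<open>K\<close>-bilinear form on \<open>L\<close> with \<open>c(\<zeta>\<alpha>, \<zeta>\<beta>) = c(\<alpha>, \<beta>)\<close>. As \<open>|N|\<close> is a unit, the Schur
  orthogonality relations show that for a suitable \<open>w\<close> the projection \<open>x \<otimes> \<alpha> \<mapsto> w \<otimes> f(x, w) \<alpha>\<close> preserves \<open>T\<close>.
  If the pairing is perfect, it follows that \<open>c\<close> is unimodular on the \<open>\<O>[\<zeta>]\<close>-module
  \<open>M = {\<alpha>. w \<otimes> \<alpha> \<in> T}\<close>. Let \<open>\<pi> = \<eta> - 1/\<eta>\<close> with \<open>\<eta>\<close> the square root of \<open>\<zeta>\<close> in \<open>\<mu>\<^sub>l\<close>. It is skew-adjoint for
  \<open>c\<close> and \<open>\<pi>^(l-1)\<close> is \<open>l\<close> times a unit. Hence \<open>c(\<pi>^(l-2) \<alpha>, \<beta>)\<close> is alternating,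
  as \<open>l - 2\<close> is odd, and induces a nondegenerate form on \<open>M / \<pi> M\<close>. But this space is a line over the
  residue field, because \<open>K\<close> is unramified, so it carries no nondegenerate alternating form.
\<close>

section \<open>Valuations\<close>

text \<open>The obstruction is a parity. Invariant symmetric forms on L are tr(u \<alpha> \<beta>'),
  where the dash is conjugation and u = u'. Replacing M by \<pi> M, or changing u, moves the dual of
  M relative to M by an even power of \<pi>, while the inverse different of \<O>[\<zeta>] is
  \<pi>^(2-l) \<O>[\<zeta>], of odd exponent. This is the origin of l - 2: being odd, it turns the
  symmetric form into an alternating one; being one short of l - 1, it makes the twisted form
  divisible by l as soon as one argument lies in \<pi> M. A splitting of T as a lattice of W
  tensored with M is avoided. A single element of the group algebra, the sum of f(g w, w) g^(-1),
  has integral coefficients and acts as C times the projection, with 1 / C integral; choosing f and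
  w so that some f(h w, w) is 1 makes c integral on M as well. No valuation on L is constructed:
  that M / \<pi> M is a line appears as integrality of the coefficients when \<beta> / \<alpha> is
  expanded in powers of \<zeta> - 1.\<close>

locale unramified_dvf = complete_dvf v for v :: "'k::field_char_0 \<Rightarrow> int" +
  fixes l :: nat
  assumes prime_l: "prime l" and odd_l: "odd l"
    and residue: "residue_char v l" and unramified: "unramified_over_Qp v l"
begin

lemma v_one [simp]: "v 1 = 0"
  using v_mult[of 1 1] by simp

lemma v_minus_one [simp]: "v (- 1) = 0"
  using v_mult[of "-1" "-1"] by simp

lemma v_minus [simp]: "v (- x) = v x"
  using v_mult[of "-1" x] by (cases "x = 0") auto

lemma v_inverse: "x \<noteq> 0 \<Longrightarrow> v (inverse x) = - v x"
  using v_mult[of x "inverse x"] by simp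

lemma v_divide: "x \<noteq> 0 \<Longrightarrow> y \<noteq> 0 \<Longrightarrow> v (x / y) = v x - v y"
  by (simp add: divide_inverse v_mult v_inverse)

lemma v_power: "x \<noteq> 0 \<Longrightarrow> v (x ^ n) = int n * v x"
  by (induction n) (auto simp: v_mult algebra_simps)

lemma val_ring_0 [simp]: "0 \<in> val_ring v"
  and val_ring_1 [simp]: "1 \<in> val_ring v"
  by (auto simp: val_ring_def)

lemma val_ring_add: "x \<in> val_ring v \<Longrightarrow> y \<in> val_ring v \<Longrightarrow> x + y \<in> val_ring v"
  using v_add[of x y] by (cases "x = 0"; cases "y = 0"; cases "x + y = 0") (auto simp: val_ring_def)

lemma val_ring_mult: "x \<in> val_ring v \<Longrightarrow> y \<in> val_ring v \<Longrightarrow> x * y \<in> val_ring v"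
  by (cases "x = 0"; cases "y = 0") (auto simp: val_ring_def v_mult)

lemma val_ring_minus [simp]: "- x \<in> val_ring v \<longleftrightarrow> x \<in> val_ring v"
  by (auto simp: val_ring_def)

lemma val_ring_diff: "x \<in> val_ring v \<Longrightarrow> y \<in> val_ring v \<Longrightarrow> x - y \<in> val_ring v"
  using val_ring_add[of x "- y"] by simp

lemma val_ring_of_nat [simp]: "of_nat n \<in> val_ring v"
  by (induction n) (auto intro: val_ring_add)

lemma l_gt_2: "l > 2"
  using prime_l odd_l prime_ge_2_nat[of l] by (cases "l = 2") auto

lemma l_pos [simp]: "0 < l" and l_neq_0 [simp]: "l \<noteq> 0"
  using l_gt_2 by auto

lemma l_ne_0: "(of_nat l :: 'k) \<noteq> 0"
  by simp

text \<open>Both hypotheses on l enter: residue characteristic l gives v(l) > 0, and unramifiedness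
  writes an element of valuation 1 as l times an integral one, so that v(l) \<le> 1.\<close>

lemma v_l: "v (of_nat l) = 1"
proof -
  obtain x where x: "x \<noteq> 0" "v x = 1" using v_uniformizer by blast
  then have "x \<in> val_ideal v" by (simp add: val_ideal_def)
  then obtain y where y: "x = of_nat l * y" "y \<in> val_ring v"
    using unramified by (auto simp: unramified_over_Qp_def)
  then have "v x = v (of_nat l) + v y" "v y \<ge> 0"
    using x v_mult[of "of_nat l" y] by (auto simp: val_ring_def)
  moreover have "v (of_nat l) > 0"
  proof -
    have "of_nat l \<in> val_ideal v" using residue by (simp add: residue_char_def)
    then show ?thesis using l_ne_0 unfolding val_ideal_def by blast
  qed
  ultimately show ?thesis using x by simp
qed

lemma v_of_nat_coprime:
  assumes "\<not> l dvd n"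
  shows "v (of_nat n) = 0"
proof -
  have "of_nat n \<notin> val_ideal v" using assms residue by (auto simp: residue_char_def)
  moreover have "of_nat n \<in> val_ring v" by simp
  ultimately show ?thesis by (auto simp: val_ring_def val_ideal_def)
qed

text \<open>As l is a uniformizer, its integral multiples form the maximal ideal. Zero is listed
  apart because \<open>v 0\<close> carries no meaning.\<close>

lemma l_multiple_iff: "(\<exists>y\<in>val_ring v. x = of_nat l * y) \<longleftrightarrow> x = 0 \<or> v x \<ge> 1"
proof
  assume "\<exists>y\<in>val_ring v. x = of_nat l * y"
  then obtain y where "y \<in> val_ring v" "x = of_nat l * y" by blast
  then show "x = 0 \<or> v x \<ge> 1"
    using v_mult[OF l_ne_0, of y] by (cases "y = 0") (auto simp: val_ring_def v_l)
next
  assume "x = 0 \<or> v x \<ge> 1"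
  then have "x / of_nat l \<in> val_ring v"
    by (cases "x = 0") (auto simp: val_ring_def v_divide v_l)
  then show "\<exists>y\<in>val_ring v. x = of_nat l * y"
    by (rule bexI[rotated]) simp
qed

text \<open>Otherwise 1 = (1 - l a) + l a would lie in the maximal ideal. This is the unit by which
  the elimination in \<open>nakayama\<close> divides.\<close>

lemma one_minus_l_unit:
  assumes "a \<in> val_ring v"
  shows "1 - of_nat l * a \<noteq> 0" "inverse (1 - of_nat l * a) \<in> val_ring v"
proof -
  have *: "of_nat l * a = 0 \<or> v (of_nat l * a) \<ge> 1" using assms l_multiple_iff by blast
  show ne: "1 - of_nat l * a \<noteq> 0" using * by auto
  have "v (1 - of_nat l * a) = 0"
  proof (rule ccontr)
    assume a: "v (1 - of_nat l * a) \<noteq> 0"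
    have "1 - of_nat l * a \<in> val_ring v" using assms by (intro val_ring_diff val_ring_mult) auto
    with a ne have b: "v (1 - of_nat l * a) \<ge> 1" by (auto simp: val_ring_def)
    show False
    proof (cases "of_nat l * a = 0")
      case False
      then show ?thesis
        using v_add[of "1 - of_nat l * a" "of_nat l * a"] * ne b by auto
    next
      case True
      with a show ?thesis by (simp only: True diff_0_right v_one)
    qed
  qed
  then show "inverse (1 - of_nat l * a) \<in> val_ring v"
    using ne by (simp add: val_ring_def v_inverse)
qed

end

section \<open>Linear dependence\<close>

text \<open>More vectors than the dimension are dependent, and a repeated vector gives a relation by
  subtraction. Indexing by natural numbers lets the relation be read as a polynomial killing an
  element of L, or a vector under an endomorphism.\<close>

lemma (in vector_space) linear_relation:
  fixes x :: "nat \<Rightarrow> 'b"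
  assumes "finite B" and x: "\<And>i. x i \<in> span B"
  obtains n c where "\<exists>i\<le>n. c i \<noteq> 0" "(\<Sum>i\<le>n. c i *s x i) = 0"
proof (cases "inj_on x {..card B}")
  case True
  have "dependent (x ` {..card B})"
    using independent_span_bound[of B "x ` {..card B}"] assms True by (auto simp: card_image)
  then obtain u where u: "\<exists>y\<in>x ` {..card B}. u y \<noteq> 0" "(\<Sum>y\<in>x ` {..card B}. u y *s y) = 0"
    by (auto simp: dependent_finite)
  from u(2) have "(\<Sum>i\<le>card B. u (x i) *s x i) = 0" by (simp add: sum.reindex[OF True])
  then show ?thesis using that[of "card B" "\<lambda>i. u (x i)"] u(1) by auto
next
  case False
  then obtain i j where ij: "i \<noteq> j" "x i = x j" "i \<le> card B" "j \<le> card B" by (auto simp: inj_on_def)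
  define c :: "nat \<Rightarrow> 'a" where "c k = (if k = i then 1 else if k = j then - 1 else 0)" for k
  have "(\<Sum>k\<le>card B. c k *s x k) = (\<Sum>k\<in>{i, j}. c k *s x k)"
    using ij by (intro sum.mono_neutral_right) (auto simp: c_def)
  also have "\<dots> = 0" using ij by (simp add: c_def)
  finally show ?thesis using that[of "card B" c] ij by (metis c_def zero_neq_one)
qed

section \<open>The cyclotomic extension\<close>

locale cyclotomic_extension = unramified_dvf v l for v :: "'k::field_char_0 \<Rightarrow> int" and l +
  fixes \<iota> :: "'k \<Rightarrow> 'l::field" and \<zeta> :: 'l
  assumes field_extension: "field_extension \<iota>"
    and primitive: "primitive_root_of_unity l \<zeta>" and generated: "generated_over \<iota> \<zeta>"
begin

lemma \<iota>_add [simp]: "\<iota> (a + b) = \<iota> a + \<iota> b" and \<iota>_mult [simp]: "\<iota> (a * b) = \<iota> a * \<iota> b"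
  and \<iota>_1 [simp]: "\<iota> 1 = 1"
  using field_extension unfolding field_extension_def
  by (auto simp: ring_hom_def ring_of_type_algebra_def)

lemma \<iota>_0 [simp]: "\<iota> 0 = 0"
  using \<iota>_add[of 0 0] by (simp only: add_0 add_cancel_right_right)

lemma \<iota>_minus [simp]: "\<iota> (- a) = - \<iota> a"
  using \<iota>_add[of a "- a"] by (simp add: add_eq_0_iff)

lemma \<iota>_diff [simp]: "\<iota> (a - b) = \<iota> a - \<iota> b"
  using \<iota>_add[of a "- b"] by simp

lemma \<iota>_of_nat [simp]: "\<iota> (of_nat n) = of_nat n"
  by (induction n) auto

lemma \<iota>_eq_0_iff [simp]: "\<iota> a = 0 \<longleftrightarrow> a = 0"
proof
  assume "\<iota> a = 0"
  show "a = 0"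
  proof (rule ccontr)
    assume "a \<noteq> 0"
    then have "\<iota> (a * inverse a) = 1" by simp
    then show False using \<open>\<iota> a = 0\<close> by (simp del: right_inverse)
  qed
qed simp

lemma \<iota>_inverse [simp]: "\<iota> (inverse a) = inverse (\<iota> a)"
proof (cases "a = 0")
  case False
  then have "\<iota> a * \<iota> (inverse a) = 1" by (simp flip: \<iota>_mult)
  then show ?thesis by (metis inverse_unique)
qed simp

lemma \<iota>_divide [simp]: "\<iota> (a / b) = \<iota> a / \<iota> b"
  by (simp add: divide_inverse)

lemma of_nat_l_ne_0 [simp]: "(of_nat l :: 'l) \<noteq> 0"
  by (metis \<iota>_eq_0_iff \<iota>_of_nat l_ne_0)

lemma l_ge_2 [simp]: "Suc 0 < l"
  using l_gt_2 by auto

lemma zeta_pow_l [simp]: "\<zeta> ^ l = 1"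
  using primitive by (simp add: primitive_root_of_unity_def)

lemma zeta_pow_ne: "0 < k \<Longrightarrow> k < l \<Longrightarrow> \<zeta> ^ k \<noteq> 1"
  using primitive by (simp add: primitive_root_of_unity_def)

lemma zeta_ne_0 [simp]: "\<zeta> \<noteq> 0"
  using zeta_pow_l l_gt_2 by (metis power_0_left zero_neq_one not_gr_zero l_pos)

sublocale vs: vector_space "ext_scale \<iota>"
  by unfold_locales (auto simp: ext_scale_def algebra_simps)

lemma zeta_pow_inj: "inj_on (\<lambda>i. \<zeta> ^ i) {..<l}"
proof -
  have *: "i = j" if "i \<le> j" "j < l" "\<zeta> ^ i = \<zeta> ^ j" for i j
  proof (rule ccontr)
    assume "i \<noteq> j"
    have "\<zeta> ^ i * \<zeta> ^ (j - i) = \<zeta> ^ i * 1"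
      using that by (metis power_add le_add_diff_inverse mult.right_neutral)
    then have "\<zeta> ^ (j - i) = 1" by simp
    then show False using zeta_pow_ne[of "j - i"] that \<open>i \<noteq> j\<close> by simp
  qed
  show ?thesis by (rule inj_onI) (metis * lessThan_iff nat_le_linear)
qed

section \<open>The element \<theta> = \<zeta> - 1 and the factorisation of l\<close>

definition \<theta> :: 'l where "\<theta> = \<zeta> - 1"

lemma theta_ne_0 [simp]: "\<theta> \<noteq> 0"
  using zeta_pow_ne[of 1] by (simp add: \<theta>_def)

text \<open>The relation \<open>\<Phi>\<^sub>l(X + 1) = (\<Sum>i<l. (l choose i+1) X^i)\<close> at any \<open>l\<close>-th root of unity other than \<open>1\<close>.\<close>

lemma root_of_unity_relation:
  fixes z :: 'l
  assumes "z ^ l = 1" "z \<noteq> 1"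
  shows "(z - 1) ^ (l - 1) = - (\<Sum>i<l-1. of_nat (l choose Suc i) * (z - 1) ^ i)"
proof -
  have "1 = ((z - 1) + 1) ^ l" using assms by simp
  also have "\<dots> = (\<Sum>k\<le>l. of_nat (l choose k) * (z - 1) ^ k)"
    by (subst binomial_ring) simp
  also have "\<dots> = 1 + (\<Sum>i<l. of_nat (l choose Suc i) * (z - 1) ^ Suc i)"
    by (simp add: sum.atMost_shift)
  also have "(\<Sum>i<l. of_nat (l choose Suc i) * (z - 1) ^ Suc i)
      = (z - 1) * (\<Sum>i<l. of_nat (l choose Suc i) * (z - 1) ^ i)"
    by (simp add: sum_distrib_left mult_ac)
  finally have "(\<Sum>i<l. of_nat (l choose Suc i) * (z - 1) ^ i) = 0" using assms by simp
  moreover have "(\<Sum>i<l. of_nat (l choose Suc i) * (z - 1) ^ i)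
      = (\<Sum>i<l-1. of_nat (l choose Suc i) * (z - 1) ^ i) + (z - 1) ^ (l - 1)"
    using sum.lessThan_Suc[of "\<lambda>i. of_nat (l choose Suc i) * (z - 1) ^ i" "l - 1"] by simp
  ultimately show ?thesis by (simp add: add_eq_0_iff)
qed

lemmas theta_pow = root_of_unity_relation[OF zeta_pow_l, folded \<theta>_def]

text \<open>Evaluate 1 + X + ... + X^(l-1) = product of the X - \<zeta>^i at 1. The two polynomials
  have degree at most l - 1, share the coefficient there and agree at l - 1 distinct points.\<close>

lemma of_nat_l_eq_prod: "(of_nat l :: 'l) = (\<Prod>i\<in>{0<..<l}. 1 - \<zeta> ^ i)"
proof -
  define p :: "'l poly" where "p = (\<Sum>i<l. Polynomial.monom 1 i)"
  define q :: "'l poly" where "q = (\<Prod>i\<in>{0<..<l}. [:- (\<zeta> ^ i), 1:])"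
  have degq: "Polynomial.degree q = l - 1"
    unfolding q_def by (subst degree_prod_eq_sum_degree) auto
  have leadq: "Polynomial.lead_coeff q = 1"
    unfolding q_def by (simp add: lead_coeff_prod)
  have cp: "Polynomial.coeff p k = (if k < l then 1 else 0)" for k
    unfolding p_def by (simp add: coeff_sum)
  have "p = q"
  proof (rule poly_eqI_degree_lead_coeff[where A = "(\<lambda>i. \<zeta> ^ i) ` {0<..<l}" and n = "l - 1"])
    show "Polynomial.coeff p (l - 1) = Polynomial.coeff q (l - 1)"
      using leadq degq cp by simp
    have "inj_on (\<lambda>i. \<zeta> ^ i) {0<..<l}" by (rule inj_on_subset[OF zeta_pow_inj]) auto
    then show "l - 1 \<le> card ((\<lambda>i. \<zeta> ^ i) ` {0<..<l})" by (simp add: card_image)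
    show "Polynomial.degree p \<le> l - 1" by (rule degree_le) (auto simp: cp)
    show "Polynomial.degree q \<le> l - 1" by (simp add: degq)
    fix z assume "z \<in> (\<lambda>i. \<zeta> ^ i) ` {0<..<l}"
    then obtain i where i: "z = \<zeta> ^ i" "0 < i" "i < l" by auto
    have "(z - 1) * (\<Sum>i<l. z ^ i) = z ^ l - 1" by (metis power_diff_1_eq)
    also have "z ^ l = 1" using i by (metis zeta_pow_l power_mult mult.commute power_one)
    finally have "(\<Sum>i<l. z ^ i) = 0" using i zeta_pow_ne by simp
    then have "poly p z = 0" by (simp add: p_def poly_sum poly_monom)
    moreover have "poly q z = 0" using i by (auto simp: q_def poly_prod)
    ultimately show "poly p z = poly q z" by simp
  qed
  then have "poly p 1 = poly q 1" by simp
  then show ?thesis by (simp add: p_def q_def poly_sum poly_prod poly_monom)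
qed

section \<open>Modules over \<O>[\<zeta>] and their filtration by powers of \<theta>\<close>

inductive_set int_ring :: "'l set" where
  base: "a \<in> val_ring v \<Longrightarrow> \<iota> a \<in> int_ring"
| zeta: "\<zeta> \<in> int_ring"
| add: "x \<in> int_ring \<Longrightarrow> y \<in> int_ring \<Longrightarrow> x + y \<in> int_ring"
| mult: "x \<in> int_ring \<Longrightarrow> y \<in> int_ring \<Longrightarrow> x * y \<in> int_ring"

lemma int_ring_0 [simp]: "0 \<in> int_ring" and int_ring_1 [simp]: "1 \<in> int_ring"
  using int_ring.base[of 0] int_ring.base[of 1] by auto

lemma int_ring_minus: "x \<in> int_ring \<Longrightarrow> - x \<in> int_ring"
  using int_ring.mult[OF int_ring.base[of "- 1"], of x] by simp

lemma int_ring_diff: "x \<in> int_ring \<Longrightarrow> y \<in> int_ring \<Longrightarrow> x - y \<in> int_ring"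
  using int_ring.add[OF _ int_ring_minus] by fastforce

lemma int_ring_power: "x \<in> int_ring \<Longrightarrow> x ^ n \<in> int_ring"
  by (induction n) (auto intro: int_ring.mult)

lemma int_ring_sum: "(\<And>i. i \<in> I \<Longrightarrow> f i \<in> int_ring) \<Longrightarrow> sum f I \<in> int_ring"
  by (induction I rule: infinite_finite_induct) (auto intro: int_ring.add)

lemma int_ring_prod: "(\<And>i. i \<in> I \<Longrightarrow> f i \<in> int_ring) \<Longrightarrow> prod f I \<in> int_ring"
  by (induction I rule: infinite_finite_induct) (auto intro: int_ring.mult)

lemma int_ring_of_nat [simp]: "of_nat n \<in> int_ring"
  using int_ring.base[of "of_nat n"] by simp

lemma int_ring_theta: "\<theta> \<in> int_ring"
  by (simp add: \<theta>_def int_ring.zeta int_ring_diff)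

text \<open>The relation for \<theta> is of Eisenstein type: the prime l divides each binomial
  coefficient (l choose i+1) with i < l - 1.\<close>

lemma theta_pow_eq_l: "\<exists>A\<in>int_ring. \<theta> ^ (l - 1) = of_nat l * A"
proof -
  define A where "A = - (\<Sum>i<l-1. of_nat ((l choose Suc i) div l) * \<theta> ^ i)"
  have d: "l dvd (l choose Suc i)" if "i < l - 1" for i
    using that prime_l by (intro dvd_choose_prime) auto
  have "\<theta> ^ (l - 1) = - (\<Sum>i<l-1. of_nat (l choose Suc i) * \<theta> ^ i)"
    using theta_pow theta_ne_0 by (auto simp: \<theta>_def)
  also have "\<dots> = - (\<Sum>i<l-1. of_nat l * (of_nat ((l choose Suc i) div l) * \<theta> ^ i))"
  proof (intro arg_cong[where f = uminus] sum.cong refl)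
    fix i assume "i \<in> {..<l-1}"
    then have "(l choose Suc i) = l * ((l choose Suc i) div l)" using d by simp
    then have "(of_nat (l choose Suc i) :: 'l) = of_nat l * of_nat ((l choose Suc i) div l)"
      by (metis of_nat_mult)
    then show "of_nat (l choose Suc i) * \<theta> ^ i = of_nat l * (of_nat ((l choose Suc i) div l) * \<theta> ^ i)"
      by simp
  qed
  also have "\<dots> = of_nat l * A" by (simp add: A_def sum_distrib_left)
  finally show ?thesis
    by (intro bexI[of _ A]) (auto simp: A_def intro!: int_ring_minus int_ring_sum int_ring.mult
        int_ring_power int_ring_theta)
qed

text \<open>Each factor 1 - \<zeta>^i of l is \<theta> times a geometric sum in \<O>[\<zeta>]. With
  \<open>theta_pow_eq_l\<close> it follows that l and \<theta>^(l-1) generate the same ideal: l is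
  totally ramified.\<close>

lemma l_eq_theta_pow: "\<exists>A\<in>int_ring. of_nat l = \<theta> ^ (l - 1) * A"
proof -
  have "of_nat l = (\<Prod>i\<in>{0<..<l}. \<theta> * (- (\<Sum>j<i. \<zeta> ^ j)))"
  proof (subst of_nat_l_eq_prod, intro prod.cong refl)
    fix i show "1 - \<zeta> ^ i = \<theta> * (- (\<Sum>j<i. \<zeta> ^ j))"
      using power_diff_1_eq[of \<zeta> i] by (simp add: \<theta>_def algebra_simps)
  qed
  also have "\<dots> = \<theta> ^ (l - 1) * (\<Prod>i\<in>{0<..<l}. - (\<Sum>j<i. \<zeta> ^ j))"
    by (subst prod.distrib) simp
  finally show ?thesis
    by (rule bexI) (auto intro!: int_ring_minus int_ring_sum int_ring_prod int_ring_power int_ring.zeta)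
qed

definition int_submodule :: "'l set \<Rightarrow> bool" where
  "int_submodule M \<longleftrightarrow> 0 \<in> M \<and> (\<forall>x\<in>M. \<forall>y\<in>M. x + y \<in> M) \<and>
    (\<forall>a\<in>val_ring v. \<forall>x\<in>M. \<iota> a * x \<in> M) \<and> (\<forall>x\<in>M. \<zeta> * x \<in> M)"

lemma int_submodule_mult:
  assumes M: "int_submodule M"
  shows "r \<in> int_ring \<Longrightarrow> x \<in> M \<Longrightarrow> r * x \<in> M"
proof (induction r arbitrary: x rule: int_ring.induct)
  case (mult r s)
  then show ?case by (simp add: mult.assoc)
qed (use M in \<open>auto simp: int_submodule_def distrib_right\<close>)

lemma int_submodule_sum:
  assumes M: "int_submodule M"
  shows "(\<And>i. i \<in> I \<Longrightarrow> f i \<in> M) \<Longrightarrow> sum f I \<in> M"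
  using M by (induction I rule: infinite_finite_induct) (auto simp: int_submodule_def)

lemma int_submodule_image:
  assumes M: "int_submodule M"
  shows "int_submodule ((*) r ` M)"
  unfolding int_submodule_def
proof (intro conjI ballI; clarsimp?)
  show "0 \<in> (*) r ` M" using M by (auto simp: int_submodule_def intro!: image_eqI[of _ _ 0])
next
  fix x y assume "x \<in> M" "y \<in> M"
  then show "r * x + r * y \<in> (*) r ` M"
    using M by (auto simp: int_submodule_def algebra_simps intro!: image_eqI[of _ _ "x + y"])
next
  fix a x assume "a \<in> val_ring v" "x \<in> M"
  then show "\<iota> a * (r * x) \<in> (*) r ` M"
    using M by (auto simp: int_submodule_def algebra_simps intro!: image_eqI[of _ _ "\<iota> a * x"])
next
  fix x assume "x \<in> M"
  then show "\<zeta> * (r * x) \<in> (*) r ` M"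
    using M by (auto simp: int_submodule_def algebra_simps intro!: image_eqI[of _ _ "\<zeta> * x"])
qed

lemma theta_pow_mult_mono:
  assumes M: "int_submodule M" and "i \<le> j" "x \<in> (*) (\<theta> ^ j) ` M"
  shows "x \<in> (*) (\<theta> ^ i) ` M"
proof -
  from assms obtain y where y: "y \<in> M" "x = \<theta> ^ j * y" by blast
  then have "x = \<theta> ^ i * (\<theta> ^ (j - i) * y)" using assms by (simp flip: power_add mult.assoc)
  moreover have "\<theta> ^ (j - i) * y \<in> M" using y by (intro int_submodule_mult[OF M] int_ring_power int_ring_theta)
  ultimately show ?thesis by blast
qed

lemma l_mult_imp_theta_pow_mult:
  assumes M: "int_submodule M" and "x \<in> M"
  shows "of_nat l * x \<in> (*) (\<theta> ^ (l - 1)) ` M"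
  using l_eq_theta_pow int_submodule_mult[OF M _ assms(2)] by (auto simp: mult.assoc)

lemma theta_pow_mult_imp_l_mult:
  assumes M: "int_submodule M" and "x \<in> M"
  shows "\<theta> ^ (l - 1) * x \<in> (*) (of_nat l) ` M"
  using theta_pow_eq_l int_submodule_mult[OF M _ assms(2)] by (auto simp: mult.assoc)

text \<open>
  The classes of \<open>\<alpha>, \<theta> \<alpha>, \<dots>, \<theta>^(l-2) \<alpha>\<close> form a basis of \<open>M / l M\<close>, by looking at the
  filtration of \<open>M\<close> by the \<open>\<theta>^i M\<close>.
\<close>

lemma theta_expansion_integral:
  assumes M: "int_submodule M" and \<alpha>: "\<alpha> \<in> M" "\<alpha> \<notin> (*) \<theta> ` M"
    and c: "(\<Sum>i<l-1. \<iota> (c i) * \<theta> ^ i) * \<alpha> \<in> M" and i: "i < l - 1"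
  shows "c i \<in> val_ring v"
proof (rule ccontr)
  assume not: "c i \<notin> val_ring v"
  define I where "I = {i. i < l - 1 \<and> c i \<noteq> 0}"
  have "finite I" "i \<in> I" using not i by (auto simp: I_def)
  define m where "m = Min ((\<lambda>i. v (c i)) ` I)"
  have m_le: "m \<le> v (c j)" if "j \<in> I" for j using that \<open>finite I\<close> by (auto simp: m_def)
  have "m \<in> (\<lambda>i. v (c i)) ` I" unfolding m_def using \<open>finite I\<close> \<open>i \<in> I\<close> by (intro Min_in) auto
  then have ex: "\<exists>j. j \<in> I \<and> v (c j) = m" by auto
  \<comment> \<open>The expansion is going to be divided by its worst coefficient. Among those of
    least valuation the one of lowest index is taken, so that after the division all earlier
    coefficients are divisible by l.\<close>
  define j where "j = (LEAST j. j \<in> I \<and> v (c j) = m)"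
  have j: "j \<in> I" "v (c j) = m" using LeastI_ex[OF ex] by (auto simp: j_def)
  have less_j: "v (c k) > m" if "k \<in> I" "k < j" for k
  proof -
    have "\<not> (k \<in> I \<and> v (c k) = m)" using that(2) unfolding j_def by (rule not_less_Least)
    then show ?thesis using m_le[OF that(1)] that(1) by simp
  qed
  have "m < 0" using m_le[OF \<open>i \<in> I\<close>] not by (auto simp: val_ring_def)
  define d where "d k = c k / c j" for k
  have cj: "c j \<noteq> 0" "j < l - 1" using j by (auto simp: I_def)
  \<comment> \<open>Every term except the j-th will lie in \<theta>^(j+1) M, which contains l M =
    \<theta>^(l-1) M because j + 1 \<le> l - 1.\<close>
  define S where "S = (*) (\<theta> ^ Suc j) ` M"
  have S: "int_submodule S" unfolding S_def by (rule int_submodule_image[OF M])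
  have lS: "of_nat l * x \<in> S" if "x \<in> M" for x
    unfolding S_def using cj by (intro theta_pow_mult_mono[OF M _ l_mult_imp_theta_pow_mult[OF M that]]) simp
  have "v (inverse (c j)) \<ge> 1" using cj j \<open>m < 0\<close> by (simp add: v_inverse)
  then obtain e where e: "e \<in> val_ring v" "inverse (c j) = of_nat l * e"
    using l_multiple_iff by blast
  have tot: "(\<Sum>i<l-1. \<iota> (d i) * (\<theta> ^ i * \<alpha>)) \<in> S"
  proof -
    have "(\<Sum>i<l-1. \<iota> (d i) * (\<theta> ^ i * \<alpha>)) = inverse (\<iota> (c j)) * ((\<Sum>i<l-1. \<iota> (c i) * \<theta> ^ i) * \<alpha>)"
      unfolding sum_distrib_left sum_distrib_right
      by (rule sum.cong) (simp_all add: d_def divide_inverse mult_ac)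
    also have "inverse (\<iota> (c j)) = of_nat l * \<iota> e"
      using e(2) by (metis \<iota>_inverse \<iota>_mult \<iota>_of_nat)
    finally have "(\<Sum>i<l-1. \<iota> (d i) * (\<theta> ^ i * \<alpha>)) = of_nat l * (\<iota> e * ((\<Sum>i<l-1. \<iota> (c i) * \<theta> ^ i) * \<alpha>))"
      by (simp add: mult.assoc)
    then show ?thesis using c e lS int_submodule_mult[OF M int_ring.base] by simp
  qed
  have summand: "\<iota> (d k) * (\<theta> ^ k * \<alpha>) \<in> S" if "k < l - 1" "k \<noteq> j" for k
  proof (cases "k < j")
    case True
    have "c k = 0 \<or> v (d k) \<ge> 1"
      using less_j[of k] True that cj j
      by (cases "c k = 0") (auto simp: I_def d_def v_divide)
    then obtain a where a: "a \<in> val_ring v" "d k = of_nat l * a"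
      using l_multiple_iff[of "d k"] by (auto simp: d_def)
    have "\<iota> (d k) * (\<theta> ^ k * \<alpha>) = of_nat l * (\<iota> a * (\<theta> ^ k * \<alpha>))"
      by (simp add: a mult.assoc)
    moreover have "\<iota> a * (\<theta> ^ k * \<alpha>) \<in> M"
      using a \<alpha> by (intro int_submodule_mult[OF M] int_ring.base int_ring_power int_ring_theta)
    ultimately show ?thesis using lS by (simp only:)
  next
    case False
    then have "Suc j \<le> k" using that by simp
    have "\<theta> ^ k * \<alpha> \<in> S" unfolding S_def
      using \<alpha> by (intro theta_pow_mult_mono[OF M \<open>Suc j \<le> k\<close>] imageI)
    moreover have "d k \<in> val_ring v"
      using m_le[of k] that cj j
      by (cases "c k = 0") (auto simp: I_def d_def v_divide val_ring_def)
    ultimately show ?thesis using int_submodule_mult[OF S int_ring.base] by blast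
  qed
  have "\<theta> ^ j * \<alpha> = (\<Sum>i<l-1. \<iota> (d i) * (\<theta> ^ i * \<alpha>)) + (- 1) * (\<Sum>i\<in>{..<l-1}-{j}. \<iota> (d i) * (\<theta> ^ i * \<alpha>))"
  proof -
    have "(\<Sum>i<l-1. \<iota> (d i) * (\<theta> ^ i * \<alpha>))
        = \<iota> (d j) * (\<theta> ^ j * \<alpha>) + (\<Sum>i\<in>{..<l-1}-{j}. \<iota> (d i) * (\<theta> ^ i * \<alpha>))"
      using cj by (intro sum.remove) auto
    moreover have "d j = 1" using cj by (simp add: d_def)
    ultimately show ?thesis by simp
  qed
  moreover have "(\<Sum>i\<in>{..<l-1}-{j}. \<iota> (d i) * (\<theta> ^ i * \<alpha>)) \<in> S"
    using summand by (intro int_submodule_sum[OF S]) auto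
  then have "(- 1) * (\<Sum>i\<in>{..<l-1}-{j}. \<iota> (d i) * (\<theta> ^ i * \<alpha>)) \<in> S"
    by (intro int_submodule_mult[OF S] int_ring_minus int_ring_1)
  ultimately have "\<theta> ^ j * \<alpha> \<in> S"
    using S tot unfolding int_submodule_def by (simp only:)
  then obtain \<gamma> where "\<gamma> \<in> M" "\<theta> ^ j * \<alpha> = \<theta> ^ j * (\<theta> * \<gamma>)" by (auto simp: S_def mult_ac)
  then show False using \<alpha> by simp
qed

text \<open>Elimination in place of a determinant: in its own equation the last generator has the
  unit coefficient 1 - l a, so it is expressed by the others and substituted into their equations,
  which keep the factor l.\<close>

lemma nakayama:
  fixes e :: "nat \<Rightarrow> 'l"
  assumes "\<And>i. i < n \<Longrightarrow> \<exists>a. (\<forall>j. a j \<in> val_ring v) \<and> e i = of_nat l * (\<Sum>j<n. \<iota> (a j) * e j)"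
  shows "i < n \<Longrightarrow> e i = 0"
  using assms
proof (induction n arbitrary: i)
  case (Suc n)
  obtain a where a: "\<forall>j. a j \<in> val_ring v" "e n = of_nat l * (\<Sum>j<Suc n. \<iota> (a j) * e j)"
    using Suc.prems(2)[of n] by auto
  define w where "w = inverse (1 - of_nat l * a n)"
  have w: "w \<in> val_ring v" "1 - of_nat l * a n \<noteq> 0" using one_minus_l_unit a by (auto simp: w_def)
  have "\<iota> (1 - of_nat l * a n) * e n = of_nat l * (\<Sum>j<n. \<iota> (a j) * e j)"
    using a(2) by (simp add: algebra_simps)
  then have en: "e n = \<iota> w * (of_nat l * (\<Sum>j<n. \<iota> (a j) * e j))"
  proof -
    have "\<iota> w * \<iota> (1 - of_nat l * a n) = \<iota> (w * (1 - of_nat l * a n))" by (rule \<iota>_mult [symmetric])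
    also have "w * (1 - of_nat l * a n) = 1" unfolding w_def using w(2) by (rule left_inverse)
    finally have "\<iota> w * (\<iota> (1 - of_nat l * a n) * e n) = e n" by (simp only: mult.assoc [symmetric] \<iota>_1 mult_1)
    then show ?thesis using \<open>\<iota> (1 - of_nat l * a n) * e n = _\<close> by (simp only:)
  qed
  have *: "e i = 0" if "i < n" for i
  proof (rule Suc.IH[OF that])
    fix k assume "k < n"
    then obtain b where b: "\<forall>j. b j \<in> val_ring v" "e k = of_nat l * (\<Sum>j<Suc n. \<iota> (b j) * e j)"
      using Suc.prems(2)[of k] by auto
    let ?c = "\<lambda>j. b j + b n * (w * (of_nat l * a j))"
    have ek: "e k = of_nat l * (\<Sum>j<n. \<iota> (?c j) * e j)"
    proof -
      have "e k = of_nat l * ((\<Sum>j<n. \<iota> (b j) * e j) + \<iota> (b n) * e n)" using b(2) by simp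
      also have "\<iota> (b n) * e n = (\<Sum>j<n. \<iota> (b n * (w * (of_nat l * a j))) * e j)"
        by (subst en) (simp add: sum_distrib_left mult.assoc)
      also have "(\<Sum>j<n. \<iota> (b j) * e j) + \<dots> = (\<Sum>j<n. \<iota> (?c j) * e j)"
        by (simp only: sum.distrib [symmetric] \<iota>_add distrib_right)
      finally show ?thesis .
    qed
    then show "\<exists>a. (\<forall>j. a j \<in> val_ring v) \<and> e k = of_nat l * (\<Sum>j<n. \<iota> (a j) * e j)"
    proof (intro exI[of _ ?c] conjI allI ek)
      fix j show "?c j \<in> val_ring v"
        using a(1) b(1) w(1) by (intro val_ring_add val_ring_mult val_ring_of_nat) blast+
    qed
  qed
  show ?case
  proof (cases "i = n")
    case True then show ?thesis using en * by simp
  qed (use * Suc.prems in auto)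
qed simp

text \<open>The combinations of all l powers are a submodule containing 1: as \<zeta>^l = 1,
  multiplication by \<zeta> rotates the coefficients. The l powers are not independent, but
  \<open>nakayama\<close> only asks for generators.\<close>

lemma int_ring_span: "x \<in> int_ring \<Longrightarrow> \<exists>a. (\<forall>j. a j \<in> val_ring v) \<and> x = (\<Sum>j<l. \<iota> (a j) * \<zeta> ^ j)"
proof -
  define M where "M = {x. \<exists>a. (\<forall>j. a j \<in> val_ring v) \<and> x = (\<Sum>j<l. \<iota> (a j) * \<zeta> ^ j)}"
  have "int_submodule M"
    unfolding int_submodule_def
  proof (intro conjI ballI)
    show "0 \<in> M" by (auto simp: M_def intro!: exI[of _ "\<lambda>_. 0"])
  next
    fix x y assume "x \<in> M" "y \<in> M"
    then obtain a b where ab: "\<forall>j. a j \<in> val_ring v" "\<forall>j. b j \<in> val_ring v"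
      "x = (\<Sum>j<l. \<iota> (a j) * \<zeta> ^ j)" "y = (\<Sum>j<l. \<iota> (b j) * \<zeta> ^ j)" by (auto simp: M_def)
    then show "x + y \<in> M"
      by (auto simp: M_def sum.distrib distrib_right intro!: exI[of _ "\<lambda>j. a j + b j"] val_ring_add)
  next
    fix r x assume "r \<in> val_ring v" "x \<in> M"
    then obtain a where a: "\<forall>j. a j \<in> val_ring v" "x = (\<Sum>j<l. \<iota> (a j) * \<zeta> ^ j)" by (auto simp: M_def)
    then show "\<iota> r * x \<in> M" using \<open>r \<in> val_ring v\<close>
      by (auto simp: M_def sum_distrib_left mult_ac intro!: exI[of _ "\<lambda>j. r * a j"] val_ring_mult)
  next
    fix x assume "x \<in> M"
    then obtain a where a: "\<forall>j. a j \<in> val_ring v" "x = (\<Sum>j<l. \<iota> (a j) * \<zeta> ^ j)" by (auto simp: M_def)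
    obtain m where m: "l = Suc m" using l_ge_2 by (cases l) auto
    let ?b = "\<lambda>j. case j of 0 \<Rightarrow> a m | Suc j \<Rightarrow> a j"
    have "\<zeta> * x = (\<Sum>j<m. \<iota> (a j) * \<zeta> ^ Suc j) + \<iota> (a m) * \<zeta> ^ l"
      by (simp add: a m sum_distrib_left distrib_left mult_ac)
    also have "\<dots> = (\<Sum>j<Suc m. \<iota> (?b j) * \<zeta> ^ j)"
      by (subst sum.lessThan_Suc_shift) simp
    finally have "\<zeta> * x = (\<Sum>j<l. \<iota> (?b j) * \<zeta> ^ j)" by (simp only: m)
    moreover have "\<forall>j. ?b j \<in> val_ring v" using a(1) by (simp split: nat.split)
    ultimately show "\<zeta> * x \<in> M" unfolding M_def by blast
  qed
  moreover have "1 \<in> M"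
  proof -
    let ?a = "\<lambda>j. if j = 0 then 1 else 0 :: 'k"
    have "(\<Sum>j<l. \<iota> (?a j) * \<zeta> ^ j) = (\<Sum>j\<in>{0}. \<iota> (?a j) * \<zeta> ^ j)"
      by (rule sum.mono_neutral_right) auto
    then show ?thesis by (auto simp: M_def intro!: exI[of _ ?a])
  qed
  moreover assume "x \<in> int_ring"
  ultimately have "x * 1 \<in> M" by (intro int_submodule_mult)
  then show ?thesis by (simp add: M_def)
qed

lemma int_submodule_int_ring: "int_submodule int_ring"
  by (auto simp: int_submodule_def intro: int_ring.intros)

text \<open>If \<theta> were a unit, raising to the power l - 1 would put 1, hence every \<zeta>^i,
  into l \<O>[\<zeta>], and \<open>nakayama\<close> would give \<zeta>^0 = 0. So
  \<open>theta_expansion_integral\<close> can be applied to the ring itself and the element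
  1.\<close>

lemma one_notin_theta_int_ring: "1 \<notin> (*) \<theta> ` int_ring"
proof
  assume "1 \<in> (*) \<theta> ` int_ring"
  then obtain \<mu> where \<mu>: "\<mu> \<in> int_ring" "1 = \<theta> * \<mu>" by blast
  obtain A where A: "A \<in> int_ring" "\<theta> ^ (l - 1) = of_nat l * A" using theta_pow_eq_l by blast
  have one: "1 = of_nat l * (A * \<mu> ^ (l - 1))"
    using \<mu>(2) A(2) by (metis mult.assoc power_mult_distrib power_one)
  have "\<zeta> ^ i = 0" if "i < l" for i
  proof (rule nakayama[where e = "\<lambda>i. \<zeta> ^ i" and n = l and i = i])
    fix k
    have "A * \<mu> ^ (l - 1) * \<zeta> ^ k \<in> int_ring"
      using A \<mu> by (intro int_ring.mult int_ring_power int_ring.zeta)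
    from int_ring_span[OF this] obtain a where
      "\<forall>j. a j \<in> val_ring v" "A * \<mu> ^ (l - 1) * \<zeta> ^ k = (\<Sum>j<l. \<iota> (a j) * \<zeta> ^ j)" by blast
    then show "\<exists>a. (\<forall>j. a j \<in> val_ring v) \<and> \<zeta> ^ k = of_nat l * (\<Sum>j<l. \<iota> (a j) * \<zeta> ^ j)"
      using one by (metis mult.assoc mult_1)
  qed fact
  from this[of 0] show False by simp
qed

text \<open>Divide a relation by l c_i: the sum is still 0, an element of \<O>[\<zeta>], while the
  i-th coefficient has become 1/l. In effect this is the irreducibility of the l-th cyclotomic
  polynomial over K.\<close>

lemma theta_pow_independent:
  assumes "(\<Sum>i<l-1. \<iota> (c i) * \<theta> ^ i) = 0" "i < l - 1"
  shows "c i = 0"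
proof (rule ccontr)
  assume ci: "c i \<noteq> 0"
  define d where "d j = c j / (of_nat l * c i)" for j
  have "(\<Sum>i<l-1. \<iota> (d i) * \<theta> ^ i) = inverse (\<iota> (of_nat l * c i)) * (\<Sum>i<l-1. \<iota> (c i) * \<theta> ^ i)"
    by (subst sum_distrib_left) (auto simp: d_def field_simps)
  also have "\<dots> = 0" using assms by simp
  finally have "d i \<in> val_ring v"
    using assms(2) by (intro theta_expansion_integral[OF int_submodule_int_ring int_ring_1 one_notin_theta_int_ring]) auto
  moreover have "v (d i) = - 1" using ci by (simp add: d_def v_divide v_mult v_l)
  ultimately show False using ci by (auto simp: val_ring_def d_def)
qed

end

text \<open>\<open>lin_trace\<close> is tied to a basis picked by \<open>SOME\<close>. Expanding
  F(e_i) in that basis and exchanging the sums carries the trace over to the coordinate system (e,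
  \<phi>), so that it can be computed, and compared in two systems.\<close>

lemma (in vector_space) lin_trace_eq_sum:
  assumes fin: "finite B" "span B = UNIV" and F: "Vector_Spaces.linear scale scale F"
    and "finite I" and \<phi>: "\<And>i. i \<in> I \<Longrightarrow> Vector_Spaces.linear scale (*) (\<phi> i)"
    and exp: "\<And>x. x = (\<Sum>i\<in>I. \<phi> i x *s e i)"
  shows "lin_trace scale F = (\<Sum>i\<in>I. \<phi> i (F (e i)))"
proof -
  define B0 where "B0 = (SOME B. \<not> dependent B \<and> span B = UNIV)"
  obtain B1 where "independent B1" "UNIV \<subseteq> span B1"
    by (rule maximal_independent_subset[of UNIV])
  then have "\<not> dependent B1 \<and> span B1 = UNIV" by auto
  from someI[of "\<lambda>B. \<not> dependent B \<and> span B = UNIV", OF this]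
  have B0: "independent B0" "span B0 = UNIV" unfolding B0_def by auto
  have "finite B0" using independent_span_bound[OF fin(1) B0(1)] fin(2) by auto
  have rep: "(\<Sum>b\<in>B0. representation B0 x b *s b) = x" for x
    using B0 \<open>finite B0\<close> by (intro sum_representation_eq) auto
  have lin: "\<phi> i (\<Sum>b\<in>B0. g b *s b) = (\<Sum>b\<in>B0. g b * \<phi> i b)" if "i \<in> I" for i g
  proof -
    interpret p: Vector_Spaces.linear scale "(*)" "\<phi> i" by (rule \<phi>[OF that])
    show ?thesis by (simp add: p.sum p.scale)
  qed
  interpret F: Vector_Spaces.linear scale scale F by (rule F)
  have "(\<Sum>i\<in>I. \<phi> i (F (e i))) = (\<Sum>i\<in>I. \<Sum>b\<in>B0. representation B0 (F (e i)) b * \<phi> i b)"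
    by (intro sum.cong refl) (metis lin rep)
  also have "\<dots> = (\<Sum>b\<in>B0. \<Sum>i\<in>I. representation B0 (F (e i)) b * \<phi> i b)" by (rule sum.swap)
  also have "\<dots> = (\<Sum>b\<in>B0. representation B0 (F b) b)"
  proof (intro sum.cong refl)
    fix b assume "b \<in> B0"
    have "representation B0 (F b) b = representation B0 (\<Sum>i\<in>I. \<phi> i b *s F (e i)) b"
      by (subst exp[of b]) (simp add: F.sum F.scale)
    also have "\<dots> = (\<Sum>i\<in>I. representation B0 (F (e i)) b * \<phi> i b)"
      using B0 by (simp add: representation_sum representation_scale mult.commute)
    finally show "(\<Sum>i\<in>I. representation B0 (F (e i)) b * \<phi> i b) = representation B0 (F b) b" by simp
  qed
  finally show ?thesis by (simp add: lin_trace_def Let_def flip: B0_def)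
qed

section \<open>K(\<zeta>) as the span of the powers of \<theta> below l - 1\<close>

context cyclotomic_extension
begin

declare One_nat_def [simp del]

lemma one_less_l_minus [simp]: "1 < l" "0 < l - 1" "1 < l - 1"
  using l_gt_2 by auto

abbreviation "theta_basis \<equiv> (\<lambda>i. \<theta> ^ i) ` {..<l - 1}"

lemma subspace_iff: "vs.subspace S \<longleftrightarrow>
    0 \<in> S \<and> (\<forall>x\<in>S. \<forall>y\<in>S. x + y \<in> S) \<and> (\<forall>a. \<forall>x\<in>S. \<iota> a * x \<in> S)"
  by (simp add: vs.subspace_def ext_scale_def)

lemma linear_iff: "Vector_Spaces.linear (ext_scale \<iota>) (ext_scale \<iota>) f \<longleftrightarrow>
    (\<forall>x y. f (x + y) = f x + f y) \<and> (\<forall>a x. f (\<iota> a * x) = \<iota> a * f x)"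
  using vs.vector_space_axioms by (simp add: Vector_Spaces.linear_iff ext_scale_def)

lemma linear_functional_iff: "Vector_Spaces.linear (ext_scale \<iota>) (*) f \<longleftrightarrow>
    (\<forall>x y. f (x + y) = f x + f y) \<and> (\<forall>a x. f (\<iota> a * x) = a * f x)"
  using vs.vector_space_axioms
  by (auto simp: Vector_Spaces.linear_iff ext_scale_def vector_space_def algebra_simps)

text \<open>Only \<theta> * \<theta>^(l-2) leaves the list of powers, and \<open>theta_pow\<close>
  brings it back.\<close>

lemma span_theta_mult_closed:
  assumes "x \<in> vs.span theta_basis" "y \<in> vs.span theta_basis"
  shows "x * y \<in> vs.span theta_basis"
proof -
  let ?S = "vs.span theta_basis"
  have S: "vs.subspace ?S" by (rule vs.subspace_span)
  have \<theta>: "\<theta> * x \<in> ?S" if "x \<in> ?S" for x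
    using that
  proof (induction rule: vs.span_induct)
    case base
    show ?case using S by (auto simp: subspace_iff distrib_left mult.left_commute[of \<theta>])
  next
    case (step x)
    then obtain i where i: "x = \<theta> ^ i" "i < l - 1" by blast
    have b: "\<theta> ^ j \<in> ?S" if "j < l - 1" for j using that by (intro vs.span_base) auto
    show ?case
    proof (cases "Suc i < l - 1")
      case True
      then show ?thesis using b[of "Suc i"] i by simp
    next
      case False
      then have "Suc i = l - 1" using i by simp
      then have "\<theta> * x = - (\<Sum>i<l-1. of_nat (l choose Suc i) * \<theta> ^ i)"
        using theta_pow theta_ne_0 i by (metis \<theta>_def power_Suc right_minus_eq)
      moreover have "of_nat (l choose Suc j) * \<theta> ^ j \<in> ?S" if "j < l - 1" for j
        using vs.span_scale[OF b[OF that], of "of_nat (l choose Suc j)"] by (simp add: ext_scale_def)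
      ultimately show ?thesis by (auto intro!: vs.span_neg vs.span_sum)
    qed
  qed
  have "\<forall>y\<in>?S. x * y \<in> ?S"
    using assms(1)
  proof (induction rule: vs.span_induct)
    case base
    show ?case using S by (auto simp: subspace_iff distrib_right mult.assoc)
  next
    case (step x)
    then obtain i where "x = \<theta> ^ i" by blast
    have "\<theta> ^ i * y \<in> ?S" if "y \<in> ?S" for y
    proof (induction i)
      case (Suc i)
      from \<theta>[OF this] show ?case by (simp only: power_Suc mult.assoc)
    qed (use that in simp)
    then show ?case by (simp add: \<open>x = \<theta> ^ i\<close>)
  qed
  then show ?thesis using assms by blast
qed

lemma one_in_span_theta: "1 \<in> vs.span theta_basis"
  by (rule vs.span_base) (rule image_eqI[of _ _ 0], use l_gt_2 in auto)

text \<open>The powers of x lie in a finite-dimensional space, so x satisfies a polynomial over K.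
  Cancelling the lowest power of x that occurs leaves a nonzero constant term c_k, and x y = -
  c_k.\<close>

lemma span_theta_inverse_closed:
  assumes "x \<in> vs.span theta_basis" "x \<noteq> 0"
  shows "inverse x \<in> vs.span theta_basis"
proof -
  let ?S = "vs.span theta_basis"
  have pow: "x ^ i \<in> ?S" for i
  proof (induction i)
    case (Suc i)
    from span_theta_mult_closed[OF assms(1) this] show ?case by (simp only: power_Suc)
  next
    case 0
    show ?case using one_in_span_theta by (simp only: power_0)
  qed
  obtain n c where c: "\<exists>i\<le>n. c i \<noteq> 0" "(\<Sum>i\<le>n. ext_scale \<iota> (c i) (x ^ i)) = 0"
    using vs.linear_relation[of theta_basis "\<lambda>i. x ^ i"] pow by auto
  define k where "k = (LEAST i. i \<le> n \<and> c i \<noteq> 0)"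
  have k: "k \<le> n" "c k \<noteq> 0" using LeastI_ex[OF c(1)] by (auto simp: k_def)
  have lt: "c i = 0" if "i < k" for i
    using not_less_Least[of i "\<lambda>i. i \<le> n \<and> c i \<noteq> 0"] that k by (auto simp: k_def)
  define y where "y = (\<Sum>i\<in>{k<..n}. ext_scale \<iota> (c i) (x ^ (i - Suc k)))"
  have "(\<Sum>i\<le>n. ext_scale \<iota> (c i) (x ^ i)) = (\<Sum>i\<in>{k..n}. ext_scale \<iota> (c i) (x ^ i))"
    using lt by (intro sum.mono_neutral_right) (auto simp: ext_scale_def)
  also have "{k..n} = insert k {k<..n}" using k by auto
  also have "(\<Sum>i\<in>insert k {k<..n}. ext_scale \<iota> (c i) (x ^ i)) = \<iota> (c k) * x ^ k + x ^ Suc k * y"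
  proof -
    have "(\<Sum>i\<in>{k<..n}. ext_scale \<iota> (c i) (x ^ i)) = x ^ Suc k * y"
      unfolding y_def sum_distrib_left
    proof (intro sum.cong refl)
      fix i assume "i \<in> {k<..n}"
      then have "x ^ i = x ^ Suc k * x ^ (i - Suc k)" by (metis Suc_leI greaterThanAtMost_iff le_add_diff_inverse power_add)
      then show "ext_scale \<iota> (c i) (x ^ i) = x ^ Suc k * ext_scale \<iota> (c i) (x ^ (i - Suc k))"
        by (simp add: ext_scale_def)
    qed
    then show ?thesis by (simp add: ext_scale_def)
  qed
  finally have "x ^ k * (\<iota> (c k) + x * y) = 0" using c(2) by (simp add: algebra_simps)
  then have "\<iota> (c k) + x * y = 0" using assms by simp
  then have "x * y = - \<iota> (c k)" by (simp add: add_eq_0_iff)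
  then have "inverse x = ext_scale \<iota> (- inverse (c k)) y"
    using k(2) assms(2) by (simp add: ext_scale_def field_simps)
  moreover have "y \<in> ?S" unfolding y_def by (intro vs.span_sum vs.span_scale pow)
  ultimately show ?thesis by (simp only: vs.span_scale)
qed

lemma span_theta: "vs.span theta_basis = UNIV"
proof -
  let ?S = "vs.span theta_basis"
  let ?R = "ring_of_type_algebra :: 'l ring"
  have R [simp]: "\<one>\<^bsub>?R\<^esub> = 1" "\<zero>\<^bsub>?R\<^esub> = 0" "x \<otimes>\<^bsub>?R\<^esub> y = x * y" "x \<oplus>\<^bsub>?R\<^esub> y = x + y" for x y
    by (simp_all add: ring_of_type_algebra_def)
  have carrier: "carrier ?R = UNIV" by (simp add: ring_of_type_algebra_def)
  interpret F: Ring.field ?R by (rule field_from_type_algebra)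
  have ai: "\<ominus>\<^bsub>?R\<^esub> x = - x" for x
    by (rule F.minus_equality) (auto simp: carrier)
  have mi: "inv\<^bsub>?R\<^esub> x = inverse x" if "x \<noteq> 0" for x
    by (rule F.comm_inv_char) (use that in \<open>auto simp: carrier\<close>)
  have z: "\<zeta> \<in> ?S"
  proof -
    have "\<theta> \<in> ?S" by (rule vs.span_base) (rule image_eqI[of _ _ 1], auto)
    then have "\<theta> + 1 \<in> ?S" using one_in_span_theta by (intro vs.span_add)
    then show ?thesis by (simp add: \<theta>_def)
  qed
  have base: "\<iota> a \<in> ?S" for a
    using vs.span_scale[OF one_in_span_theta, of a] by (subst (asm) ext_scale_def) (simp only: mult_1_right)
  have "x \<in> ?S" if "x \<in> generate_field ?R (insert \<zeta> (range \<iota>))" for x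
    using that
  proof (induction rule: generate_field.induct)
    case (incl h)
    then show ?case using z base by blast
  next
    case (m_inv h)
    then have "h \<noteq> 0" by simp
    from mi[OF this] span_theta_inverse_closed[OF m_inv.IH this] show ?case by (simp only:)
  qed (simp_all only: R ai one_in_span_theta vs.span_neg vs.span_add span_theta_mult_closed)
  then show ?thesis using generated by (auto simp: generated_over_def)
qed

lemma theta_inj: "inj_on (\<lambda>i. \<theta> ^ i) {..<l - 1}"
proof (rule inj_onI, rule ccontr)
  fix i j assume ij: "i \<in> {..<l - 1}" "j \<in> {..<l - 1}" "\<theta> ^ i = \<theta> ^ j" "i \<noteq> j"
  let ?c = "\<lambda>k. if k = i then 1 else if k = j then - 1 else 0 :: 'k"
  have "(\<Sum>k<l-1. \<iota> (?c k) * \<theta> ^ k) = (\<Sum>k\<in>{i, j}. \<iota> (?c k) * \<theta> ^ k)"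
    using ij by (intro sum.mono_neutral_right) auto
  also have "\<dots> = 0" using ij by simp
  finally have "?c i = 0" using ij by (intro theta_pow_independent[where c = ?c]) auto
  then show False by simp
qed

lemma theta_basis_independent: "vs.independent theta_basis"
proof (rule vs.independent_if_scalars_zero)
  fix f x assume "(\<Sum>x\<in>theta_basis. ext_scale \<iota> (f x) x) = 0" "x \<in> theta_basis"
  then show "f x = 0"
    using theta_pow_independent[of "\<lambda>i. f (\<theta> ^ i)"] by (auto simp: sum.reindex[OF theta_inj] ext_scale_def)
qed simp

lemma theta_expansion: "\<exists>c. x = (\<Sum>i<l-1. \<iota> (c i) * \<theta> ^ i)"
proof -
  have "x \<in> vs.span theta_basis" by (simp add: span_theta)
  then obtain u where "x = (\<Sum>y\<in>theta_basis. ext_scale \<iota> (u y) y)" by (auto simp: vs.span_finite)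
  then show ?thesis
    by (intro exI[of _ "\<lambda>i. u (\<theta> ^ i)"]) (simp add: sum.reindex[OF theta_inj] ext_scale_def)
qed

lemma theta_induct:
  assumes "P 1" "\<And>x. P x \<Longrightarrow> P (\<theta> * x)" "\<And>x y. P x \<Longrightarrow> P y \<Longrightarrow> P (x + y)" "\<And>a x. P x \<Longrightarrow> P (\<iota> a * x)"
  shows "P x"
proof -
  have "x \<in> vs.span theta_basis" by (simp add: span_theta)
  then show ?thesis
  proof (induction rule: vs.span_induct)
    case base
    show ?case using assms(3) assms(4) assms(4)[OF assms(1), of 0]
      by (simp add: subspace_iff)
  next
    case (step x)
    then obtain i where "x = \<theta> ^ i" by blast
    moreover have "P (\<theta> ^ i)" by (induction i) (auto simp: assms)
    ultimately show ?case by simp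
  qed
qed

section \<open>The automorphism inverting \<zeta>, and the trace\<close>

text \<open>At first only a K-linear map, sending the basis element (\<zeta> - 1)^i to (1/\<zeta> -
  1)^i; \<open>the_inv_into\<close> recovers the exponent from the basis element. That it is a ring
  homomorphism is proved afterwards from the cyclotomic relation.\<close>

definition cnj :: "'l \<Rightarrow> 'l" where
  "cnj = vector_space_pair.construct (ext_scale \<iota>) (ext_scale \<iota>) theta_basis
     (\<lambda>b. (inverse \<zeta> - 1) ^ the_inv_into {..<l - 1} (\<lambda>i. \<theta> ^ i) b)"

lemma cnj_add [simp]: "cnj (x + y) = cnj x + cnj y" and cnj_scale: "cnj (\<iota> a * x) = \<iota> a * cnj x"
proof -
  interpret vector_space_pair "ext_scale \<iota>" "ext_scale \<iota>" ..
  have "Vector_Spaces.linear (ext_scale \<iota>) (ext_scale \<iota>) cnj"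
    unfolding cnj_def by (rule linear_construct[OF theta_basis_independent])
  then show "cnj (x + y) = cnj x + cnj y" "cnj (\<iota> a * x) = \<iota> a * cnj x" by (auto simp: linear_iff)
qed

lemma cnj_theta_pow: "i < l - 1 \<Longrightarrow> cnj (\<theta> ^ i) = (inverse \<zeta> - 1) ^ i"
proof -
  interpret vector_space_pair "ext_scale \<iota>" "ext_scale \<iota>" ..
  assume i: "i < l - 1"
  show ?thesis
    unfolding cnj_def using i
    by (subst construct_basis[OF theta_basis_independent]) (auto simp: the_inv_into_f_f[OF theta_inj])
qed

lemma cnj_sum: "cnj (sum f I) = (\<Sum>i\<in>I. cnj (f i))"
  using cnj_scale[of 0 0] by (induction I rule: infinite_finite_induct) auto

lemma cnj_1 [simp]: "cnj 1 = 1"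
  using cnj_theta_pow[of 0] by simp

lemma cnj_\<iota> [simp]: "cnj (\<iota> a) = \<iota> a"
  using cnj_scale[of a 1] by simp

lemma cnj_minus [simp]: "cnj (- x) = - cnj x"
  using cnj_scale[of "- 1" x] by simp

lemma cnj_diff [simp]: "cnj (x - y) = cnj x - cnj y"
  using cnj_add[of x "- y"] by (simp del: cnj_add)

text \<open>The one case that the definition does not settle is \<theta>^(l-1), reduced by the
  cyclotomic relation. As 1/\<zeta> is another l-th root of unity different from 1, it obeys the
  same relation with the same coefficients in K, and the two reductions match.\<close>

lemma cnj_theta_mult: "cnj (\<theta> * x) = (inverse \<zeta> - 1) * cnj x"
proof -
  have *: "cnj (\<theta> * \<theta> ^ i) = (inverse \<zeta> - 1) * cnj (\<theta> ^ i)" if "i < l - 1" for i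
  proof (cases "Suc i < l - 1")
    case True
    then show ?thesis using cnj_theta_pow[of "Suc i"] cnj_theta_pow[of i] by simp
  next
    case False
    then have i: "Suc i = l - 1" using that by simp
    have "inverse \<zeta> ^ l = 1" "inverse \<zeta> \<noteq> 1"
      using zeta_pow_ne[of 1] by (simp_all add: power_inverse)
    note rel = root_of_unity_relation[OF this]
    have "cnj (\<theta> * \<theta> ^ i) = - cnj (\<Sum>i<l-1. of_nat (l choose Suc i) * \<theta> ^ i)"
      using theta_pow theta_ne_0 i by (metis \<theta>_def cnj_minus power_Suc right_minus_eq)
    also have "\<dots> = - (\<Sum>i<l-1. of_nat (l choose Suc i) * (inverse \<zeta> - 1) ^ i)"
      using cnj_theta_pow cnj_scale[of "of_nat n" for n] by (simp add: cnj_sum)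
    also have "\<dots> = (inverse \<zeta> - 1) ^ Suc i" using rel i by simp
    finally show ?thesis using cnj_theta_pow[OF that] by simp
  qed
  obtain c where x: "x = (\<Sum>i<l-1. \<iota> (c i) * \<theta> ^ i)" using theta_expansion by blast
  have "cnj (\<theta> * x) = (\<Sum>i<l-1. \<iota> (c i) * cnj (\<theta> * \<theta> ^ i))"
    by (simp add: x sum_distrib_left mult.left_commute[of \<theta>] cnj_sum cnj_scale)
  also have "\<dots> = (inverse \<zeta> - 1) * cnj x"
    by (simp add: x sum_distrib_left cnj_sum cnj_scale * mult_ac)
  finally show ?thesis .
qed

lemma cnj_mult [simp]: "cnj (x * y) = cnj x * cnj y"
  by (induction x rule: theta_induct)
    (auto simp: mult.assoc cnj_theta_mult distrib_right cnj_scale)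

lemma cnj_0 [simp]: "cnj 0 = 0"
  using cnj_\<iota>[of 0] by simp

lemma cnj_power [simp]: "cnj (x ^ n) = cnj x ^ n"
  by (induction n) auto

lemma cnj_theta: "cnj \<theta> = inverse \<zeta> - 1"
  using cnj_theta_mult[of 1] by simp

lemma cnj_zeta: "cnj \<zeta> = inverse \<zeta>"
proof -
  have "cnj (\<theta> + 1) = inverse \<zeta>" by (simp only: cnj_add cnj_theta cnj_1) simp
  then show ?thesis by (simp add: \<theta>_def)
qed

lemma cnj_inverse [simp]: "cnj (inverse x) = inverse (cnj x)"
proof (cases "x = 0")
  case False
  then have "cnj x * cnj (inverse x) = 1" by (simp flip: cnj_mult)
  then show ?thesis by (metis inverse_unique)
qed simp

lemma cnj_cnj [simp]: "cnj (cnj x) = x"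
proof (induction x rule: theta_induct)
  case (2 x)
  have "cnj (cnj \<theta>) = \<theta>"
    by (simp add: cnj_theta cnj_zeta) (simp add: \<theta>_def)
  then show ?case by (simp add: 2)
qed (auto simp: cnj_scale)

lemma ext_automorphism_cnj: "ext_automorphism \<iota> cnj"
proof -
  have "bij cnj" by (rule o_bij[of cnj]) (auto simp: fun_eq_iff)
  then show ?thesis
    by (auto simp: ext_automorphism_def ring_iso_def ring_hom_def ring_of_type_algebra_def)
qed

lemma trace_eq_sum:
  assumes "finite I" "\<And>i. i \<in> I \<Longrightarrow> Vector_Spaces.linear (ext_scale \<iota>) (*) (\<phi> i)"
    and "\<And>x. x = (\<Sum>i\<in>I. \<iota> (\<phi> i x) * e i)"
  shows "field_trace \<iota> x = (\<Sum>i\<in>I. \<phi> i (x * e i))"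
  unfolding field_trace_def
  by (rule vs.lin_trace_eq_sum[of theta_basis])
    (use assms span_theta in \<open>auto simp: linear_iff algebra_simps ext_scale_def\<close>)

abbreviation "coord \<equiv> vs.representation theta_basis"

lemma coord_linear: "Vector_Spaces.linear (ext_scale \<iota>) (*) (\<lambda>x. coord x b)"
proof -
  have "coord (ext_scale \<iota> a x) b = a * coord x b" for a x
    by (simp add: vs.representation_scale theta_basis_independent span_theta)
  then show ?thesis
    by (simp add: linear_functional_iff vs.representation_add theta_basis_independent span_theta ext_scale_def)
qed

lemma coord_sum: "x = (\<Sum>b\<in>theta_basis. \<iota> (coord x b) * b)"
  using vs.sum_representation_eq[OF theta_basis_independent, of x theta_basis] by (simp add: span_theta ext_scale_def)

lemma trace_coord: "field_trace \<iota> x = (\<Sum>b\<in>theta_basis. coord (x * b) b)"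
  by (rule trace_eq_sum) (use coord_linear coord_sum in auto)

lemma trace_add: "field_trace \<iota> (x + y) = field_trace \<iota> x + field_trace \<iota> y"
  and trace_scale: "field_trace \<iota> (\<iota> a * x) = a * field_trace \<iota> x"
  using coord_linear unfolding linear_functional_iff trace_coord
  by (auto simp: distrib_right sum.distrib sum_distrib_left mult.assoc)

text \<open>The conjugated basis, with coordinates those of \<open>cnj x\<close>, is another
  coordinate system; computed there, the trace of \<open>cnj x\<close> is term by term the trace of
  x in the original basis.\<close>

lemma trace_cnj: "field_trace \<iota> (cnj x) = field_trace \<iota> x"
proof -
  have "field_trace \<iota> (cnj x) = (\<Sum>b\<in>theta_basis. coord (cnj (cnj x * cnj b)) b)"
  proof (rule trace_eq_sum)
    show "Vector_Spaces.linear (ext_scale \<iota>) (*) (\<lambda>x. coord (cnj x) b)" for b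
      using coord_linear[of b] by (simp add: linear_functional_iff cnj_scale)
    show "x = (\<Sum>b\<in>theta_basis. \<iota> (coord (cnj x) b) * cnj b)" for x
      using arg_cong[OF coord_sum[of "cnj x"], of cnj] by (simp only: cnj_sum cnj_cnj cnj_scale)
  qed simp
  then show ?thesis by (simp add: trace_coord)
qed

lemma trace_1: "field_trace \<iota> 1 = of_nat (l - 1)"
  unfolding trace_coord
  by (simp add: vs.representation_basis[OF theta_basis_independent] card_image[OF theta_inj])

lemma trace_nondegenerate:
  assumes "\<And>y. field_trace \<iota> (x * y) = 0"
  shows "x = 0"
proof (rule ccontr)
  assume "x \<noteq> 0"
  \<comment> \<open>The inverse of x pairs with x to tr 1 = l - 1, which is nonzero in
    characteristic 0.\<close>
  then have "of_nat (l - 1) = (0 :: 'k)" using assms[of "inverse x"] trace_1 by simp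
  then show False using l_gt_2 by (simp only: of_nat_eq_0_iff)
qed

text \<open>Such a z is not in K: otherwise \<theta> = z^j - 1 would be, against the independence of
  1 and \<theta>, two basis elements because l > 2. Hence 1 and z can be separated. In the
  application z is a nontrivial l-th root of unity.\<close>

lemma functional_exists:
  assumes "z ^ j = \<zeta>"
  shows "\<exists>\<psi>. Vector_Spaces.linear (ext_scale \<iota>) (*) \<psi> \<and> \<psi> 1 = 1 \<and> \<psi> z = 0"
proof -
  interpret vector_space_pair "ext_scale \<iota>" "(*) :: 'k \<Rightarrow> _"
    by unfold_locales (auto simp: algebra_simps)
  have "z \<noteq> \<iota> a" for a
  proof
    assume "z = \<iota> a"
    then have "\<zeta> = \<iota> (a ^ j)" using assms by (induction j arbitrary: \<zeta>) auto
    then have "\<zeta> - 1 = \<iota> (a ^ j) - 1" by simp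
    then have \<theta>: "\<theta> = \<iota> (a ^ j - 1)" by (simp only: \<theta>_def \<iota>_diff \<iota>_1)
    define c where "c = (\<lambda>k::nat. if k = 0 then a ^ j - 1 else if k = 1 then - 1 else 0)"
    have "{0, 1} \<subseteq> {..<l-1}" using l_gt_2 by auto
    then have "(\<Sum>k<l-1. \<iota> (c k) * \<theta> ^ k) = (\<Sum>k\<in>{0, 1}. \<iota> (c k) * \<theta> ^ k)"
      by (intro sum.mono_neutral_right) (auto simp: c_def)
    also have "\<dots> = \<iota> (a ^ j - 1) - \<theta>" by (simp add: c_def)
    also have "\<dots> = 0" by (simp only: \<theta> cancel_comm_monoid_add_class.diff_cancel)
    finally have "c 1 = 0" by (rule theta_pow_independent) simp
    then show False by (simp add: c_def)
  qed
  then have z: "z \<notin> vs.span {1}" by (auto simp: vs.span_singleton ext_scale_def)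
  then have "z \<noteq> 1" using vs.span_base[of 1 "{1}"] by auto
  have ind: "vs.independent {z, 1}"
    by (intro vs.independent_insertI vs.independent_empty z) simp
  obtain \<psi> where "Vector_Spaces.linear (ext_scale \<iota>) (*) \<psi>"
      "\<forall>x\<in>{z, 1}. \<psi> x = (if x = 1 then 1 else 0)"
    using linear_independent_extend[OF ind, of "\<lambda>x. if x = 1 then 1 else 0"] by blast
  then show ?thesis using \<open>z \<noteq> 1\<close> by auto
qed

text \<open>
  The symmetric form \<open>c\<close> becomes alternating after twisting with \<open>\<pi>^(l-2)\<close>, where \<open>\<pi> = \<eta> - 1/\<eta>\<close> with
  \<open>\<eta>^2 = \<zeta>\<close> is a generator of the prime above \<open>l\<close> that is skew-adjoint for \<open>c\<close>.
\<close>

lemma no_unimodular_form: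
  fixes c :: "'l \<Rightarrow> 'l \<Rightarrow> 'k"
  assumes M: "int_submodule M"
    and add: "\<And>x y z. c (x + y) z = c x z + c y z" and scale: "\<And>a x y. c (\<iota> a * x) y = a * c x y"
    and sym: "\<And>x y. c x y = c y x" and inv: "\<And>x y. c (\<zeta> * x) (\<zeta> * y) = c x y"
    and integral: "\<And>x y. x \<in> M \<Longrightarrow> y \<in> M \<Longrightarrow> c x y \<in> val_ring v"
    and dual: "\<And>x. (\<And>y. y \<in> M \<Longrightarrow> \<exists>a\<in>val_ring v. c x y = of_nat l * a) \<Longrightarrow> x \<in> (*) (of_nat l) ` M"
    and "\<alpha> \<in> M" "\<And>n. \<alpha> \<in> (*) (of_nat l ^ n) ` M \<Longrightarrow> n < n0"
  shows False
proof -
  have add': "c x (y + z) = c x y + c x z" and scale': "c x (\<iota> a * y) = a * c x y" for x y z a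
    using add scale sym by metis+
  have minus: "c (- x) y = - c x y" for x y using scale[of "- 1" x y] by simp
  have minus': "c x (- y) = - c x y" for x y using minus sym by metis
  have \<zeta>n: "c (\<zeta> ^ n * x) (\<zeta> ^ n * y) = c x y" for n x y
    by (induction n) (auto simp: mult.assoc inv)
  \<comment> \<open>As l is odd, (l+1)/2 is an inverse of 2 mod l, so this is the square root of
    \<zeta> among its powers; its inverse is \<zeta>^((l-1)/2), so both lie in \<O>[\<zeta>].
    Splitting \<eta> off \<theta> leaves the expression \<pi> that changes sign under \<eta>
    \<mapsto> 1/\<eta>.\<close>
  define \<eta> where "\<eta> = \<zeta> ^ ((l + 1) div 2)"
  define \<pi> where "\<pi> = \<eta> - inverse \<eta>"
  have [simp]: "\<eta> \<noteq> 0" by (simp add: \<eta>_def)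
  have "(l + 1) div 2 + (l + 1) div 2 = l + 1" using odd_l by presburger
  then have "\<eta> * \<eta> = \<zeta> ^ (l + 1)" unfolding \<eta>_def by (metis power_add)
  then have \<eta>\<eta>: "\<eta> * \<eta> = \<zeta>" by (simp add: power_add)
  have "\<zeta> ^ (l div 2) * \<eta> = \<zeta> ^ l" unfolding \<eta>_def power_add [symmetric]
    by (rule arg_cong[where f = "\<lambda>n. \<zeta> ^ n"]) (use odd_l in presburger)
  then have "inverse \<eta> = \<zeta> ^ (l div 2)" by (simp add: field_simps)
  then have \<eta>int: "\<eta> \<in> int_ring" "inverse \<eta> \<in> int_ring"
    by (simp_all only: \<eta>_def int_ring_power int_ring.zeta)
  have \<theta>: "\<theta> = \<pi> * \<eta>" using \<eta>\<eta> by (simp add: \<theta>_def \<pi>_def algebra_simps)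
  then have \<pi>: "\<pi> = inverse \<eta> * \<theta>" by simp
  \<comment> \<open>A power of \<zeta> is an isometry, so its adjoint is its inverse; this makes the
    difference \<pi> skew-adjoint.\<close>
  have \<eta>inv: "c (\<eta> * x) y = c x (inverse \<eta> * y)" for x y
  proof -
    have "\<eta> * (inverse \<eta> * y) = y" by (simp flip: mult.assoc)
    then show ?thesis using \<zeta>n[of "(l + 1) div 2" x "inverse \<eta> * y", folded \<eta>_def] by (simp only:)
  qed
  have \<pi>skew: "c (\<pi> * x) y = - c x (\<pi> * y)" for x y
  proof -
    have "c (\<pi> * x) y = c (\<eta> * x) y - c (inverse \<eta> * x) y"
      using add[of "\<eta> * x" "- (inverse \<eta> * x)" y] by (simp add: \<pi>_def left_diff_distrib minus)
    also have "\<dots> = c x (inverse \<eta> * y) - c x (\<eta> * y)" using \<eta>inv sym by metis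
    also have "\<dots> = - c x (\<pi> * y)"
      using add'[of x "\<eta> * y" "- (inverse \<eta> * y)"] by (simp add: \<pi>_def left_diff_distrib minus')
    finally show ?thesis .
  qed
  have \<pi>pow: "c (\<pi> ^ n * x) y = (- 1) ^ n * c x (\<pi> ^ n * y)" for n x y
  proof (induction n arbitrary: x)
    case (Suc n)
    have "c (\<pi> ^ Suc n * x) y = c (\<pi> ^ n * (\<pi> * x)) y" by (simp add: mult_ac)
    also have "\<dots> = (- 1) ^ n * - c x (\<pi> * (\<pi> ^ n * y))" by (simp only: Suc \<pi>skew)
    finally show ?case by (simp add: mult_ac)
  qed simp
  \<comment> \<open>Moving the odd power across costs a sign, and symmetry of c moves it back, so
    the value is its own negative.\<close>
  have "odd (l - 2)" using odd_l l_gt_2 by simp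
  then have diag: "c (\<pi> ^ (l - 2) * x) x = 0" for x
    using \<pi>pow[of "l - 2" x x] sym[of x "\<pi> ^ (l - 2) * x"] by simp
  \<comment> \<open>Otherwise M would lie in \<theta>^n M, hence in l^n M, for every n, against the
    bound \<open>n0\<close> for the given element.\<close>
  have "\<exists>\<alpha>\<in>M. \<alpha> \<notin> (*) \<theta> ` M"
  proof (rule ccontr)
    assume "\<not> ?thesis"
    then have *: "M \<subseteq> (*) \<theta> ` M" by blast
    have "M \<subseteq> (*) (\<theta> ^ n) ` M" for n
    proof (induction n)
      case (Suc n)
      show ?case
      proof
        fix x assume "x \<in> M"
        then obtain y where "y \<in> M" "x = \<theta> * y" using * by blast
        moreover obtain z where "z \<in> M" "y = \<theta> ^ n * z" using Suc \<open>y \<in> M\<close> by blast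
        ultimately show "x \<in> (*) (\<theta> ^ Suc n) ` M" by (auto simp: mult.assoc)
      qed
    qed simp
    have l: "M \<subseteq> (*) (of_nat l) ` M"
    proof
      fix x assume "x \<in> M"
      then obtain y where "y \<in> M" "x = \<theta> ^ (l - 1) * y" using \<open>\<And>n. M \<subseteq> (*) (\<theta> ^ n) ` M\<close>[of "l - 1"] by blast
      then show "x \<in> (*) (of_nat l) ` M" using theta_pow_mult_imp_l_mult[OF M] by simp
    qed
    have "M \<subseteq> (*) (of_nat l ^ n) ` M" for n
    proof (induction n)
      case (Suc n)
      show ?case
      proof
        fix x assume "x \<in> M"
        then obtain y where "y \<in> M" "x = of_nat l * y" using l by blast
        moreover obtain z where "z \<in> M" "y = of_nat l ^ n * z" using Suc \<open>y \<in> M\<close> by blast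
        ultimately show "x \<in> (*) (of_nat l ^ Suc n) ` M" by (auto simp: mult.assoc)
      qed
    qed simp
    then show False using assms(8) assms(9)[of n0] by blast
  qed
  then obtain \<alpha>0 where \<alpha>0: "\<alpha>0 \<in> M" "\<alpha>0 \<notin> (*) \<theta> ` M" by blast
  \<comment> \<open>The class of \<alpha>0 spans M / \<theta> M and is orthogonal to itself for the
    twisted form, so \<alpha>0 pairs into l \<O> with all of M. By \<open>dual\<close>,
    unimodularity scaled by l, this becomes divisibility in M.\<close>
  have "\<pi> ^ (l - 2) * \<alpha>0 \<in> (*) (of_nat l) ` M"
  proof (rule dual)
    fix \<beta> assume "\<beta> \<in> M"
    obtain a where a: "\<beta> / \<alpha>0 = (\<Sum>i<l-1. \<iota> (a i) * \<theta> ^ i)" using theta_expansion by blast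
    have "\<alpha>0 \<noteq> 0" using \<alpha>0 M by (auto simp: int_submodule_def intro!: image_eqI[of _ _ 0])
    then have \<beta>: "\<beta> = (\<Sum>i<l-1. \<iota> (a i) * \<theta> ^ i) * \<alpha>0" using a by (simp add: field_simps)
    have ai: "a i \<in> val_ring v" if "i < l - 1" for i
      using theta_expansion_integral[OF M \<alpha>0] \<beta> \<open>\<beta> \<in> M\<close> that by blast
    obtain m where m: "l - 1 = Suc m" using l_gt_2 by (cases "l - 1") auto
    \<comment> \<open>Removing the constant term leaves \<theta> times an element of M, so M = \<O>
      \<alpha>0 + \<theta> M.\<close>
    define \<gamma> where "\<gamma> = (\<Sum>i<m. \<iota> (a (Suc i)) * \<theta> ^ i) * \<alpha>0"
    have \<gamma>: "\<gamma> \<in> M" unfolding \<gamma>_def using ai m \<alpha>0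
      by (intro int_submodule_mult[OF M] int_ring_sum int_ring.mult int_ring.base int_ring_power int_ring_theta) auto
    have "\<beta> = \<iota> (a 0) * \<alpha>0 + \<pi> * (\<eta> * \<gamma>)"
      unfolding mult.assoc [symmetric] \<theta> [symmetric]
      by (simp add: \<beta> m sum.lessThan_Suc_shift \<gamma>_def sum_distrib_left distrib_right distrib_left mult_ac del: sum.lessThan_Suc)
    then have "c (\<pi> ^ (l - 2) * \<alpha>0) \<beta> = c (\<pi> ^ (l - 2) * \<alpha>0) (\<pi> * (\<eta> * \<gamma>))"
      by (simp add: add' scale' diag)
    also have "\<dots> = - c (\<pi> * (\<pi> ^ (l - 2) * \<alpha>0)) (\<eta> * \<gamma>)" by (simp add: \<pi>skew)
    also have "\<pi> * (\<pi> ^ (l - 2) * \<alpha>0) = \<theta> ^ (l - 1) * (inverse \<eta> ^ (l - 1) * \<alpha>0)"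
    proof -
      have "Suc (l - 2) = l - 1" using l_gt_2 by simp
      then have "\<pi> * \<pi> ^ (l - 2) = \<pi> ^ (l - 1)" by (metis power_Suc)
      then show ?thesis by (simp only: mult.assoc [symmetric]) (simp only: \<pi> power_mult_distrib mult_ac)
    qed
    finally have c1: "c (\<pi> ^ (l - 2) * \<alpha>0) \<beta> = - c (\<theta> ^ (l - 1) * (inverse \<eta> ^ (l - 1) * \<alpha>0)) (\<eta> * \<gamma>)" .
    have "inverse \<eta> ^ (l - 1) * \<alpha>0 \<in> M"
      using \<alpha>0 by (intro int_submodule_mult[OF M] int_ring_power \<eta>int)
    from theta_pow_mult_imp_l_mult[OF M this] obtain \<mu> where
      \<mu>: "\<mu> \<in> M" "\<theta> ^ (l - 1) * (inverse \<eta> ^ (l - 1) * \<alpha>0) = of_nat l * \<mu>" by blast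
    have "c (\<pi> ^ (l - 2) * \<alpha>0) \<beta> = of_nat l * - c \<mu> (\<eta> * \<gamma>)"
      using c1 \<mu>(2) scale[of "of_nat l" \<mu>] by simp
    moreover have "c \<mu> (\<eta> * \<gamma>) \<in> val_ring v"
      using \<mu> \<gamma> by (intro integral int_submodule_mult[OF M \<eta>int(1)])
    ultimately show "\<exists>a\<in>val_ring v. c (\<pi> ^ (l - 2) * \<alpha>0) \<beta> = of_nat l * a"
      by (intro bexI[of _ "- c \<mu> (\<eta> * \<gamma>)"]) simp_all
  qed
  then obtain y where "y \<in> M" "\<pi> ^ (l - 2) * \<alpha>0 = of_nat l * y" by blast
  then obtain \<gamma> where \<gamma>: "\<gamma> \<in> M" "\<pi> ^ (l - 2) * \<alpha>0 = \<theta> ^ (l - 1) * \<gamma>"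
    using l_mult_imp_theta_pow_mult[OF M] by auto
  \<comment> \<open>Since l M = \<theta>^(l-1) M, cancelling l - 2 factors puts \<alpha>0 into
    \<theta> M.\<close>
  have "\<theta> ^ (l - 2) * \<alpha>0 = \<eta> ^ (l - 2) * (\<pi> ^ (l - 2) * \<alpha>0)"
    by (simp only: \<theta> power_mult_distrib mult_ac)
  also have "\<dots> = \<theta> ^ (l - 2) * (\<theta> * (\<eta> ^ (l - 2) * \<gamma>))"
  proof -
    have "Suc (l - 2) = l - 1" using l_gt_2 by simp
    then have "\<theta> ^ (l - 1) = \<theta> * \<theta> ^ (l - 2)" by (metis power_Suc)
    then have "\<eta> ^ (l - 2) * (\<theta> ^ (l - 1) * \<gamma>) = \<theta> ^ (l - 2) * (\<theta> * (\<eta> ^ (l - 2) * \<gamma>))"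
      by (simp only: mult_ac)
    then show ?thesis by (simp only: \<gamma>(2))
  qed
  finally have "\<alpha>0 = \<theta> * (\<eta> ^ (l - 2) * \<gamma>)" by simp
  moreover have "\<eta> ^ (l - 2) * \<gamma> \<in> M"
    using \<gamma> by (intro int_submodule_mult[OF M] int_ring_power \<eta>int)
  ultimately show False using \<alpha>0 by blast
qed

end

section \<open>Tensor products\<close>

lemma vector_space_mult: "vector_space ((*) :: 'a::field \<Rightarrow> 'a \<Rightarrow> 'a)"
  by unfold_locales (auto simp: algebra_simps)

lemma bilinear_map_iff: "bilinear_map s1 s2 s3 f \<longleftrightarrow>
    vector_space s1 \<and> vector_space s2 \<and> vector_space s3 \<and>
    (\<forall>x y z. f (x + y) z = f x z + f y z) \<and> (\<forall>x y z. f x (y + z) = f x y + f x z) \<and>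
    (\<forall>a x y. f (s1 a x) y = s3 a (f x y)) \<and> (\<forall>a x y. f x (s2 a y) = s3 a (f x y))"
  unfolding bilinear_map_def Vector_Spaces.linear_iff by blast

lemma (in vector_space) functional_separating:
  assumes "subspace S" "w \<notin> S"
  obtains \<psi> where "Vector_Spaces.linear scale (*) \<psi>" "\<And>x. x \<in> S \<Longrightarrow> \<psi> x = 0" "\<psi> w = 1"
proof -
  interpret vector_space_pair scale "(*) :: 'a \<Rightarrow> _"
    by (intro vector_space_pair.intro vector_space_axioms vector_space_mult)
  obtain B where B: "B \<subseteq> S" "independent B" "S \<subseteq> span B"
    using maximal_independent_subset[of S] by blast
  have sp: "span B = S" using B assms(1) by (simp add: span_subspace)
  have "independent (insert w B)" using B sp assms by (intro independent_insertI) auto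
  from linear_independent_extend[OF this, of "\<lambda>x. if x = w then 1 else 0"] obtain \<psi> where
    \<psi>: "Vector_Spaces.linear scale (*) \<psi>" "\<forall>x\<in>insert w B. \<psi> x = (if x = w then 1 else 0)" by blast
  interpret p: Vector_Spaces.linear scale "(*)" \<psi> by fact
  have "\<psi> x = 0" if "x \<in> S" for x
  proof -
    have "x \<in> span B" using that sp by simp
    then show ?thesis
    proof (induction rule: span_induct)
      case base show ?case using p.subspace_kernel by simp
    next
      case (step x)
      then have "x \<noteq> w" using B(1) assms(2) by auto
      then show ?case using \<psi>(2) step by simp
    qed
  qed
  then show ?thesis using that \<psi> by simp
qed

locale tensor_product =
  fixes s1 :: "'a::field \<Rightarrow> 'b::ab_group_add \<Rightarrow> 'b" and s2 :: "'a \<Rightarrow> 'c::ab_group_add \<Rightarrow> 'c"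
    and s3 :: "'a \<Rightarrow> 'd::ab_group_add \<Rightarrow> 'd" and t :: "'b \<Rightarrow> 'c \<Rightarrow> 'd"
  assumes tensor: "is_tensor_product s1 s2 s3 t"
begin

sublocale V1: vector_space s1 using tensor by (simp add: is_tensor_product_def)
sublocale V2: vector_space s2 using tensor by (simp add: is_tensor_product_def)
sublocale V3: vector_space s3 using tensor by (simp add: is_tensor_product_def)

lemma add_left: "t (x + x') y = t x y + t x' y" and add_right: "t x (y + y') = t x y + t x y'"
  and scale_left: "t (s1 a x) y = s3 a (t x y)" and scale_right: "t x (s2 a y) = s3 a (t x y)"
  using is_tensor_product_bilinear[OF tensor] by (auto simp: bilinear_map_iff)

lemma zero_left [simp]: "t 0 y = 0" and zero_right [simp]: "t x 0 = 0"
  using scale_left[of 0 0 y] scale_right[of x 0 0] by auto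

lemma sum_left: "t (sum f I) y = (\<Sum>i\<in>I. t (f i) y)"
  by (induction I rule: infinite_finite_induct) (auto simp: add_left)

lemma induct_tensor [case_names tensor add]:
  assumes "\<And>x y. P (t x y)" "\<And>u v. P u \<Longrightarrow> P v \<Longrightarrow> P (u + v)"
  shows "P v"
proof -
  have "v \<in> range (free_lift s3 (case_prod t))" using tensor by (simp add: is_tensor_product_def)
  then obtain p where v: "v = free_lift s3 (case_prod t) p" by blast
  have "P (\<Sum>i\<in>I. s3 (c i) (case_prod t i))" for c and I :: "('b \<times> 'c) set"
  proof (induction I rule: infinite_finite_induct)
    case (insert i I)
    have "s3 (c i) (case_prod t i) = t (s1 (c i) (fst i)) (snd i)" by (simp add: scale_left split_beta)
    then have "P (s3 (c i) (case_prod t i))" using assms(1) by simp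
    then show ?case using insert assms(2) by simp
  qed (use assms(1)[of 0 0] in auto)
  then show ?thesis unfolding v free_lift_def by blast
qed

definition lift :: "('a \<Rightarrow> 'e::ab_group_add \<Rightarrow> 'e) \<Rightarrow> ('b \<Rightarrow> 'c \<Rightarrow> 'e) \<Rightarrow> 'd \<Rightarrow> 'e" where
  "lift s4 b = (THE h. Vector_Spaces.linear s3 s4 h \<and> (\<forall>x y. h (t x y) = b x y))"

context
  fixes s4 :: "'a \<Rightarrow> 'e::ab_group_add \<Rightarrow> 'e" and b
  assumes b: "bilinear_map s1 s2 s4 b"
begin

lemma linear_lift: "Vector_Spaces.linear s3 s4 (lift s4 b)" and lift_tensor: "lift s4 b (t x y) = b x y"
  using theI'[OF tensor_product_universal[OF tensor b]] by (auto simp: lift_def)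

lemma lift_add: "lift s4 b (u + v) = lift s4 b u + lift s4 b v"
  and lift_scale: "lift s4 b (s3 a v) = s4 a (lift s4 b v)"
  using linear_lift by (auto simp: Vector_Spaces.linear_iff)

end

text \<open>The universal property is used twice: for fixed x, y it yields the linear map
  \<open>q x y\<close> on the second argument, then it is applied in (x, y). That q is bilinear in
  (x, y) is checked on pure tensors in the remaining argument.\<close>

lemma bilinear_form_exists:
  assumes b1: "bilinear_map s1 s1 (*) b1" and b2: "bilinear_map s2 s2 (*) b2"
  obtains f where "bilinear_map s3 s3 (*) f" "\<And>x y x' y'. f (t x y) (t x' y') = b1 x x' * b2 y y'"
proof -
  define m where "m = ((*) :: 'a \<Rightarrow> 'a \<Rightarrow> 'a)"
  define q where "q x y = lift m (\<lambda>x' y'. b1 x x' * b2 y y')" for x y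
  note B = b1[unfolded bilinear_map_iff] b2[unfolded bilinear_map_iff]
  have bil: "bilinear_map s1 s2 m (\<lambda>x' y'. b1 x x' * b2 y y')" for x y
    using B by (auto simp: bilinear_map_iff m_def algebra_simps)
  have q: "q x y (t x' y') = b1 x x' * b2 y y'" "q x y (u + v) = q x y u + q x y v"
    "q x y (s3 a v) = a * q x y v" for x y x' y' u v a
    using lift_tensor[OF bil] lift_add[OF bil] lift_scale[OF bil] by (auto simp: q_def m_def)
  have bil2: "bilinear_map s1 s2 m (\<lambda>x y. q x y v)" for v
  proof -
    have "q (x + x') y v = q x y v + q x' y v" for x x' y
      by (induction v rule: induct_tensor) (use B in \<open>auto simp: q algebra_simps\<close>)
    moreover have "q x (y + y') v = q x y v + q x y' v" for x y y'
      by (induction v rule: induct_tensor) (use B in \<open>auto simp: q algebra_simps\<close>)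
    moreover have "q (s1 a x) y v = a * q x y v" for a x y
      by (induction v rule: induct_tensor) (use B in \<open>auto simp: q algebra_simps\<close>)
    moreover have "q x (s2 a y) v = a * q x y v" for a x y
      by (induction v rule: induct_tensor) (use B in \<open>auto simp: q algebra_simps\<close>)
    ultimately show ?thesis
      using V1.vector_space_axioms V2.vector_space_axioms vector_space_mult
      by (auto simp: bilinear_map_iff m_def)
  qed
  define f where "f u v = lift m (\<lambda>x y. q x y v) u" for u v
  have f: "f (t x y) v = q x y v" "f (u + u') v = f u v + f u' v" "f (s3 a u) v = a * f u v" for x y u u' v a
    using lift_tensor[OF bil2] lift_add[OF bil2] lift_scale[OF bil2] by (auto simp: f_def m_def)
  have "f u (v + v') = f u v + f u v'" for u v v'
    by (induction u rule: induct_tensor) (auto simp: f q algebra_simps)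
  moreover have "f u (s3 a v) = a * f u v" for u v a
    by (induction u rule: induct_tensor) (auto simp: f q algebra_simps)
  ultimately have "bilinear_map s3 s3 (*) f"
    using f V3.vector_space_axioms vector_space_mult by (auto simp: bilinear_map_iff)
  then show ?thesis using that f q by simp
qed

text \<open>This is id \<otimes> \<psi>. A functional with prescribed values turns an equation
  between tensors into one between vectors of a single factor; \<open>contract_left\<close> is the
  mirror image.\<close>

lemma contract_right:
  assumes "Vector_Spaces.linear s2 (*) \<psi>"
  obtains h where "Vector_Spaces.linear s3 s1 h" "\<And>x y. h (t x y) = s1 (\<psi> y) x"
proof -
  have "bilinear_map s1 s2 s1 (\<lambda>x y. s1 (\<psi> y) x)"
    using assms V1.vector_space_axioms V2.vector_space_axioms
    by (auto simp: bilinear_map_iff Vector_Spaces.linear_iff algebra_simps V1.scale_left_distrib V1.scale_right_distrib)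
  from that[OF linear_lift[OF this] lift_tensor[OF this]] show ?thesis .
qed

lemma contract_left:
  assumes "Vector_Spaces.linear s1 (*) \<psi>"
  obtains h where "Vector_Spaces.linear s3 s2 h" "\<And>x y. h (t x y) = s2 (\<psi> x) y"
proof -
  have "bilinear_map s1 s2 s2 (\<lambda>x y. s2 (\<psi> x) y)"
    using assms V1.vector_space_axioms V2.vector_space_axioms
    by (auto simp: bilinear_map_iff Vector_Spaces.linear_iff algebra_simps V2.scale_left_distrib V2.scale_right_distrib)
  from that[OF linear_lift[OF this] lift_tensor[OF this]] show ?thesis .
qed

end

section \<open>Nondegenerate forms in finite dimension; group modules\<close>

text \<open>The functional f(z, -) is recorded as the vector \<open>A z\<close> whose coordinates
  are its values on the basis B. This makes A an endomorphism, injective by nondegeneracy and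
  therefore surjective.\<close>

lemma (in vector_space) form_represents_functionals:
  assumes fin: "finite B0" "span B0 = UNIV" and f: "bilinear_map scale scale (*) f"
    and nondeg: "\<And>x. (\<And>y. f x y = 0) \<Longrightarrow> x = 0" and \<phi>: "Vector_Spaces.linear scale (*) \<phi>"
  shows "\<exists>z. \<forall>y. f z y = \<phi> y"
proof -
  obtain B where B: "B \<subseteq> B0" "independent B" "B0 \<subseteq> span B"
    using maximal_independent_subset[of B0] by blast
  have fB: "finite B" using B(1) fin(1) finite_subset by blast
  have sB: "span B = UNIV" using B(3) fin(2) span_mono[of B0 "span B"] by (simp add: span_span top.extremum_unique)
  interpret fd: finite_dimensional_vector_space scale B
    by unfold_locales (use fB B sB in auto)
  note F = f[unfolded bilinear_map_iff]
  interpret \<phi>: Vector_Spaces.linear scale "(*)" \<phi> by (rule \<phi>)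
  have ind: "u b = u' b" if "(\<Sum>b\<in>B. u b *s b) = (\<Sum>b\<in>B. u' b *s b)" "b \<in> B" for u u' b
  proof -
    have "(\<Sum>b\<in>B. (u b - u' b) *s b) = 0" using that by (simp add: scale_left_diff_distrib sum_subtractf)
    from independentD[OF B(2) fB subset_refl this that(2)] show ?thesis by simp
  qed
  have ext: "\<psi> y = \<psi>' y" if "\<And>b. b \<in> B \<Longrightarrow> \<psi> b = \<psi>' b" "Vector_Spaces.linear scale (*) \<psi>" "Vector_Spaces.linear scale (*) \<psi>'"
    for \<psi> \<psi>' :: "'b \<Rightarrow> 'a" and y
  proof -
    interpret vector_space_pair scale "(*) :: 'a \<Rightarrow> _"
      by (intro vector_space_pair.intro vector_space_axioms vector_space_mult)
    show ?thesis using linear_eq_on[OF that(2,3), of y B] that(1) sB by auto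
  qed
  have linf: "Vector_Spaces.linear scale (*) (f x)" for x
    using F vector_space_axioms vector_space_mult by (auto simp: Vector_Spaces.linear_iff)
  define A where "A z = (\<Sum>b\<in>B. f z b *s b)" for z
  have linA: "Vector_Spaces.linear scale scale A"
    using F vector_space_axioms
    by (auto simp: Vector_Spaces.linear_iff A_def scale_left_distrib sum.distrib scale_sum_right)
  interpret A: Vector_Spaces.linear scale scale A by (rule linA)
  have "inj A"
  proof (subst A.inj_iff_eq_0, intro allI impI)
    fix z assume "A z = 0"
    then have "f z b = 0" if "b \<in> B" for b using ind[of "f z" "\<lambda>_. 0"] that by (simp add: A_def)
    then have "f z y = 0" for y
      by (rule ext[of "f z" "\<lambda>_. 0", OF _ linf])
        (auto simp: Vector_Spaces.linear_iff vector_space_axioms vector_space_mult)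
    then show "z = 0" by (rule nondeg)
  qed
  then have "surj A" by (rule fd.linear_inj_imp_surj[OF linA])
  then obtain z where z: "A z = (\<Sum>b\<in>B. \<phi> b *s b)" by (metis surjD)
  have "f z y = \<phi> y" for y
    by (rule ext[OF _ linf \<phi>]) (rule ind, use z in \<open>auto simp: A_def\<close>)
  then show ?thesis by blast
qed

lemma (in vector_space) dual_basis_exists:
  assumes fin: "finite B0" "span B0 = UNIV" and f: "bilinear_map scale scale (*) f"
    and nondeg: "\<And>x. (\<And>y. f x y = 0) \<Longrightarrow> x = 0"
  obtains B D where "finite B" "independent B" "span B = UNIV" "\<forall>y. y = (\<Sum>b\<in>B. f (D b) y *s b)" "\<forall>b\<in>B. f (D b) b = 1"
proof -
  obtain B where B: "B \<subseteq> B0" "independent B" "B0 \<subseteq> span B"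
    using maximal_independent_subset[of B0] by blast
  have fB: "finite B" using B(1) fin(1) finite_subset by blast
  have sB: "span B = UNIV" using B(3) fin(2) span_mono[of B0 "span B"] by (simp add: span_span top.extremum_unique)
  have "Vector_Spaces.linear scale (*) (\<lambda>y. representation B y b)" for b
    using vector_space_axioms vector_space_mult B(2) sB
    by (auto simp: Vector_Spaces.linear_iff representation_add representation_scale)
  then have "\<forall>b. \<exists>z. \<forall>y. f z y = representation B y b"
    using form_represents_functionals[OF fin f nondeg] by blast
  then obtain D where D: "\<And>b y. f (D b) y = representation B y b" by metis
  show ?thesis
  proof (rule that[OF fB B(2) sB])
    show "\<forall>y. y = (\<Sum>b\<in>B. f (D b) y *s b)"
      using sum_representation_eq[OF B(2) _ fB subset_refl] sB by (simp add: D)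
    show "\<forall>b\<in>B. f (D b) b = 1" using representation_basis[OF B(2)] by (simp add: D)
  qed
qed

lemma group_module_props:
  assumes "group_module G s \<rho>" "group G"
  shows "vector_space s" "\<And>g x y. g \<in> carrier G \<Longrightarrow> \<rho> g (x + y) = \<rho> g x + \<rho> g y"
    and "\<And>g a x. g \<in> carrier G \<Longrightarrow> \<rho> g (s a x) = s a (\<rho> g x)"
    and "\<And>g h x. g \<in> carrier G \<Longrightarrow> h \<in> carrier G \<Longrightarrow> \<rho> (g \<otimes>\<^bsub>G\<^esub> h) x = \<rho> g (\<rho> h x)"
    and "\<And>x. \<rho> \<one>\<^bsub>G\<^esub> x = x"
    and "\<And>g x. g \<in> carrier G \<Longrightarrow> \<rho> g (\<rho> (inv\<^bsub>G\<^esub> g) x) = x"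
    and "\<And>g x. g \<in> carrier G \<Longrightarrow> \<rho> (inv\<^bsub>G\<^esub> g) (\<rho> g x) = x"
proof -
  have act: "group_action G UNIV \<rho>" using assms(1) by (simp add: group_module_def)
  then interpret hom: group_hom G "BijGroup UNIV" \<rho> by (simp add: group_action_def)
  interpret group G by fact
  show "vector_space s" "\<And>g x y. g \<in> carrier G \<Longrightarrow> \<rho> g (x + y) = \<rho> g x + \<rho> g y"
    "\<And>g a x. g \<in> carrier G \<Longrightarrow> \<rho> g (s a x) = s a (\<rho> g x)"
    using assms(1) by (auto simp: group_module_def Vector_Spaces.linear_iff)
  show mult: "\<rho> (g \<otimes>\<^bsub>G\<^esub> h) x = \<rho> g (\<rho> h x)" if "g \<in> carrier G" "h \<in> carrier G" for g h x
  proof -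
    have "\<rho> g \<in> Bij UNIV" "\<rho> h \<in> Bij UNIV"
      using hom.hom_closed that by (auto simp: BijGroup_def)
    then have "\<rho> (g \<otimes>\<^bsub>G\<^esub> h) = compose UNIV (\<rho> g) (\<rho> h)"
      using hom.hom_mult[OF that] by (simp add: BijGroup_def)
    then show ?thesis by (simp add: compose_def)
  qed
  show one: "\<rho> \<one>\<^bsub>G\<^esub> x = x" for x
    using hom.hom_one by (simp add: BijGroup_def fun_eq_iff)
  show "\<rho> g (\<rho> (inv\<^bsub>G\<^esub> g) x) = x" "\<rho> (inv\<^bsub>G\<^esub> g) (\<rho> g x) = x" if "g \<in> carrier G" for g x
    using mult[OF that hom.G.inv_closed[OF that], of x] mult[OF hom.G.inv_closed[OF that] that, of x] one that
    by (simp_all del: hom.hom_inv)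
qed

lemma group_moduleI:
  assumes "group G" "vector_space s"
    and lin: "\<And>g. g \<in> carrier G \<Longrightarrow> Vector_Spaces.linear s s (\<rho> g)"
    and mult: "\<And>g h x. g \<in> carrier G \<Longrightarrow> h \<in> carrier G \<Longrightarrow> \<rho> (g \<otimes>\<^bsub>G\<^esub> h) x = \<rho> g (\<rho> h x)"
    and one: "\<And>x. \<rho> \<one>\<^bsub>G\<^esub> x = x"
  shows "group_module G s \<rho>"
proof -
  interpret group G by fact
  have bij: "\<rho> g \<in> Bij UNIV" if "g \<in> carrier G" for g
  proof -
    have "\<rho> g \<circ> \<rho> (inv\<^bsub>G\<^esub> g) = id" "\<rho> (inv\<^bsub>G\<^esub> g) \<circ> \<rho> g = id"
      using that by (auto simp: fun_eq_iff mult [symmetric] one)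
    then have "bij (\<rho> g)" by (metis o_bij)
    then show ?thesis by (simp add: Bij_def)
  qed
  have "\<rho> \<in> hom G (BijGroup UNIV)"
    by (auto simp: hom_def BijGroup_def bij mult compose_def fun_eq_iff)
  then have "group_action G UNIV \<rho>"
    by (simp add: group_action_def group_hom_def group_hom_axioms_def group_axioms group_BijGroup)
  then show ?thesis using assms lin by (simp add: group_module_def)
qed

section \<open>Absolutely simple modules\<close>

text \<open>Split off a root of the polynomial \<open>\<Sum>k\<le>n. f k X^k\<close> annihilating \<open>u\<close> until an eigenvector appears.\<close>

lemma eigenvector_exists:
  fixes s :: "'e::alg_closed_field \<Rightarrow> 'u::ab_group_add \<Rightarrow> 'u"
  assumes \<Phi>: "Vector_Spaces.linear s s \<Phi>"
  shows "f n \<noteq> 0 \<Longrightarrow> (\<Sum>k\<le>n. s (f k) ((\<Phi> ^^ k) u)) = 0 \<Longrightarrow> u \<noteq> 0 \<Longrightarrow> \<exists>\<mu> w. w \<noteq> 0 \<and> \<Phi> w = s \<mu> w"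
proof (induction n arbitrary: f u)
  case 0
  interpret vector_space s using \<Phi> by (simp add: Vector_Spaces.linear_iff)
  show ?case using 0 by simp
next
  case (Suc n)
  interpret \<Phi>: Vector_Spaces.linear s s \<Phi> by fact
  obtain \<mu> where \<mu>: "(\<Sum>k\<le>Suc n. f k * \<mu> ^ k) = 0" using alg_closed[of "Suc n" f] Suc.prems by auto
  define p where "p = (\<Sum>k\<le>Suc n. Polynomial.monom (f k) k)"
  have cp: "Polynomial.coeff p k = (if k \<le> Suc n then f k else 0)" for k
    by (simp add: p_def coeff_sum del: sum.atMost_Suc)
  have "poly p \<mu> = 0" using \<mu> by (simp add: p_def poly_sum poly_monom del: sum.atMost_Suc)
  then obtain q where q: "p = [:- \<mu>, 1:] * q" by (auto simp: poly_eq_0_iff_dvd)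
  define d where "d k = Polynomial.coeff q k" for k
  have pk: "Polynomial.coeff p k = (case k of 0 \<Rightarrow> 0 | Suc j \<Rightarrow> d j) - \<mu> * d k" for k
    by (simp add: q d_def coeff_pCons split: nat.split)
  have d0: "d k = 0" if "k > n" for k
  proof -
    have "Polynomial.degree p = Suc n"
      using Suc.prems(1) by (intro antisym degree_le le_degree) (auto simp: cp)
    moreover have "q \<noteq> 0" using Suc.prems(1) cp[of "Suc n"] q by auto
    ultimately have "Polynomial.degree q = n" using q by (simp add: degree_mult_eq del: mult_pCons_left)
    then show ?thesis using that by (simp add: d_def coeff_eq_0)
  qed
  have dn: "d n \<noteq> 0" using pk[of "Suc n"] cp[of "Suc n"] d0[of "Suc n"] Suc.prems(1) by simp
  have lin: "(\<Phi> ^^ k) (x - y) = (\<Phi> ^^ k) x - (\<Phi> ^^ k) y" "(\<Phi> ^^ k) (s a x) = s a ((\<Phi> ^^ k) x)" for k x y a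
    by (induction k) (auto simp: \<Phi>.diff \<Phi>.scale)
  \<comment> \<open>X - \<mu> is applied to u. Either the result is 0 and u is an eigenvector, or
    the cofactor q, of degree n, annihilates it and the induction continues.\<close>
  define u' where "u' = \<Phi> u - s \<mu> u"
  have "(\<Sum>k\<le>n. s (d k) ((\<Phi> ^^ k) u')) = (\<Sum>k\<le>n. s (d k) ((\<Phi> ^^ Suc k) u)) - (\<Sum>k\<le>n. s (\<mu> * d k) ((\<Phi> ^^ k) u))"
    by (simp add: u'_def lin sum_subtractf \<Phi>.vs1.scale_right_diff_distrib funpow_swap1 mult.commute)
  also have "(\<Sum>k\<le>n. s (d k) ((\<Phi> ^^ Suc k) u))
      = (\<Sum>k\<le>Suc n. s (case k of 0 \<Rightarrow> 0 | Suc j \<Rightarrow> d j) ((\<Phi> ^^ k) u))"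
    by (simp add: sum.atMost_Suc_shift del: sum.atMost_Suc funpow.simps)
  also have "(\<Sum>k\<le>n. s (\<mu> * d k) ((\<Phi> ^^ k) u)) = (\<Sum>k\<le>Suc n. s (\<mu> * d k) ((\<Phi> ^^ k) u))"
    by (simp add: d0)
  also have "(\<Sum>k\<le>Suc n. s (case k of 0 \<Rightarrow> 0 | Suc j \<Rightarrow> d j) ((\<Phi> ^^ k) u)) - \<dots>
      = (\<Sum>k\<le>Suc n. s (Polynomial.coeff p k) ((\<Phi> ^^ k) u))"
    unfolding sum_subtractf [symmetric] \<Phi>.vs1.scale_left_diff_distrib [symmetric] pk ..
  also have "\<dots> = (\<Sum>k\<le>Suc n. s (f k) ((\<Phi> ^^ k) u))" by (intro sum.cong refl) (simp add: cp)
  also have "\<dots> = 0" by (rule Suc.prems(2))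
  finally have *: "(\<Sum>k\<le>n. s (d k) ((\<Phi> ^^ k) u')) = 0" .
  show ?case
  proof (cases "u' = 0")
    case True
    then show ?thesis using Suc.prems(3) by (auto simp: u'_def)
  qed (use Suc.IH[OF dn *] in blast)
qed

locale absolutely_simple_module =
  fixes U :: "'u::ab_group_add itself" and N :: "('n, 'm) monoid_scheme" (structure)
    and s :: "'k::field \<Rightarrow> 'w::ab_group_add \<Rightarrow> 'w" and \<rho> :: "'n \<Rightarrow> 'w \<Rightarrow> 'w"
  assumes group_N: "group N" and finite_N: "finite (carrier N)"
    and abs_simple: "absolutely_simple U N s \<rho>"
begin

sublocale group N by (rule group_N)

lemma module: "group_module N s \<rho>"
  using abs_simple by (simp add: absolutely_simple_def)

lemmas act = group_module_props[OF module group_N]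

sublocale vector_space s by (rule act(1))

definition orbit_of :: "'w \<Rightarrow> 'w set" where "orbit_of x = (\<lambda>g. \<rho> g x) ` carrier N"

text \<open>Simplicity is given over the closure and has to descend. If a functional \<psi> killed
  the orbit of x but not w, its extension h would kill the orbit of x \<otimes> 1. The vectors whose
  orbit lies in the kernel of h form a submodule; it is nonzero, hence everything, yet w \<otimes> 1
  is not in it.\<close>

lemma span_orbit:
  assumes "x \<noteq> 0"
  shows "span (orbit_of x) = UNIV"
proof (rule ccontr)
  assume "span (orbit_of x) \<noteq> UNIV"
  then obtain w where "w \<notin> span (orbit_of x)" by blast
  then obtain \<psi> where \<psi>: "Vector_Spaces.linear s (*) \<psi>" "\<And>y. y \<in> span (orbit_of x) \<Longrightarrow> \<psi> y = 0" "\<psi> w = 1"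
    using functional_separating[OF subspace_span] by blast
  obtain sU :: "'k alg_closure \<Rightarrow> 'u \<Rightarrow> 'u" and \<rho>U t where
    ext: "scalar_extension to_ac N s \<rho> sU \<rho>U t" and simple: "simple_module N sU \<rho>U"
    using abs_simple unfolding absolutely_simple_def by blast
  have T: "tensor_product s (ext_scale to_ac) (\<lambda>a. sU (to_ac a)) t"
    and sU: "\<And>c x e. sU c (t x e) = t x (c * e)" and mU: "group_module N sU \<rho>U"
    and \<rho>U: "\<And>g x e. g \<in> carrier N \<Longrightarrow> \<rho>U g (t x e) = t (\<rho> g x) e"
    using ext by (auto simp: scalar_extension_def tensor_product_def)
  have simpleU: "S = {0} \<or> S = UNIV"
    if "module.subspace sU S" "\<And>g. g \<in> carrier N \<Longrightarrow> \<rho>U g ` S \<subseteq> S" for S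
    using simple that by (simp add: simple_module_def)
  interpret T: tensor_product s "ext_scale to_ac" "\<lambda>a. sU (to_ac a)" t by (rule T)
  note actU = group_module_props[OF mU group_N]
  interpret U: vector_space sU by (rule actU(1))
  obtain h where h: "Vector_Spaces.linear (\<lambda>a. sU (to_ac a)) (ext_scale to_ac) h"
    "\<And>y e. h (t y e) = to_ac (\<psi> y) * e"
    using T.contract_left[OF \<psi>(1)] by (metis ext_scale_def)
  have hadd: "h (u + v) = h u + h v" for u v using h(1) by (simp add: Vector_Spaces.linear_iff)
  have hscale: "h (sU c u) = c * h u" for c u
    by (induction u rule: T.induct_tensor) (auto simp: sU h hadd U.scale_right_distrib algebra_simps)
  have h0: "h 0 = 0" using hadd[of 0 0] by (simp only: add_0 add_cancel_right_right)
  define Z where "Z = {u. \<forall>g\<in>carrier N. h (\<rho>U g u) = 0}"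
  have \<rho>U0: "\<rho>U g 0 = 0" if "g \<in> carrier N" for g using actU(3)[OF that, of 0 0] by simp
  have "U.subspace Z"
    by (auto simp: U.subspace_def Z_def actU hadd hscale h0 \<rho>U0)
  moreover have "\<rho>U g ` Z \<subseteq> Z" if "g \<in> carrier N" for g
    using that by (auto simp: Z_def actU(4) [symmetric])
  ultimately have "Z = {0} \<or> Z = UNIV" by (rule simpleU)
  moreover have "t x 1 \<in> Z"
    using \<psi>(2) span_base by (auto simp: Z_def \<rho>U h orbit_of_def)
  moreover have "t x 1 \<noteq> 0"
  proof
    assume 0: "t x 1 = 0"
    obtain \<psi>' where \<psi>': "Vector_Spaces.linear s (*) \<psi>'" "\<psi>' x = 1"
      using functional_separating[OF subspace_single_0, of x] assms by blast
    then obtain h' where "Vector_Spaces.linear (\<lambda>a. sU (to_ac a)) (ext_scale to_ac) h'"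
      "\<And>y e. h' (t y e) = to_ac (\<psi>' y) * e"
      using T.contract_left[OF \<psi>'(1)] by (metis ext_scale_def)
    then show False using 0 \<psi>'(2) by (metis T.zero_left zero_neq_one mult_1_right to_ac_1 mult_zero_right T.zero_right)
  qed
  ultimately have "Z = UNIV" by blast
  then have "h (\<rho>U \<one> (t w 1)) = 0" by (auto simp: Z_def)
  then show False using actU(5) h(2) \<psi>(3) by simp
qed

lemma finite_orbit: "finite (orbit_of x)"
  by (simp add: orbit_of_def finite_N)

text \<open>Over the closure \<phi> \<otimes> id has an eigenvector; the eigenspace is a submodule,
  so \<phi> \<otimes> id is a scalar \<mu>. It lies in K: otherwise a K-linear functional with value
  0 at 1 and 1 at \<mu> contracts \<phi>(x) \<otimes> 1 = x \<otimes> \<mu> to 0 = x.\<close>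

lemma schur:
  assumes \<phi>: "Vector_Spaces.linear s s \<phi>" and comm: "\<And>g x. g \<in> carrier N \<Longrightarrow> \<phi> (\<rho> g x) = \<rho> g (\<phi> x)"
  shows "\<exists>a. \<forall>x. \<phi> x = s a x"
proof (cases "\<exists>x::'w. x \<noteq> 0")
  case True
  then obtain x0 :: 'w where x0: "x0 \<noteq> 0" by blast
  obtain sU :: "'k alg_closure \<Rightarrow> 'u \<Rightarrow> 'u" and \<rho>U t where
    ext: "scalar_extension to_ac N s \<rho> sU \<rho>U t" and simple: "simple_module N sU \<rho>U"
    using abs_simple unfolding absolutely_simple_def by blast
  have T: "tensor_product s (ext_scale to_ac) (\<lambda>a. sU (to_ac a)) t"
    and sU: "\<And>c x e. sU c (t x e) = t x (c * e)" and mU: "group_module N sU \<rho>U"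
    and \<rho>U: "\<And>g x e. g \<in> carrier N \<Longrightarrow> \<rho>U g (t x e) = t (\<rho> g x) e"
    using ext by (auto simp: scalar_extension_def tensor_product_def)
  have simpleU: "S = {0} \<or> S = UNIV"
    if "module.subspace sU S" "\<And>g. g \<in> carrier N \<Longrightarrow> \<rho>U g ` S \<subseteq> S" for S
    using simple that by (simp add: simple_module_def)
  interpret T: tensor_product s "ext_scale to_ac" "\<lambda>a. sU (to_ac a)" t by (rule T)
  note actU = group_module_props[OF mU group_N]
  interpret U: vector_space sU by (rule actU(1))
  have \<phi>': "\<phi> (x + y) = \<phi> x + \<phi> y" "\<phi> (s a x) = s a (\<phi> x)" for x y a
    using \<phi> by (auto simp: Vector_Spaces.linear_iff)
  have bil: "bilinear_map s (ext_scale to_ac) (\<lambda>a. sU (to_ac a)) (\<lambda>x e. t (\<phi> x) e)"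
    using vector_space_axioms T.V2.vector_space_axioms T.V3.vector_space_axioms
    by (auto simp: bilinear_map_iff \<phi>' T.add_left T.add_right T.scale_left T.scale_right)
  define \<Phi> where "\<Phi> = T.lift (\<lambda>a. sU (to_ac a)) (\<lambda>x e. t (\<phi> x) e)"
  have \<Phi>: "\<Phi> (t x e) = t (\<phi> x) e" "\<Phi> (u + v) = \<Phi> u + \<Phi> v" for x e u v
    using T.lift_tensor[OF bil] T.lift_add[OF bil] by (auto simp: \<Phi>_def)
  have \<Phi>_scale: "\<Phi> (sU c u) = sU c (\<Phi> u)" for c u
    by (induction u rule: T.induct_tensor) (auto simp: sU \<Phi> U.scale_right_distrib)
  have \<Phi>_lin: "Vector_Spaces.linear sU sU \<Phi>"
    using U.vector_space_axioms by (auto simp: Vector_Spaces.linear_iff \<Phi> \<Phi>_scale)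
  have \<Phi>_comm: "\<Phi> (\<rho>U g u) = \<rho>U g (\<Phi> u)" if "g \<in> carrier N" for g u
    by (induction u rule: T.induct_tensor) (auto simp: \<rho>U \<Phi> comm actU that)
  have inj: "x = 0" if "t x 1 = 0" for x
  proof (rule ccontr)
    assume "x \<noteq> 0"
    obtain \<psi>' where \<psi>': "Vector_Spaces.linear s (*) \<psi>'" "\<psi>' x = 1"
      using functional_separating[OF subspace_single_0, of x] \<open>x \<noteq> 0\<close> by blast
    then obtain h' where "Vector_Spaces.linear (\<lambda>a. sU (to_ac a)) (ext_scale to_ac) h'"
      "\<And>y e. h' (t y e) = to_ac (\<psi>' y) * e"
      using T.contract_left[OF \<psi>'(1)] by (metis ext_scale_def)
    then show False using that \<psi>'(2) by (metis T.zero_left zero_neq_one mult_1_right to_ac_1 mult_zero_right T.zero_right)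
  qed
  have sp: "(\<phi> ^^ i) x0 \<in> span (orbit_of x0)" for i using span_orbit[OF x0] by simp
  obtain n c where c: "\<exists>i\<le>n. c i \<noteq> 0" "(\<Sum>i\<le>n. s (c i) ((\<phi> ^^ i) x0)) = 0"
    by (rule linear_relation[OF finite_orbit sp])
  \<comment> \<open>\<open>eigenvector_exists\<close> wants a nonzero leading coefficient, so the
    relation is cut off at its last nonzero term.\<close>
  define m where "m = Max {i. i \<le> n \<and> c i \<noteq> 0}"
  have m: "m \<le> n" "c m \<noteq> 0" using Max_in[of "{i. i \<le> n \<and> c i \<noteq> 0}"] c(1) by (auto simp: m_def)
  have gt: "c i = 0" if "i > m" "i \<le> n" for i
  proof (rule ccontr)
    assume "c i \<noteq> 0"
    then have "i \<le> m" unfolding m_def using that by (intro Max_ge) auto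
    then show False using that by simp
  qed
  have "(\<Sum>i\<le>m. s (c i) ((\<phi> ^^ i) x0)) = (\<Sum>i\<le>n. s (c i) ((\<phi> ^^ i) x0))"
    using m gt by (intro sum.mono_neutral_left) auto
  then have cm: "(\<Sum>i\<le>m. s (c i) ((\<phi> ^^ i) x0)) = 0" using c(2) by simp
  have pow: "(\<Phi> ^^ i) (t x0 1) = t ((\<phi> ^^ i) x0) 1" for i by (induction i) (auto simp: \<Phi>)
  have "(\<Sum>i\<le>m. sU (to_ac (c i)) ((\<Phi> ^^ i) (t x0 1))) = t (\<Sum>i\<le>m. s (c i) ((\<phi> ^^ i) x0)) 1"
    by (simp add: pow T.sum_left T.scale_left)
  also have "\<dots> = 0" by (simp add: cm)
  finally obtain \<mu> w where \<mu>: "w \<noteq> 0" "\<Phi> w = sU \<mu> w"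
    using eigenvector_exists[OF \<Phi>_lin, of "\<lambda>i. to_ac (c i)" m "t x0 1"] m x0 inj by auto
  have \<Phi>0: "\<Phi> 0 = 0" using \<Phi>(2)[of 0 0] by (simp only: add_0 add_cancel_right_right)
  have "U.subspace {u. \<Phi> u = sU \<mu> u}"
    by (auto simp: U.subspace_def \<Phi> \<Phi>_scale \<Phi>0 U.scale_right_distrib U.scale_left_commute)
  moreover have "\<rho>U g ` {u. \<Phi> u = sU \<mu> u} \<subseteq> {u. \<Phi> u = sU \<mu> u}" if "g \<in> carrier N" for g
    using that by (auto simp: \<Phi>_comm actU)
  ultimately have "{u. \<Phi> u = sU \<mu> u} = {0} \<or> {u. \<Phi> u = sU \<mu> u} = UNIV" by (rule simpleU)
  then have "\<Phi> u = sU \<mu> u" for u using \<mu> by blast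
  from this[of "t x 1" for x] have eq: "t (\<phi> x) 1 = t x \<mu>" for x by (simp add: \<Phi> sU)
  show ?thesis
  proof (cases "\<mu> \<in> range to_ac")
    case True
    then obtain a where a: "\<mu> = to_ac a" by blast
    have "\<phi> x = s a x" for x
    proof -
      have "t x \<mu> = t (s a x) 1" using T.scale_right[of x a 1] T.scale_left[of a x 1] by (simp add: a ext_scale_def)
      then have "t (\<phi> x - s a x) 1 = 0" using eq[of x] T.add_left[of "\<phi> x - s a x" "s a x" 1] by simp
      then show ?thesis using inj by fastforce
    qed
    then show ?thesis by blast
  next
    case False
    have "\<mu> \<notin> T.V2.span {1}" using False by (auto simp: T.V2.span_singleton ext_scale_def)
    then obtain \<psi> where \<psi>: "Vector_Spaces.linear (ext_scale to_ac) (*) \<psi>" "\<And>e. e \<in> T.V2.span {1} \<Longrightarrow> \<psi> e = 0" "\<psi> \<mu> = 1"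
      using T.V2.functional_separating[OF T.V2.subspace_span] by blast
    obtain h where h: "\<And>x e. h (t x e) = s (\<psi> e) x" using T.contract_right[OF \<psi>(1)] by metis
    have "\<psi> 1 = 0" using \<psi>(2) T.V2.span_base by simp
    then have "x0 = 0" using arg_cong[OF eq[of x0], of h] by (simp add: h \<psi>(3))
    then show ?thesis using x0 by simp
  qed
qed (metis)

end

section \<open>Invariant forms and Schur orthogonality\<close>

locale simple_symplectic_module = absolutely_simple_module U N s \<rho>
  for U :: "'u::ab_group_add itself" and N :: "('n, 'm) monoid_scheme" (structure)
    and s :: "'k::field_char_0 \<Rightarrow> 'w::ab_group_add \<Rightarrow> 'w" and \<rho> +
  fixes f :: "'w \<Rightarrow> 'w \<Rightarrow> 'k"
  assumes symplectic: "symplectic_form N s \<rho> f" and nonzero: "\<exists>w::'w. w \<noteq> 0"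
begin

lemma f_bilinear: "bilinear_map s s (*) f"
  using symplectic by (simp add: symplectic_form_def)

lemma f_add_left: "f (x + y) z = f x z + f y z" and f_add_right: "f x (y + z) = f x y + f x z"
  and f_scale_left: "f (s a x) y = a * f x y" and f_scale_right: "f x (s a y) = a * f x y"
  using f_bilinear by (auto simp: bilinear_map_iff)

lemma f_self [simp]: "f x x = 0" and f_nondegenerate: "(\<And>y. f x y = 0) \<Longrightarrow> x = 0"
  and f_invariant: "g \<in> carrier N \<Longrightarrow> f (\<rho> g x) (\<rho> g y) = f x y"
  using symplectic by (auto simp: symplectic_form_def)

lemma f_antisym: "f y x = - f x y"
proof -
  have "f x x + f y x + (f x y + f y y) = 0"
    using f_self[of "x + y"] by (simp only: f_add_left f_add_right)
  then show ?thesis by (simp add: eq_neg_iff_add_eq_0)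
qed

lemma f_zero [simp]: "f 0 x = 0" "f x 0 = 0"
  using f_scale_left[of 0 0 x] f_scale_right[of x 0 0] by auto

lemma f_sum_right: "f y (sum h I) = (\<Sum>i\<in>I. f y (h i))"
  by (induction I rule: infinite_finite_induct) (auto simp: f_add_right)

lemma f_eqI: "(\<And>y. f y x = f y x') \<Longrightarrow> x = x'"
proof -
  assume "\<And>y. f y x = f y x'"
  then have "f x y = f x' y" for y
    using f_antisym[of y x] f_antisym[of y x'] by simp
  then have "f (x - x') y = 0" for y
    using f_add_left[of "x - x'" x' y] by simp
  then show "x = x'" using f_nondegenerate[of "x - x'"] by simp
qed

text \<open>Finite dimension comes from simplicity: W is spanned by one orbit of the finite group
  N.\<close>

lemma finite_spanning: "\<exists>B. finite B \<and> span B = UNIV"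
  using nonzero span_orbit finite_orbit by metis

text \<open>A vector orthogonal to its orbit is orthogonal to the span W of the orbit. As f is
  alternating, g = 1 never serves, which is why a translate h w appears in
  \<open>normalized_form\<close>.\<close>

lemma orbit_pairing_nonzero:
  assumes "w \<noteq> 0"
  shows "\<exists>g\<in>carrier N. f (\<rho> g w) w \<noteq> 0"
proof (rule ccontr)
  assume not: "\<not> ?thesis"
  have "f y w = 0" for y
  proof -
    have "y \<in> span (orbit_of w)" using span_orbit[OF assms] by simp
    then show ?thesis
    proof (induction rule: span_induct)
      case base
      show ?case by (auto simp: subspace_def f_add_left f_scale_left)
    qed (use not in \<open>auto simp: orbit_of_def\<close>)
  qed
  then have "f w y = 0" for y using f_antisym[of w y] by simp
  then show False using f_nondegenerate assms by blast
qed

text \<open>Through f, the form b becomes an endomorphism \<phi> with b(x, y) = f(\<phi> x, y).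
  Invariance of both forms makes it commute with N, and \<open>schur\<close> applies.\<close>

lemma invariant_form_multiple:
  assumes b: "bilinear_map s s (*) b" and inv: "\<And>g x y. g \<in> carrier N \<Longrightarrow> b (\<rho> g x) (\<rho> g y) = b x y"
  shows "\<exists>a. \<forall>x y. b x y = a * f x y"
proof -
  obtain B where B: "finite B" "span B = UNIV" using finite_spanning by blast
  have b': "b (x + y) z = b x z + b y z" "b x (y + z) = b x y + b x z" "b (s a x) y = a * b x y"
    "b x (s a y) = a * b x y" for x y z a
    using b by (auto simp: bilinear_map_iff)
  have "Vector_Spaces.linear s (*) (b x)" for x
    using b by (simp add: bilinear_map_def)
  then have "\<forall>x. \<exists>z. \<forall>y. f z y = b x y"
    using form_represents_functionals[OF B f_bilinear f_nondegenerate] by blast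
  then obtain \<phi> where \<phi>: "\<And>x y. f (\<phi> x) y = b x y" by metis
  have eqI: "x = x'" if "\<And>y. f x y = f x' y" for x x'
    using f_eqI[of x x'] f_antisym that by metis
  have "\<phi> (x + y) = \<phi> x + \<phi> y" for x y by (rule eqI) (simp add: \<phi> f_add_left b')
  moreover have "\<phi> (s a x) = s a (\<phi> x)" for a x by (rule eqI) (simp add: \<phi> f_scale_left b')
  ultimately have "Vector_Spaces.linear s s \<phi>"
    using vector_space_axioms by (simp add: Vector_Spaces.linear_iff)
  moreover have "\<phi> (\<rho> g x) = \<rho> g (\<phi> x)" if g: "g \<in> carrier N" for g x
  proof (rule eqI)
    fix y
    have "f (\<rho> g (\<phi> x)) y = f (\<phi> x) (\<rho> (inv g) y)"
      using f_invariant[OF g, of "\<phi> x" "\<rho> (inv g) y"] act(6)[OF g] by simp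
    also have "\<dots> = b (\<rho> g x) y"
      using inv[OF g, of x "\<rho> (inv g) y"] act(6)[OF g] by (simp add: \<phi>)
    finally show "f (\<phi> (\<rho> g x)) y = f (\<rho> g (\<phi> x)) y" by (simp add: \<phi>)
  qed
  ultimately obtain a where "\<forall>x. \<phi> x = s a x" using schur by blast
  then have "b x y = a * f x y" for x y by (metis \<phi> f_scale_left)
  then show ?thesis by blast
qed

lemma sum_translate:
  assumes "h \<in> carrier N"
  shows "(\<Sum>g\<in>carrier N. F (g \<otimes> h)) = (\<Sum>g\<in>carrier N. F g)"
  by (rule sum.reindex_bij_witness[of _ "\<lambda>g. g \<otimes> inv h" "\<lambda>g. g \<otimes> h"])
    (use assms in \<open>auto simp: m_assoc\<close>)

lemma sum_translate_left:
  assumes "h \<in> carrier N"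
  shows "(\<Sum>g\<in>carrier N. F (h \<otimes> g)) = (\<Sum>g\<in>carrier N. F g)"
  by (rule sum.reindex_bij_witness[of _ "\<lambda>g. inv h \<otimes> g" "\<lambda>g. h \<otimes> g"])
    (use assms in \<open>auto simp: m_assoc [symmetric]\<close>)

text \<open>For fixed u, u' the sum is invariant in (x, y) by right translation, hence a multiple of
  f; the multiplier is invariant in (u, u') by left translation, hence again a multiple of f.
  Contracting u, u' over f-dual bases evaluates the remaining constant: n C = |N| with n = dim
  W.\<close>

lemma schur_orthogonality:
  obtains n C where "n > 0" "of_nat n * C = of_nat (Coset.order N)"
    "\<forall>x y u u'. (\<Sum>g\<in>carrier N. f (\<rho> g x) u * f (\<rho> g y) u') = C * f x y * f u u'"
proof -
  obtain x0 y0 where 1: "f x0 y0 = 1"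
  proof -
    obtain w :: 'w where "w \<noteq> 0" using nonzero by blast
    then obtain y where "f w y \<noteq> 0" using f_nondegenerate by blast
    then have "f w (s (1 / f w y) y) = 1" by (simp add: f_scale_right)
    then show ?thesis by (rule that)
  qed
  define S where "S x y u u' = (\<Sum>g\<in>carrier N. f (\<rho> g x) u * f (\<rho> g y) u')" for x y u u'
  define D where "D u u' = S x0 y0 u u'" for u u'
  have D: "S x y u u' = D u u' * f x y" for x y u u'
  proof -
    have "bilinear_map s s (*) (\<lambda>x y. S x y u u')"
      using vector_space_axioms vector_space_mult
      by (auto simp: bilinear_map_iff S_def act f_add_left f_scale_left distrib_right distrib_left
          sum.distrib sum_distrib_left mult_ac cong: sum.cong)
    moreover have "S (\<rho> h x) (\<rho> h y) u u' = S x y u u'" if "h \<in> carrier N" for h x y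
    proof -
      have "S (\<rho> h x) (\<rho> h y) u u' = (\<Sum>g\<in>carrier N. f (\<rho> (g \<otimes> h) x) u * f (\<rho> (g \<otimes> h) y) u')"
        using that by (simp add: S_def act cong: sum.cong)
      then show ?thesis by (simp only: S_def sum_translate[OF that, of "\<lambda>g. f (\<rho> g x) u * f (\<rho> g y) u'"])
    qed
    ultimately obtain a where a: "\<forall>x y. S x y u u' = a * f x y" using invariant_form_multiple by blast
    then have "a = D u u'" using 1 by (simp add: D_def)
    then show ?thesis using a by simp
  qed
  have "\<exists>C. \<forall>u u'. D u u' = C * f u u'"
  proof (rule invariant_form_multiple)
    show "bilinear_map s s (*) D"
      using vector_space_axioms vector_space_mult
      by (auto simp: bilinear_map_iff S_def D_def f_add_right f_scale_right distrib_right distrib_left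
          sum.distrib sum_distrib_left mult_ac)
    fix h u u' assume h: "h \<in> carrier N"
    have "f (\<rho> g x) (\<rho> h u) = f (\<rho> (inv h \<otimes> g) x) u" if "g \<in> carrier N" for g x u
      using f_invariant[OF h, of "\<rho> (inv h) (\<rho> g x)" u] h that by (simp add: act)
    then have "D (\<rho> h u) (\<rho> h u') = (\<Sum>g\<in>carrier N. f (\<rho> (inv h \<otimes> g) x0) u * f (\<rho> (inv h \<otimes> g) y0) u')"
      by (simp add: D_def S_def cong: sum.cong)
    then show "D (\<rho> h u) (\<rho> h u') = D u u'"
      by (simp only: D_def S_def sum_translate_left[OF inv_closed[OF h], of "\<lambda>g. f (\<rho> g x0) u * f (\<rho> g y0) u'"])
  qed
  then obtain C where C: "\<And>u u'. D u u' = C * f u u'" by blast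
  obtain B0 where B0: "finite B0" "span B0 = UNIV" using finite_spanning by blast
  obtain B E where B: "finite B" "independent B" "span B = UNIV"
    and E: "\<forall>y. y = (\<Sum>b\<in>B. s (f (E b) y) b)" "\<forall>b\<in>B. f (E b) b = 1"
    by (rule dual_basis_exists[OF B0 f_bilinear f_nondegenerate])
  have "(\<Sum>b\<in>B. S x0 y0 (E b) b) = (\<Sum>g\<in>carrier N. \<Sum>b\<in>B. f (\<rho> g x0) (E b) * f (\<rho> g y0) b)"
    unfolding S_def by (rule sum.swap)
  also have "\<dots> = (\<Sum>g\<in>carrier N. f x0 y0)"
  proof (rule sum.cong)
    fix g assume g: "g \<in> carrier N"
    \<comment> \<open>Expanding g x0 in the basis B collapses the inner sum to f(x0, y0), which is
      the same for every g.\<close>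
    have "f x0 y0 = - f (\<rho> g y0) (\<rho> g x0)" using f_invariant[OF g] f_antisym by metis
    also have "\<dots> = - f (\<rho> g y0) (\<Sum>b\<in>B. s (f (E b) (\<rho> g x0)) b)" 
      by (rule arg_cong[where f = "\<lambda>z. - f (\<rho> g y0) z"]) (rule E(1)[rule_format])
    also have "\<dots> = (\<Sum>b\<in>B. f (\<rho> g x0) (E b) * f (\<rho> g y0) b)"
      by (simp add: f_sum_right f_scale_right f_antisym[of "\<rho> g x0"] sum_negf)
    finally show "(\<Sum>b\<in>B. f (\<rho> g x0) (E b) * f (\<rho> g y0) b) = f x0 y0" by simp
  qed simp
  finally have "of_nat (card B) * C = of_nat (Coset.order N)"
    using 1 E(2) by (simp add: D C Coset.order_def cong: sum.cong)
  moreover have "card B > 0"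
  proof -
    have "B \<noteq> {}" using B(3) nonzero by auto
    then show ?thesis using B(1) by (simp add: card_gt_0_iff)
  qed
  moreover have "(\<Sum>g\<in>carrier N. f (\<rho> g x) u * f (\<rho> g y) u') = C * f x y * f u u'" for x y u u'
    using D[of x y u u'] C[of u u'] by (simp add: S_def mult_ac)
  ultimately show ?thesis using that by blast
qed

text \<open>
  When the order of \<open>N\<close> is a unit, \<open>1 / C = n / |N|\<close> is integral, so that dividing by \<open>C\<close> is harmless
  for lattices; whether the dimension \<open>n\<close> is a unit does not matter.
\<close>

lemma projection_from_group_algebra:
  obtains n C where "n > 0" "of_nat n * C = of_nat (Coset.order N)"
    "\<forall>w x. (\<Sum>g\<in>carrier N. s (f (\<rho> g w) w) (\<rho> (inv g) x)) = s (C * f x w) w"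
proof -
  obtain n C where n: "n > 0" "of_nat n * C = of_nat (Coset.order N)"
    and C: "\<forall>x y u u'. (\<Sum>g\<in>carrier N. f (\<rho> g x) u * f (\<rho> g y) u') = C * f x y * f u u'"
    by (rule schur_orthogonality)
  have "(\<Sum>g\<in>carrier N. s (f (\<rho> g w) w) (\<rho> (inv g) x)) = s (C * f x w) w" for w x
  proof (rule f_eqI)
    fix y
    have "f y (\<rho> (inv g) x) = f (\<rho> g y) x" if "g \<in> carrier N" for g
      using f_invariant[OF that, of y "\<rho> (inv g) x"] act(6)[OF that] by simp
    then have "f y (\<Sum>g\<in>carrier N. s (f (\<rho> g w) w) (\<rho> (inv g) x)) = (\<Sum>g\<in>carrier N. f (\<rho> g w) w * f (\<rho> g y) x)"
      by (simp add: f_sum_right f_scale_right cong: sum.cong)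
    \<comment> \<open>Orthogonality gives C f(w, y) f(w, x); exchanging the arguments in both
      factors costs no sign.\<close>
    also have "\<dots> = f y (s (C * f x w) w)"
      by (simp add: C f_scale_right f_antisym[of w y] f_antisym[of w x])
    finally show "f y (\<Sum>g\<in>carrier N. s (f (\<rho> g w) w) (\<rho> (inv g) x)) = f y (s (C * f x w) w)" .
  qed
  with n that show ?thesis by blast
qed

end

lemma symplectic_form_scale:
  assumes "symplectic_form G s \<rho> f" "c \<noteq> 0"
  shows "symplectic_form G s \<rho> (\<lambda>x y. c * f x y)"
  using assms by (auto simp: symplectic_form_def bilinear_map_iff algebra_simps)

section \<open>Lattices\<close>

context unramified_dvf
begin

text \<open>All is read off the coordinates in an \<O>-basis. The fourth fact holds for every large
  m so that two vectors can be scaled into L by the same power of l; the fifth is l-adic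
  separatedness.\<close>

lemma lattice_facts:
  assumes V: "vector_space s" and L: "is_lattice v s L"
  shows "0 \<in> L" "\<And>x y. x \<in> L \<Longrightarrow> y \<in> L \<Longrightarrow> x + y \<in> L"
    "\<And>a x. a \<in> val_ring v \<Longrightarrow> x \<in> L \<Longrightarrow> s a x \<in> L"
    and "\<And>x. \<exists>n. \<forall>m\<ge>n. s (of_nat l ^ m) x \<in> L"
    and "\<And>x. x \<noteq> 0 \<Longrightarrow> \<exists>n0. \<forall>n. x \<in> s (of_nat l ^ n) ` L \<longrightarrow> n < n0"
proof -
  interpret vector_space s by fact
  obtain B where B: "finite B" "independent B" "span B = UNIV"
    and LB: "L = {\<Sum>b\<in>B. s (c b) b | c. \<forall>b\<in>B. c b \<in> val_ring v}"
    using L by (auto simp: is_lattice_def)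
  let ?r = "representation B"
  have rep: "(\<Sum>b\<in>B. s (?r x b) b) = x" for x using B by (intro sum_representation_eq) auto
  have radd: "?r (x + y) b = ?r x b + ?r y b" and rscale: "?r (s a x) b = a * ?r x b" for x y a b
    using B by (simp_all add: representation_add representation_scale)
  have rB: "?r (\<Sum>b\<in>B. s (c b) b) b' = c b'" if "b' \<in> B" for c b'
    using B that by (simp add: representation_sum representation_scale representation_basis
        if_distrib[of "\<lambda>x. _ * x"] sum.delta' cong: if_cong)
  have iff: "x \<in> L \<longleftrightarrow> (\<forall>b\<in>B. ?r x b \<in> val_ring v)" for x
  proof
    assume "x \<in> L"
    then obtain c where "x = (\<Sum>b\<in>B. s (c b) b)" "\<forall>b\<in>B. c b \<in> val_ring v" by (auto simp: LB)
    then show "\<forall>b\<in>B. ?r x b \<in> val_ring v" using rB by auto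
  next
    assume "\<forall>b\<in>B. ?r x b \<in> val_ring v"
    then show "x \<in> L" unfolding LB using rep[of x, symmetric] by blast
  qed
  show "0 \<in> L" by (simp add: iff representation_zero)
  show "x + y \<in> L" if "x \<in> L" "y \<in> L" for x y
    using that by (auto simp: iff radd intro: val_ring_add)
  show "s a x \<in> L" if "a \<in> val_ring v" "x \<in> L" for a x
    using that by (auto simp: iff rscale intro: val_ring_mult)
  show "\<exists>n. \<forall>m\<ge>n. s (of_nat l ^ m) x \<in> L" for x
  proof -
    define n where "n = (\<Sum>b\<in>B. nat (- v (?r x b)))"
    have "of_nat l ^ m * ?r x b \<in> val_ring v" if "b \<in> B" "m \<ge> n" for b m
    proof (cases "?r x b = 0")
      case False
      have "nat (- v (?r x b)) \<le> n" unfolding n_def using B(1) that(1) by (intro member_le_sum) auto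
      then have "v (?r x b) + int m \<ge> 0" using that(2) by linarith
      then show ?thesis using False by (simp add: val_ring_def v_mult v_power v_l)
    qed simp
    then show ?thesis by (auto simp: iff rscale)
  qed
  show "\<exists>n0. \<forall>n. x \<in> s (of_nat l ^ n) ` L \<longrightarrow> n < n0" if "x \<noteq> 0" for x
  proof -
    obtain b where b: "b \<in> B" "?r x b \<noteq> 0"
    proof (rule ccontr)
      assume "\<not> thesis"
      then have "?r x b = 0" if "b \<in> B" for b using that \<open>\<And>b. \<lbrakk>b \<in> B; ?r x b \<noteq> 0\<rbrakk> \<Longrightarrow> thesis\<close> by blast
      then show False using rep[of x] \<open>x \<noteq> 0\<close> by simp
    qed
    have "n < nat (v (?r x b)) + 1" if x: "x \<in> s (of_nat l ^ n) ` L" for n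
    proof -
      obtain y where y: "y \<in> L" "x = s (of_nat l ^ n) y" using x by blast
      then have "?r x b = of_nat l ^ n * ?r y b" "?r y b \<in> val_ring v" using b by (auto simp: rscale iff)
      moreover from this have "?r y b \<noteq> 0" using b(2) by auto
      ultimately have "v (?r x b) \<ge> int n" by (simp add: v_mult v_power v_l val_ring_def)
      then show ?thesis by linarith
    qed
    then show ?thesis by blast
  qed
qed

text \<open>Outside L the values of f' mean nothing. Its matrix in an \<O>-basis of L defines F on
  all of V, so that later arguments may divide by l.\<close>

lemma lattice_form_extends:
  assumes V: "vector_space s" and L: "is_lattice v s L" and f': "lattice_pairing v s L f'"
  shows "\<exists>F. bilinear_map s s (*) F \<and> (\<forall>x\<in>L. \<forall>y\<in>L. F x y = f' x y)"
proof -
  interpret vector_space s by fact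
  note LF = lattice_facts[OF V L]
  obtain B where B: "finite B" "independent B" "span B = UNIV"
    and LB: "L = {\<Sum>b\<in>B. s (c b) b | c. \<forall>b\<in>B. c b \<in> val_ring v}"
    using L by (auto simp: is_lattice_def)
  let ?r = "representation B"
  define F where "F x y = (\<Sum>b\<in>B. \<Sum>b'\<in>B. ?r x b * ?r y b' * f' b b')" for x y
  have radd: "?r (x + y) b = ?r x b + ?r y b" and rscale: "?r (s a x) b = a * ?r x b" for x y a b
    using B by (simp_all add: representation_add representation_scale)
  have rB: "?r (\<Sum>b\<in>B. s (c b) b) b' = c b'" if "b' \<in> B" for c b'
    using B that by (simp add: representation_sum representation_scale representation_basis
        if_distrib[of "\<lambda>x. _ * x"] sum.delta' cong: if_cong)
  have "bilinear_map s s (*) F"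
    using vector_space_axioms vector_space_mult
    by (auto simp: bilinear_map_iff F_def radd rscale distrib_left distrib_right sum.distrib sum_distrib_left mult_ac)
  have BL: "b \<in> L" if "b \<in> B" for b
  proof -
    have "(\<Sum>b'\<in>B. s (if b' = b then 1 else 0) b') = b"
      using B(1) that by (simp add: if_distrib[of "\<lambda>x. s x _"] sum.delta' cong: if_cong)
    then show ?thesis unfolding LB by (intro CollectI exI[of _ "\<lambda>b'. if b' = b then 1 else 0"]) auto
  qed
  have dual: "restrict (f' x) L \<in> lattice_dual v s L" "restrict (\<lambda>y. f' y x) L \<in> lattice_dual v s L" if "x \<in> L" for x
    using f' that by (auto simp: lattice_pairing_def)
  have add: "f' x (y + z) = f' x y + f' x z" "f' (y + z) x = f' y x + f' z x" if "x \<in> L" "y \<in> L" "z \<in> L" for x y z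
    using dual[OF that(1)] that LF(2) by (auto simp: lattice_dual_def)
  have scale: "f' x (s a y) = a * f' x y" "f' (s a y) x = a * f' y x" if "x \<in> L" "y \<in> L" "a \<in> val_ring v" for x y a
    using dual[OF that(1)] that LF(3) by (auto simp: lattice_dual_def)
  have zero: "f' x 0 = 0" "f' 0 x = 0" if "x \<in> L" for x
    using scale[OF that LF(1), of 0] by auto
  have inL: "(\<Sum>b\<in>A. s (c b) b) \<in> L" if "A \<subseteq> B" "\<forall>b\<in>B. c b \<in> val_ring v" for A c
    using that by (induction A rule: infinite_finite_induct) (auto simp: LF BL)
  have sum: "f' x (\<Sum>b\<in>A. s (c b) b) = (\<Sum>b\<in>A. c b * f' x b)" "f' (\<Sum>b\<in>A. s (c b) b) x = (\<Sum>b\<in>A. c b * f' b x)"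
    if "A \<subseteq> B" "\<forall>b\<in>B. c b \<in> val_ring v" "x \<in> L" for A c x
    using that by (induction A rule: infinite_finite_induct) (auto simp: zero add scale LF BL inL)
  have "F x y = f' x y" if xy: "x \<in> L" "y \<in> L" for x y
  proof -
    obtain c where c: "x = (\<Sum>b\<in>B. s (c b) b)" "\<forall>b\<in>B. c b \<in> val_ring v" using xy by (auto simp: LB)
    obtain d where d: "y = (\<Sum>b\<in>B. s (d b) b)" "\<forall>b\<in>B. d b \<in> val_ring v" using xy by (auto simp: LB)
    have "f' x y = (\<Sum>b\<in>B. c b * f' b y)" using sum(2)[OF subset_refl c(2) xy(2)] c(1) by simp
    also have "\<dots> = (\<Sum>b\<in>B. c b * (\<Sum>b'\<in>B. d b' * f' b b'))"
      using sum(1)[OF subset_refl d(2) BL] d(1) by (intro sum.cong) auto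
    also have "\<dots> = F x y"
      using c(1) d(1) rB by (simp add: F_def sum_distrib_left mult.assoc)
    finally show ?thesis by simp
  qed
  with \<open>bilinear_map s s (*) F\<close> show ?thesis by blast
qed

end

section \<open>The module over \<open>N \<times> \<mu>\<^sub>l\<close>\<close>

context cyclotomic_extension
begin

lemma root_group_simps [simp]: "carrier (root_group \<zeta>) = range (\<lambda>i::nat. \<zeta> ^ i)"
  "x \<otimes>\<^bsub>root_group \<zeta>\<^esub> y = x * y" "\<one>\<^bsub>root_group \<zeta>\<^esub> = 1"
  by (simp_all add: root_group_def)

lemma group_root_group: "group (root_group \<zeta>)"
proof (rule groupI; clarsimp)
  show "\<zeta> ^ i * \<zeta> ^ j \<in> range ((^) \<zeta>)" for i j by (simp flip: power_add)
  show "1 \<in> range ((^) \<zeta>)" by (rule range_eqI[of _ _ 0]) simp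
  fix i
  have "i * (l - 1) + i = l * i" using l_pos by (cases l) auto
  then have "\<zeta> ^ (i * (l - 1)) * \<zeta> ^ i = \<zeta> ^ (l * i)" by (simp only: power_add [symmetric])
  also have "\<dots> = 1" by (simp add: power_mult)
  finally show "\<exists>x. \<zeta> ^ x * \<zeta> ^ i = 1" by blast
qed

lemma cnj_root_group: "z \<in> carrier (root_group \<zeta>) \<Longrightarrow> z * cnj z = 1"
  by (auto simp: cnj_zeta power_inverse)

lemma root_group_generator:
  assumes "y \<in> carrier (root_group \<zeta>)" "y \<noteq> 1"
  shows "\<exists>j. y ^ j = \<zeta>"
proof -
  obtain i where i: "y = \<zeta> ^ i" using assms by auto
  have "\<not> l dvd i"
  proof
    assume "l dvd i"
    then obtain k where "i = l * k" by blast
    then show False using assms(2) i by (simp add: power_mult)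
  qed
  then have "coprime i l" using prime_l by (metis coprime_commute prime_imp_coprime)
  moreover have "i \<noteq> 0" using assms(2) i by (cases i) auto
  ultimately obtain j k where "i * j = l * k + 1"
    using bezout_nat[of i l] by auto
  then have "\<zeta> ^ (i * j) = (\<zeta> ^ l) ^ k * \<zeta>" by (simp add: power_add power_mult)
  also have "\<dots> = \<zeta>" by simp
  finally show ?thesis using i by (metis power_mult)
qed

end

locale cyclotomic_twist = cyclotomic_extension v l \<iota> \<zeta> + W: simple_symplectic_module U N sW \<rho> f1
    + T: tensor_product sW "ext_scale \<iota>" sV tensor
  for v :: "'k::field_char_0 \<Rightarrow> int" and l and \<iota> :: "'k \<Rightarrow> 'l::field" and \<zeta>
    and U :: "'u::ab_group_add itself" and N :: "('n, 'm) monoid_scheme"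
    and sW :: "'k \<Rightarrow> 'w::ab_group_add \<Rightarrow> 'w" and \<rho> f1
    and sV :: "'k \<Rightarrow> 'v::ab_group_add \<Rightarrow> 'v" and tensor +
  assumes order_N: "\<not> l dvd Coset.order N" and faithful_N: "faithful_action N UNIV \<rho>"
begin

abbreviation "G \<equiv> N \<times>\<times> root_group \<zeta>"

section \<open>The action on the tensor product and its symplectic form\<close>

definition gact :: "'n \<times> 'l \<Rightarrow> 'v \<Rightarrow> 'v" where
  "gact g = T.lift sV (\<lambda>w \<alpha>. tensor (\<rho> (fst g) w) (snd g * \<alpha>))"

lemma group_G: "group G"
  by (rule DirProd_group[OF W.group_N group_root_group])

lemma gact_bilinear:
  "fst g \<in> carrier N \<Longrightarrow> bilinear_map sW (ext_scale \<iota>) sV (\<lambda>w \<alpha>. tensor (\<rho> (fst g) w) (snd g * \<alpha>))"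
  using W.vector_space_axioms vs.vector_space_axioms T.V3.vector_space_axioms T.scale_right
  by (auto simp: bilinear_map_iff W.act T.add_left T.add_right T.scale_left ext_scale_def distrib_left mult.left_commute[of "snd g"])

lemma gact_tensor: "n \<in> carrier N \<Longrightarrow> gact (n, z) (tensor w \<alpha>) = tensor (\<rho> n w) (z * \<alpha>)"
  using T.lift_tensor[OF gact_bilinear[of "(n, z)"]] by (simp add: gact_def)

lemma gact_linear: "n \<in> carrier N \<Longrightarrow> Vector_Spaces.linear sV sV (gact (n, z))"
  using T.linear_lift[OF gact_bilinear[of "(n, z)"]] by (simp add: gact_def)

lemma gact_add: "n \<in> carrier N \<Longrightarrow> gact (n, z) (x + y) = gact (n, z) x + gact (n, z) y"
  and gact_scale: "n \<in> carrier N \<Longrightarrow> gact (n, z) (sV a x) = sV a (gact (n, z) x)"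
  using gact_linear by (auto simp: Vector_Spaces.linear_iff)

lemma group_module_gact: "group_module G sV gact"
proof (rule group_moduleI[OF group_G T.V3.vector_space_axioms])
  show "Vector_Spaces.linear sV sV (gact g)" if "g \<in> carrier G" for g
    using that gact_linear by (cases g) auto
  show "gact (g \<otimes>\<^bsub>G\<^esub> h) x = gact g (gact h x)" if "g \<in> carrier G" "h \<in> carrier G" for g h x
  proof -
    obtain n z n' z' where "g = (n, z)" "h = (n', z')" by (cases g, cases h)
    then show ?thesis using that
      by (induction x rule: T.induct_tensor) (simp_all add: gact_tensor W.act mult.assoc gact_add)
  qed
  show "gact \<one>\<^bsub>G\<^esub> x = x" for x
    by (induction x rule: T.induct_tensor) (simp_all add: gact_tensor W.act gact_add)
qed

text \<open>If (n, \<zeta>^i) and (n', \<zeta>^j) act alike, then n w \<otimes> y = n' w \<otimes> 1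
  with y = \<zeta>^(i-j). For y \<noteq> 1 a functional with values 0 at y and 1 at 1 gives n' w = 0
  for all w, absurd; for y = 1 contraction gives n w = n' w.\<close>

lemma faithful_gact: "faithful_action G UNIV gact"
proof -
  have act: "group_action G UNIV gact" using group_module_gact by (simp add: group_module_def)
  have "inj_on gact (carrier G)"
  proof (rule inj_onI, clarsimp)
    fix n i n' j assume n: "n \<in> carrier N" "n' \<in> carrier N" and eq: "gact (n, \<zeta> ^ i) = gact (n', \<zeta> ^ j)"
    define y where "y = \<zeta> ^ i / \<zeta> ^ j"
    have t: "tensor (\<rho> n w) y = tensor (\<rho> n' w) 1" for w
      using fun_cong[OF eq, of "tensor w (1 / \<zeta> ^ j)"] n by (simp add: gact_tensor y_def)
    have "y = 1"
    proof (rule ccontr)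
      assume "y \<noteq> 1"
      have "y = \<zeta> ^ (i + j * (l - 1))"
      proof -
        have "i + j * (l - 1) + j = i + l * j" using l_pos by (cases l) auto
        then have "\<zeta> ^ (i + j * (l - 1)) * \<zeta> ^ j = \<zeta> ^ (i + l * j)" by (simp only: power_add [symmetric])
        also have "\<dots> = \<zeta> ^ i" by (simp add: power_add power_mult)
        finally show ?thesis by (simp add: y_def field_simps)
      qed
      then have "y \<in> carrier (root_group \<zeta>)" by simp
      then obtain k where "y ^ k = \<zeta>" using root_group_generator \<open>y \<noteq> 1\<close> by blast
      then obtain \<psi> where \<psi>: "Vector_Spaces.linear (ext_scale \<iota>) (*) \<psi>" "\<psi> 1 = 1" "\<psi> y = 0"
        using functional_exists by blast
      obtain h where h: "\<And>x \<alpha>. h (tensor x \<alpha>) = sW (\<psi> \<alpha>) x" using T.contract_right[OF \<psi>(1)] by metis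
      have "\<rho> n' w = 0" for w using arg_cong[OF t[of w], of h] by (simp add: h \<psi>)
      then have "\<rho> (inv\<^bsub>N\<^esub> n') 0 = w" for w using W.act(7)[OF n(2), of w] by simp
      then show False using W.nonzero by metis
    qed
    obtain \<psi> where \<psi>: "Vector_Spaces.linear (ext_scale \<iota>) (*) \<psi>" "\<psi> 1 = 1"
      using functional_exists[of \<zeta> 1] by auto
    obtain h where h: "\<And>x \<alpha>. h (tensor x \<alpha>) = sW (\<psi> \<alpha>) x" using T.contract_right[OF \<psi>(1)] by metis
    have "\<rho> n w = \<rho> n' w" for w using arg_cong[OF t[of w], of h] by (simp add: h \<psi> \<open>y = 1\<close>)
    then have "\<rho> n = \<rho> n'" by blast
    then have "n = n'"
      using faithful_N n by (simp add: faithful_action_def faithful_action_axioms_def inj_on_def)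
    moreover have "\<zeta> ^ i = \<zeta> ^ j" using \<open>y = 1\<close> by (simp add: y_def)
    ultimately show "n = n' \<and> \<zeta> ^ i = \<zeta> ^ j" by simp
  qed
  then show ?thesis using act by (simp add: faithful_action_def faithful_action_axioms_def)
qed

lemma trace_form_bilinear: "bilinear_map (ext_scale \<iota>) (ext_scale \<iota>) (*) (\<lambda>\<alpha> \<beta>. field_trace \<iota> (\<alpha> * cnj \<beta>))"
proof -
  have "field_trace \<iota> (x * (\<iota> a * y)) = a * field_trace \<iota> (x * y)" for a x y
    using trace_scale[of a "x * y"] by (simp add: mult.left_commute)
  then show ?thesis
    using vs.vector_space_axioms vector_space_mult
    by (auto simp: bilinear_map_iff ext_scale_def distrib_left distrib_right trace_add trace_scale mult.assoc)
qed

text \<open>This symmetry makes the product with the alternating form on W antisymmetric.\<close>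

lemma trace_form_sym: "field_trace \<iota> (\<alpha> * cnj \<beta>) = field_trace \<iota> (\<beta> * cnj \<alpha>)"
  using trace_cnj[of "\<alpha> * cnj \<beta>"] by (simp add: mult.commute)

lemma symplectic_form_exists:
  obtains f where "symplectic_form G sV gact f"
    "\<forall>w \<alpha> w' \<beta>. f (tensor w \<alpha>) (tensor w' \<beta>) = f1 w w' * field_trace \<iota> (\<alpha> * cnj \<beta>)"
proof -
  obtain f where f: "bilinear_map sV sV (*) f"
    "\<And>w \<alpha> w' \<beta>. f (tensor w \<alpha>) (tensor w' \<beta>) = f1 w w' * field_trace \<iota> (\<alpha> * cnj \<beta>)"
    using T.bilinear_form_exists[OF W.f_bilinear trace_form_bilinear] by metis
  have fadd: "f (x + y) z = f x z + f y z" "f x (y + z) = f x y + f x z" for x y z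
    using f(1) by (auto simp: bilinear_map_iff)
  have anti: "f x y = - f y x" for x y
  proof (induction x rule: T.induct_tensor)
    case (tensor w \<alpha>)
    show ?case
    proof (induction y rule: T.induct_tensor)
      case (tensor w' \<beta>)
      show ?case using W.f_antisym[of w w'] by (simp add: f trace_form_sym)
    qed (simp add: fadd)
  qed (simp add: fadd)
  have self: "f x x = 0" for x using anti[of x x] by simp
  have inv: "f (gact g x) (gact g y) = f x y" if "g \<in> carrier G" for g x y
  proof -
    obtain n z where nz: "g = (n, z)" by (cases g)
    then have g: "g = (n, z)" "n \<in> carrier N" "z \<in> carrier (root_group \<zeta>)" using that by simp_all
    have z: "z * \<alpha> * (cnj z * cnj \<beta>) = \<alpha> * cnj \<beta>" for \<alpha> \<beta>
    proof -
      have "z * \<alpha> * (cnj z * cnj \<beta>) = z * cnj z * (\<alpha> * cnj \<beta>)" by (simp only: mult_ac)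
      then show ?thesis by (simp only: cnj_root_group[OF g(3)] mult_1)
    qed
    show ?thesis
    proof (induction x rule: T.induct_tensor)
      case (tensor w \<alpha>)
      show ?case
      proof (induction y rule: T.induct_tensor)
        case (tensor w' \<beta>)
        show ?case using g(1,2) by (simp add: f gact_tensor W.f_invariant z)
      qed (use g in \<open>simp add: fadd gact_add\<close>)
    qed (use g in \<open>simp add: fadd gact_add\<close>)
  qed
  have nondeg: "x = 0" if x: "\<forall>y. f x y = 0" for x
  proof -
    \<comment> \<open>Write x as the sum of the b \<otimes> \<kappa>_b(x) with \<kappa>_b(x) in L.
      Pairing x with E b \<otimes> \<beta> gives, up to sign, the trace of \<kappa>_b(x) times the
      conjugate of \<beta>, so nondegeneracy of the trace makes every \<kappa>_b(x) vanish.\<close>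
    obtain B0 where B0: "finite B0" "W.span B0 = UNIV" using W.finite_spanning by blast
    obtain B E where "finite B" "W.independent B" "W.span B = UNIV"
      and E: "\<forall>y. y = (\<Sum>b\<in>B. sW (f1 (E b) y) b)" "\<forall>b\<in>B. f1 (E b) b = 1"
      by (rule W.dual_basis_exists[OF B0 W.f_bilinear W.f_nondegenerate])
    have "Vector_Spaces.linear sW (*) (f1 (E b))" for b
      using W.f_bilinear by (simp add: bilinear_map_def)
    then have "\<exists>h. Vector_Spaces.linear sV (ext_scale \<iota>) h \<and> (\<forall>w \<alpha>. h (tensor w \<alpha>) = \<iota> (f1 (E b) w) * \<alpha>)" for b
      using T.contract_left[of "f1 (E b)"] by (metis ext_scale_def)
    then obtain \<kappa> where \<kappa>: "\<And>b. Vector_Spaces.linear sV (ext_scale \<iota>) (\<kappa> b)"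
      "\<And>b w \<alpha>. \<kappa> b (tensor w \<alpha>) = \<iota> (f1 (E b) w) * \<alpha>" by metis
    have \<kappa>add: "\<kappa> b (x + y) = \<kappa> b x + \<kappa> b y" for b x y using \<kappa>(1) by (simp add: Vector_Spaces.linear_iff)
    have "f x (tensor (E b) \<beta>) = - field_trace \<iota> (\<kappa> b x * cnj \<beta>)" for b \<beta>
    proof (induction x rule: T.induct_tensor)
      case (tensor w \<alpha>)
      show ?case using W.f_antisym[of w "E b"] by (simp add: f \<kappa> mult.assoc trace_scale)
    qed (simp add: fadd \<kappa>add distrib_right trace_add)
    then have "field_trace \<iota> (\<kappa> b x * cnj \<beta>) = 0" for b \<beta> using x by simp
    then have "field_trace \<iota> (\<kappa> b x * \<beta>) = 0" for b \<beta> by (metis cnj_cnj)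
    then have \<kappa>0: "\<kappa> b x = 0" for b by (rule trace_nondegenerate)
    have "x = (\<Sum>b\<in>B. tensor b (\<kappa> b x))"
    proof (induction x rule: T.induct_tensor)
      case (tensor w \<alpha>)
      have "tensor w \<alpha> = tensor (\<Sum>b\<in>B. sW (f1 (E b) w) b) \<alpha>"
        by (rule arg_cong[where f = "\<lambda>w. tensor w \<alpha>"]) (rule E(1)[rule_format])
      also have "\<dots> = (\<Sum>b\<in>B. tensor b (\<kappa> b (tensor w \<alpha>)))"
        using T.scale_right by (simp add: T.sum_left T.scale_left \<kappa> ext_scale_def)
      finally show ?case .
    next
      case (add x y)
      have "(\<Sum>b\<in>B. tensor b (\<kappa> b (x + y))) = (\<Sum>b\<in>B. tensor b (\<kappa> b x)) + (\<Sum>b\<in>B. tensor b (\<kappa> b y))"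
        by (simp add: \<kappa>add T.add_right sum.distrib)
      then show ?case using add by simp
    qed
    then show ?thesis by (simp add: \<kappa>0)
  qed
  have "symplectic_form G sV gact f"
    unfolding symplectic_form_def using f(1) self inv nondeg by blast
  then show ?thesis using that f(2) by blast
qed

text \<open>
  By invariance, \<open>a f\<^sub>1\<close> is integral on the \<open>\<O>\<close>-lattice spanned by the orbit of \<open>w\<close>, and takes the
  value \<open>1\<close> there.
\<close>

lemma normalized_form:
  obtains a w h where "a \<noteq> 0" "h \<in> carrier N" "a * f1 (\<rho> h w) w = 1"
    "\<forall>g\<in>carrier N. a * f1 (\<rho> g w) w \<in> val_ring v"
proof -
  obtain w :: 'w where "w \<noteq> 0" using W.nonzero by blast
  \<comment> \<open>Zero values are left out: \<open>v 0\<close> is arbitrary and would spoil the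
    minimum.\<close>
  define S where "S = {g. g \<in> carrier N \<and> f1 (\<rho> g w) w \<noteq> 0}"
  have S: "finite S" "S \<noteq> {}"
    using W.orbit_pairing_nonzero[OF \<open>w \<noteq> 0\<close>] W.finite_N by (auto simp: S_def)
  define m where "m = Min ((\<lambda>g. v (f1 (\<rho> g w) w)) ` S)"
  have "m \<in> (\<lambda>g. v (f1 (\<rho> g w) w)) ` S" unfolding m_def using S by (intro Min_in) auto
  then obtain h where h: "h \<in> S" "m = v (f1 (\<rho> h w) w)" by blast
  have le: "v (f1 (\<rho> h w) w) \<le> v (f1 (\<rho> g w) w)" if "g \<in> S" for g
    unfolding h(2) [symmetric] m_def using S that by (intro Min_le) auto
  define a where "a = inverse (f1 (\<rho> h w) w)"
  show ?thesis
  proof (rule that[of a h w])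
    show "a \<noteq> 0" "h \<in> carrier N" "a * f1 (\<rho> h w) w = 1" using h(1) by (auto simp: a_def S_def)
    show "\<forall>g\<in>carrier N. a * f1 (\<rho> g w) w \<in> val_ring v"
    proof
      fix g assume g: "g \<in> carrier N"
      show "a * f1 (\<rho> g w) w \<in> val_ring v"
      proof (cases "f1 (\<rho> g w) w = 0")
        case False
        then show ?thesis using g h(1) le[of g] by (auto simp: a_def S_def val_ring_def v_mult v_inverse)
      qed simp
    qed
  qed
qed

end

section \<open>Nonexistence of a stable unimodular lattice\<close>

context cyclotomic_twist
begin

text \<open>Identities known on L pass to V by scaling two vectors into L with one power of l.
  Perfectness is used in the form that L contains its own dual in V (\<open>F_dual\<close>): this is
  how elements of L, and with them elements of M, are produced.\<close>

lemma no_unimodular_lattice: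
  assumes L: "is_lattice v sV L" and stable: "\<forall>g\<in>carrier G. gact g ` L \<subseteq> L"
    and perfect: "perfect_pairing v sV L f'" and alt: "\<forall>x\<in>L. f' x x = 0"
    and inv: "\<forall>g\<in>carrier G. \<forall>x\<in>L. \<forall>y\<in>L. f' (gact g x) (gact g y) = f' x y"
  shows False
proof -
  note LF = lattice_facts[OF T.V3.vector_space_axioms L]
  have pairing: "lattice_pairing v sV L f'" using perfect by (simp add: perfect_pairing_def)
  obtain F where F: "bilinear_map sV sV (*) F" and Ff: "\<forall>x\<in>L. \<forall>y\<in>L. F x y = f' x y"
    using lattice_form_extends[OF T.V3.vector_space_axioms L pairing] by blast
  have F_add: "F (x + y) z = F x z + F y z" "F x (y + z) = F x y + F x z" for x y z
    using F by (auto simp: bilinear_map_iff)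
  have F_scale: "F (sV a x) y = a * F x y" "F x (sV a y) = a * F x y" for a x y
    using F by (auto simp: bilinear_map_iff)
  have F_diff: "F (x - y) z = F x z - F y z" for x y z
    using F_add(1)[of "x - y" y z] by simp
  have act_L: "gact (n, z) x \<in> L" if "n \<in> carrier N" "z \<in> carrier (root_group \<zeta>)" "x \<in> L" for n z x
  proof -
    have "(n, z) \<in> carrier G" using that by simp
    then show ?thesis using stable that(3) by blast
  qed
  have one_z: "1 \<in> carrier (root_group \<zeta>)" by (auto intro: range_eqI[of _ _ 0])
  have zeta_z: "\<zeta> \<in> carrier (root_group \<zeta>)" by (auto intro: range_eqI[of _ _ 1])
  have scale_into: "\<exists>a. a \<noteq> 0 \<and> sV a x \<in> L \<and> sV a y \<in> L" for x y
  proof -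
    obtain n1 n2 where "\<forall>m\<ge>n1. sV (of_nat l ^ m) x \<in> L" "\<forall>m\<ge>n2. sV (of_nat l ^ m) y \<in> L"
      using LF(4) by metis
    then show ?thesis by (intro exI[of _ "of_nat l ^ max n1 n2"]) auto
  qed
  have F_antisym: "F y x = - F x y" for x y
  proof -
    obtain a where a: "a \<noteq> 0" "sV a x \<in> L" "sV a y \<in> L" using scale_into by blast
    have self: "F u u = 0" if "u \<in> L" for u using Ff alt that by simp
    have "F (sV a x) (sV a y) + F (sV a y) (sV a x) = 0"
      using self[OF LF(2)[OF a(2,3)]] self[OF a(2)] self[OF a(3)] by (simp only: F_add) (simp add: add.commute)
    then have "a * (a * (F x y + F y x)) = 0" by (simp add: F_scale distrib_left)
    then have "F x y + F y x = 0" using a(1) by simp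
    then show ?thesis by (simp add: eq_neg_iff_add_eq_0 add.commute)
  qed
  have F_inv: "F (gact (n, z) x) (gact (n, z) y) = F x y"
    if nz: "n \<in> carrier N" "z \<in> carrier (root_group \<zeta>)" for n z x y
  proof -
    obtain a where a: "a \<noteq> 0" "sV a x \<in> L" "sV a y \<in> L" using scale_into by blast
    have "(n, z) \<in> carrier G" using nz by simp
    then have "f' (gact (n, z) (sV a x)) (gact (n, z) (sV a y)) = f' (sV a x) (sV a y)"
      using inv a by blast
    then have "F (gact (n, z) (sV a x)) (gact (n, z) (sV a y)) = F (sV a x) (sV a y)"
      using Ff a act_L[OF nz] by simp
    then show ?thesis using a(1) by (simp add: gact_scale nz F_scale)
  qed
  have F_integral: "F x y \<in> val_ring v" if "x \<in> L" "y \<in> L" for x y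
  proof -
    have "restrict (f' x) L \<in> lattice_dual v sV L" using pairing that by (simp add: lattice_pairing_def)
    then have "restrict (f' x) L y \<in> val_ring v" using that by (auto simp: lattice_dual_def dest: PiE_mem)
    then show ?thesis using Ff that by simp
  qed
  have bij: "bij_betw (\<lambda>x. restrict (f' x) L) L (lattice_dual v sV L)"
    using perfect by (simp add: perfect_pairing_def)
  have F_nondeg: "x = 0" if "\<And>y. y \<in> L \<Longrightarrow> F x y = 0" for x
  proof -
    obtain a where a: "a \<noteq> 0" "sV a x \<in> L" using scale_into by blast
    have F0: "F 0 y = 0" for y using F_scale(1)[of 0 0 y] by simp
    have "f' (sV a x) y = f' 0 y" if "y \<in> L" for y
    proof -
      have "f' (sV a x) y = F (sV a x) y" "f' 0 y = F 0 y" using Ff a(2) LF(1) that by simp_all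
      then show ?thesis using \<open>\<And>y. y \<in> L \<Longrightarrow> F x y = 0\<close>[OF that] by (simp add: F_scale F0)
    qed
    then have "restrict (f' (sV a x)) L = restrict (f' 0) L" by (rule restrict_ext)
    then have "sV a x = 0" using bij_betw_imp_inj_on[OF bij] a(2) LF(1) by (metis (no_types, lifting) inj_onD)
    then show ?thesis using a by simp
  qed
  \<comment> \<open>The functional F(x, -) on L is represented by some t in L, and nondegeneracy
    forces x = t.\<close>
  have F_dual: "x \<in> L" if x: "\<And>y. y \<in> L \<Longrightarrow> F x y \<in> val_ring v" for x
  proof -
    have "restrict (F x) L \<in> lattice_dual v sV L"
      using x LF by (auto simp: lattice_dual_def F_add F_scale)
    then have "restrict (F x) L \<in> (\<lambda>x. restrict (f' x) L) ` L"
      using bij by (simp add: bij_betw_def)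
    then obtain t where t: "restrict (F x) L = restrict (f' t) L" "t \<in> L" by (rule imageE)
    have "F (x - t) y = 0" if "y \<in> L" for y
      using fun_cong[OF t(1), of y] that t(2) Ff by (simp add: F_diff)
    then have "x - t = 0" by (rule F_nondeg)
    then show ?thesis using t by simp
  qed
  obtain a w h where a: "a \<noteq> 0" and h: "h \<in> carrier N" "a * f1 (\<rho> h w) w = 1"
    and int: "\<forall>g\<in>carrier N. a * f1 (\<rho> g w) w \<in> val_ring v"
    by (rule normalized_form)
  define f where "f x y = a * f1 x y" for x y
  interpret f: simple_symplectic_module U N sW \<rho> f
  proof unfold_locales
    show "symplectic_form N sW \<rho> f"
      using symplectic_form_scale[OF W.symplectic a] by (simp add: f_def[abs_def])
  qed (rule W.nonzero)
  have fh: "f (\<rho> h w) w = 1" "f w (\<rho> h w) = - 1" and int: "\<forall>g\<in>carrier N. f (\<rho> g w) w \<in> val_ring v"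
    using h int f.f_antisym[of w "\<rho> h w"] by (auto simp: f_def)
  obtain n C where n: "n > 0" "of_nat n * C = of_nat (Coset.order N)"
    and C: "\<forall>w x. (\<Sum>g\<in>carrier N. sW (f (\<rho> g w) w) (\<rho> (inv\<^bsub>N\<^esub> g) x)) = sW (C * f x w) w"
    by (rule f.projection_from_group_algebra)
  have ord: "of_nat (Coset.order N) \<noteq> (0 :: 'k)" "v (of_nat (Coset.order N)) = 0"
    using order_N v_of_nat_coprime[OF order_N] by (auto intro: ccontr)
  have C0: "C \<noteq> 0" using n ord by auto
  have "v (of_nat n) \<ge> 0" using val_ring_of_nat[of n] n(1) by (simp add: val_ring_def)
  moreover have "v (of_nat n) + v C = 0" using v_mult[of "of_nat n" C] n ord C0 by simp
  ultimately have C_inv: "inverse C \<in> val_ring v" using C0 by (simp add: val_ring_def v_inverse)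
  have f_lin: "Vector_Spaces.linear sW (*) (\<lambda>x. f x w)"
    using f.f_bilinear by (simp add: bilinear_map_def)
  obtain \<kappa> where \<kappa>: "Vector_Spaces.linear sV (ext_scale \<iota>) \<kappa>" "\<forall>x \<alpha>. \<kappa> (tensor x \<alpha>) = \<iota> (f x w) * \<alpha>"
    using T.contract_left[OF f_lin] by (metis ext_scale_def)
  have \<kappa>_add: "\<kappa> (x + y) = \<kappa> x + \<kappa> y" for x y using \<kappa>(1) by (simp add: Vector_Spaces.linear_iff)
  have t_scale: "tensor x (\<iota> a * \<alpha>) = sV a (tensor x \<alpha>)" for x a \<alpha>
    using T.scale_right[of x a \<alpha>] by (simp add: ext_scale_def)
  have L_sum: "(\<And>i. i \<in> I \<Longrightarrow> e i \<in> L) \<Longrightarrow> sum e I \<in> L" for e :: "'n \<Rightarrow> 'v" and I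
    by (induction I rule: infinite_finite_induct) (auto simp: LF)
  \<comment> \<open>The group algebra acts through the left factor only, so the identity on W
    carries over to pure tensors; its coefficients f(g w, w) are integral by the choice of
    w.\<close>
  have proj: "(\<Sum>g\<in>carrier N. sV (f (\<rho> g w) w) (gact (inv\<^bsub>N\<^esub> g, 1) x)) = sV C (tensor w (\<kappa> x))" for x
  proof (induction x rule: T.induct_tensor)
    case (tensor y \<alpha>)
    have "(\<Sum>g\<in>carrier N. sV (f (\<rho> g w) w) (gact (inv\<^bsub>N\<^esub> g, 1) (tensor y \<alpha>)))
        = tensor (\<Sum>g\<in>carrier N. sW (f (\<rho> g w) w) (\<rho> (inv\<^bsub>N\<^esub> g) y)) \<alpha>"
      by (simp add: gact_tensor T.sum_left T.scale_left cong: sum.cong)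
    also have "\<dots> = tensor (sW (C * f y w) w) \<alpha>" using C by simp
    also have "\<dots> = sV C (tensor w (\<kappa> (tensor y \<alpha>)))"
      using \<kappa>(2) by (simp add: T.scale_left t_scale)
    finally show ?case .
  next
    case (add x y)
    have "(\<Sum>g\<in>carrier N. sV (f (\<rho> g w) w) (gact (inv\<^bsub>N\<^esub> g, 1) (x + y)))
      = (\<Sum>g\<in>carrier N. sV (f (\<rho> g w) w) (gact (inv\<^bsub>N\<^esub> g, 1) x))
        + (\<Sum>g\<in>carrier N. sV (f (\<rho> g w) w) (gact (inv\<^bsub>N\<^esub> g, 1) y))"
      unfolding sum.distrib [symmetric]
      by (intro sum.cong) (simp_all add: gact_add T.V3.scale_right_distrib)
    then show ?case using add by (simp add: \<kappa>_add T.add_right T.V3.scale_right_distrib)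
  qed
  have \<kappa>_L: "tensor w (\<kappa> x) \<in> L" if "x \<in> L" for x
  proof -
    have "(\<Sum>g\<in>carrier N. sV (f (\<rho> g w) w) (gact (inv\<^bsub>N\<^esub> g, 1) x)) \<in> L"
      using that int one_z by (intro L_sum LF(3) act_L) auto
    then have "sV (inverse C) (sV C (tensor w (\<kappa> x))) \<in> L" unfolding proj using C_inv by (rule LF(3)[rotated])
    then show ?thesis using C0 by simp
  qed
  define M where "M = {\<alpha>. tensor w \<alpha> \<in> L}"
  \<comment> \<open>Evaluating at h w and w, where f is 1, reads off the coefficient; as h preserves
    L, it is integral on M.\<close>
  define c where "c \<alpha> \<beta> = F (tensor (\<rho> h w) \<alpha>) (tensor w \<beta>)" for \<alpha> \<beta>
  have c: "F (tensor x \<alpha>) (tensor y \<beta>) = c \<alpha> \<beta> * f x y" for x y \<alpha> \<beta>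
  proof -
    have "\<exists>b. \<forall>x y. F (tensor x \<alpha>) (tensor y \<beta>) = b * f x y"
    proof (rule f.invariant_form_multiple)
      show "bilinear_map sW sW (*) (\<lambda>x y. F (tensor x \<alpha>) (tensor y \<beta>))"
        using W.vector_space_axioms vector_space_mult
        by (simp add: bilinear_map_iff T.add_left T.scale_left F_add F_scale)
      show "F (tensor (\<rho> g x) \<alpha>) (tensor (\<rho> g y) \<beta>) = F (tensor x \<alpha>) (tensor y \<beta>)" if "g \<in> carrier N" for g x y
        using F_inv[OF that one_z, of "tensor x \<alpha>" "tensor y \<beta>"] that by (simp add: gact_tensor)
    qed
    then obtain b where b: "\<forall>x y. F (tensor x \<alpha>) (tensor y \<beta>) = b * f x y" by blast
    then have "b = c \<alpha> \<beta>" using fh by (simp add: c_def)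
    then show ?thesis using b by simp
  qed
  \<comment> \<open>Pairing with w \<otimes> \<alpha> sees only the projection of y. The sign comes
    from f(w, y) = - f(y, w).\<close>
  have c_\<kappa>: "F (tensor w \<alpha>) y = - c \<alpha> (\<kappa> y)" for \<alpha> y
  proof (induction y rule: T.induct_tensor)
    case (tensor y \<beta>)
    have "c \<alpha> (\<iota> (f y w) * \<beta>) = f y w * c \<alpha> \<beta>" by (simp add: c_def t_scale F_scale)
    then show ?case using \<kappa>(2) f.f_antisym[of w y] by (simp add: c)
  next
    case (add x y)
    have "c \<alpha> (\<kappa> x + \<kappa> y) = c \<alpha> (\<kappa> x) + c \<alpha> (\<kappa> y)" by (simp add: c_def T.add_right F_add)
    then show ?case using add by (simp add: F_add \<kappa>_add)
  qed
  have "w \<noteq> 0" using fh by auto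
  obtain \<psi> where \<psi>: "Vector_Spaces.linear sW (*) \<psi>" "\<psi> w = 1"
    using W.functional_separating[OF W.subspace_single_0, of w] \<open>w \<noteq> 0\<close> by blast
  obtain \<kappa>' where \<kappa>': "\<forall>x \<alpha>. \<kappa>' (tensor x \<alpha>) = \<iota> (\<psi> x) * \<alpha>"
    using T.contract_left[OF \<psi>(1)] by (metis ext_scale_def)
  have t_inj: "\<alpha> = \<beta>" if "tensor w \<alpha> = tensor w \<beta>" for \<alpha> \<beta>
    using arg_cong[OF that, of \<kappa>'] \<kappa>' \<psi>(2) by simp
  \<comment> \<open>A power of l, viewed in L, is a nonzero element of M; separatedness at its
    tensor with w supplies the bound \<open>n0\<close>.\<close>
  obtain k where k: "\<forall>m\<ge>k. sV (of_nat l ^ m) (tensor w 1) \<in> L" using LF(4) by blast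
  define \<alpha> where "\<alpha> = \<iota> (of_nat l ^ k)"
  have \<alpha>: "\<alpha> \<in> M" "\<alpha> \<noteq> 0"
    using k t_scale[of w "of_nat l ^ k" 1] by (auto simp: M_def \<alpha>_def)
  have "tensor w \<alpha> \<noteq> 0" using t_inj[of \<alpha> 0] \<alpha>(2) by auto
  then obtain n0 where n0: "\<forall>n. tensor w \<alpha> \<in> sV (of_nat l ^ n) ` L \<longrightarrow> n < n0" using LF(5) by blast
  have t_l: "tensor w (of_nat l ^ n * \<beta>) = sV (of_nat l ^ n) (tensor w \<beta>)" for n \<beta>
  proof -
    have "\<iota> (of_nat l ^ n) = of_nat l ^ n" by (metis \<iota>_of_nat of_nat_power)
    then show ?thesis using t_scale[of w "of_nat l ^ n" \<beta>] by simp
  qed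
  show False
  proof (rule no_unimodular_form[of M c \<alpha> n0])
    show "int_submodule M"
      unfolding int_submodule_def
    proof (intro conjI ballI)
      show "0 \<in> M" by (simp add: M_def LF(1))
      show "x + y \<in> M" if "x \<in> M" "y \<in> M" for x y using that by (simp add: M_def T.add_right LF(2))
      show "\<iota> r * x \<in> M" if "r \<in> val_ring v" "x \<in> M" for r x using that by (simp add: M_def t_scale LF(3))
      show "\<zeta> * x \<in> M" if "x \<in> M" for x
        using act_L[OF W.one_closed zeta_z, of "tensor w x"] that by (simp add: M_def gact_tensor W.act)
    qed
    show "c (x + y) z = c x z + c y z" for x y z by (simp add: c_def T.add_right F_add)
    show "c (\<iota> r * x) y = r * c x y" for r x y by (simp add: c_def t_scale F_scale)
    \<comment> \<open>F and f are both antisymmetric, so the two signs cancel.\<close>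
    show "c x y = c y x" for x y
      using F_antisym[of "tensor w x" "tensor (\<rho> h w) y"] fh by (simp add: c)
    show "c (\<zeta> * x) (\<zeta> * y) = c x y" for x y
      using F_inv[OF W.one_closed zeta_z, of "tensor (\<rho> h w) x" "tensor w y"]
      by (simp add: c_def gact_tensor W.act)
    show "c x y \<in> val_ring v" if "x \<in> M" "y \<in> M" for x y
    proof -
      have "tensor (\<rho> h w) x \<in> L" using act_L[OF h(1) one_z, of "tensor w x"] that h(1) by (simp add: M_def gact_tensor)
      then show ?thesis using F_integral that by (simp add: c_def M_def)
    qed
    show "x \<in> (*) (of_nat l) ` M" if x: "\<And>y. y \<in> M \<Longrightarrow> \<exists>a\<in>val_ring v. c x y = of_nat l * a" for x
    proof -
      have x': "x = of_nat l * (x / of_nat l)" by simp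
      \<comment> \<open>By self-duality it is enough that w \<otimes> x/l pairs integrally with L.
        Its pairing with y is, up to sign, the value of c at x/l and \<kappa> y, and \<kappa> maps L
        into M.\<close>
      have "tensor w (x / of_nat l) \<in> L"
      proof (rule F_dual)
        fix y assume "y \<in> L"
        then have "\<kappa> y \<in> M" using \<kappa>_L by (simp add: M_def)
        then obtain r where r: "r \<in> val_ring v" "c x (\<kappa> y) = of_nat l * r" using x by blast
        have "c x (\<kappa> y) = of_nat l * c (x / of_nat l) (\<kappa> y)"
          using t_scale[of "\<rho> h w" "of_nat l" "x / of_nat l"] by (simp add: c_def F_scale)
        then have "c (x / of_nat l) (\<kappa> y) = r" using r(2) by simp
        then show "F (tensor w (x / of_nat l)) y \<in> val_ring v" using r(1) by (simp add: c_\<kappa>)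
      qed
      then show ?thesis by (intro image_eqI[of x "(*) (of_nat l)" "x / of_nat l"] x') (simp add: M_def)
    qed
    show "\<alpha> \<in> M" by (rule \<alpha>(1))
    show "n < n0" if n: "\<alpha> \<in> (*) (of_nat l ^ n) ` M" for n
    proof -
      obtain \<beta> where "\<beta> \<in> M" "\<alpha> = of_nat l ^ n * \<beta>" using n by blast
      then have "tensor w \<alpha> \<in> sV (of_nat l ^ n) ` L" by (auto simp: M_def t_l)
      then show ?thesis using n0 by blast
    qed
  qed
qed

end

text \<open>The tensor product is given as data, so conjugation, action and form are quantified
  existentially. The stated values determine them: a K-automorphism is fixed by its value at the
  generator \<zeta>, the maps of the action and the form by their values on pure tensors.\<close>

theorem theorem6p2:
  fixes l :: nat
    and N :: "('n, 'm) monoid_scheme"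
    and v :: "'k::field_char_0 \<Rightarrow> int"
    and sW :: "'k \<Rightarrow> 'w::ab_group_add \<Rightarrow> 'w"
    and \<rho> :: "'n \<Rightarrow> 'w \<Rightarrow> 'w"
    and f\<^sub>1 :: "'w \<Rightarrow> 'w \<Rightarrow> 'k"
    and \<iota> :: "'k \<Rightarrow> 'l::field"
    and \<zeta> :: 'l
    and sV :: "'k \<Rightarrow> 'v::ab_group_add \<Rightarrow> 'v"
    and tensor :: "'w \<Rightarrow> 'l \<Rightarrow> 'v"
  assumes "prime l" and "odd l"
    and "group N" and "finite (carrier N)" and "\<not> l dvd Coset.order N"
    and "complete_dvf v" and "residue_char v l" and "unramified_over_Qp v l"
    and "group_module N sW \<rho>" and "\<exists>w::'w. w \<noteq> 0"
    and "absolutely_simple TYPE('u::ab_group_add) N sW \<rho>"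
    and "faithful_action N UNIV \<rho>"
    and "symplectic_form N sW \<rho> f\<^sub>1"
    and "field_extension \<iota>" and "primitive_root_of_unity l \<zeta>" and "generated_over \<iota> \<zeta>"
    and "is_tensor_product sW (ext_scale \<iota>) sV tensor"
  shows "\<exists>\<sigma> act f.
    ext_automorphism \<iota> \<sigma> \<and> \<sigma> \<zeta> = inverse \<zeta> \<and>
    group_module (N \<times>\<times> root_group \<zeta>) sV act \<and>
    (\<forall>n\<in>carrier N. \<forall>z\<in>carrier (root_group \<zeta>). \<forall>w \<alpha>.
       act (n, z) (tensor w \<alpha>) = tensor (\<rho> n w) (z * \<alpha>)) \<and>
    faithful_action (N \<times>\<times> root_group \<zeta>) UNIV act \<and>
    symplectic_form (N \<times>\<times> root_group \<zeta>) sV act f \<and>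
    (\<forall>w \<alpha> w' \<beta>. f (tensor w \<alpha>) (tensor w' \<beta>) = f\<^sub>1 w w' * field_trace \<iota> (\<alpha> * \<sigma> \<beta>)) \<and>
    \<not> (\<exists>T f'. is_lattice v sV T \<and>
         (\<forall>g\<in>carrier (N \<times>\<times> root_group \<zeta>). act g ` T \<subseteq> T) \<and>
         perfect_pairing v sV T f' \<and>
         (\<forall>x\<in>T. f' x x = 0) \<and>
         (\<forall>g\<in>carrier (N \<times>\<times> root_group \<zeta>). \<forall>x\<in>T. \<forall>y\<in>T. f' (act g x) (act g y) = f' x y))"
proof -
  interpret cyclotomic_twist v l \<iota> \<zeta> "TYPE('u)" N sW \<rho> f\<^sub>1 sV tensor
    using assms
    by (intro cyclotomic_twist.intro cyclotomic_extension.intro unramified_dvf.intro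
        unramified_dvf_axioms.intro cyclotomic_extension_axioms.intro simple_symplectic_module.intro
        simple_symplectic_module_axioms.intro absolutely_simple_module.intro tensor_product.intro
        cyclotomic_twist_axioms.intro)
  obtain f where f: "symplectic_form G sV gact f"
    "\<forall>w \<alpha> w' \<beta>. f (tensor w \<alpha>) (tensor w' \<beta>) = f\<^sub>1 w w' * field_trace \<iota> (\<alpha> * cnj \<beta>)"
    by (rule symplectic_form_exists)
  show ?thesis
  proof (intro exI[of _ cnj] exI[of _ gact] exI[of _ f] conjI)
    show "\<forall>n\<in>carrier N. \<forall>z\<in>carrier (root_group \<zeta>). \<forall>w \<alpha>. gact (n, z) (tensor w \<alpha>) = tensor (\<rho> n w) (z * \<alpha>)"
      using gact_tensor by blast
    show "\<not> (\<exists>T f'. is_lattice v sV T \<and> (\<forall>g\<in>carrier G. gact g ` T \<subseteq> T) \<and> perfect_pairing v sV T f' \<and>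
        (\<forall>x\<in>T. f' x x = 0) \<and> (\<forall>g\<in>carrier G. \<forall>x\<in>T. \<forall>y\<in>T. f' (gact g x) (gact g y) = f' x y))"
      using no_unimodular_lattice by blast
  qed (rule ext_automorphism_cnj cnj_zeta group_module_gact faithful_gact f)+
qed

end
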